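(* Let $F$ be a norm form associated to a number field of degree $r\ge2$. There are positive constants $c_F,C_F$, depending only on $F$, such that the following holds for every integer $N\ge3$. Let $A_1,\ldots,A_r\subseteq[N]$ and $g\ge1$, and suppose $R_{A_1,\ldots,A_r,F}(m)\le g$ for every $m\in\mathbb Z$. Then $$\prod_{i=1}^r|A_i|\le C_F\,g^{1/r}N^r\exp\left(-c_F\frac{\log N}{\log\log N}\right).$$
   Context: $[N]=\{1,\ldots,N\}$. Let $K$ be a number field of degree $r$ with ring of integers $\mathcal O_K$. A homogeneous polynomial $F\in\mathbb Z[x_1,\ldots,x_r]$ is a norm form associated to $K$ if there are $\omega_1,\ldots,\omega_r\in\mathcal O_K$, spanning a full-rank $\mathbb Z$-module, such that $F(x_1,\ldots,x_r)=N_{K/\mathbb Q}(x_1\omega_1+\cdots+x_r\omega_r)$ for all $(x_1,\ldots,x_r)\in\mathbb Z^r$. For $A_1,\ldots,A_r\subseteq[N]$ and $m\in\mathbb Z$, $R_{A_1,\ldots,A_r,F}(m):=\#\{(a_1,\ldots,a_r)\in A_1\times\cdots\times A_r: F(a_1,\ldots,a_r)=m\}$. *)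

theory Defs
  imports Complex_Main
    "HOL-Library.FuncSet"
    "HOL-Library.Extended_Nat"
    "HOL-Library.Poly_Mapping"
    "HOL-Computational_Algebra.Polynomial"
    "Jordan_Normal_Form.Determinant"
begin

section \<open>Number fields\<close>

text \<open>A number field is a subfield, of finite dimension over the rationals, of an arbitrary
  ambient field of characteristic 0 (possibly the whole ambient field).\<close>

global_interpretation rat_vs: vector_space "\<lambda>(q::rat) (x::'a::field_char_0). of_rat q * x"
  by unfold_locales (simp_all add: of_rat_add of_rat_mult algebra_simps)

global_interpretation int_mod: Modules.module "\<lambda>(n::int) (x::'a::field_char_0). of_int n * x"
  by unfold_locales (simp_all add: algebra_simps)

definition is_subfield :: "'a::field_char_0 set \<Rightarrow> bool" where
  "is_subfield K \<longleftrightarrow> 1 \<in> K \<and> (\<forall>x\<in>K. \<forall>y\<in>K. x - y \<in> K \<and> x * y \<in> K) \<and> (\<forall>x\<in>K. inverse x \<in> K)"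

definition number_field :: "'a::field_char_0 set \<Rightarrow> bool" where
  "number_field K \<longleftrightarrow> is_subfield K \<and> (\<exists>B. finite B \<and> rat_vs.span B = K)"

definition field_degree :: "'a::field_char_0 set \<Rightarrow> nat" where
  "field_degree K = rat_vs.dim K"

definition ring_of_integers :: "'a::field_char_0 set \<Rightarrow> 'a set" where
  "ring_of_integers K = {x \<in> K. algebraic_int x}"

definition ordered_basis :: "'a::field_char_0 set \<Rightarrow> 'a list \<Rightarrow> bool" where
  "ordered_basis K b \<longleftrightarrow>
     distinct b \<and> rat_vs.independent (set b) \<and> rat_vs.span (set b) = K"

text \<open>Column \<open>j\<close> holds the coordinates of \<open>\<alpha> * b ! j\<close> in the basis \<open>b\<close>.\<close>

definition mult_matrix :: "'a::field_char_0 list \<Rightarrow> 'a \<Rightarrow> rat mat" where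
  "mult_matrix b \<alpha> = mat (length b) (length b)
     (\<lambda>(i, j). rat_vs.representation (set b) (\<alpha> * b ! j) (b ! i))"

text \<open>The norm from \<open>K\<close> to the rationals: the determinant of multiplication by \<open>\<alpha>\<close> on \<open>K\<close>.
  The value does not depend on the chosen basis.\<close>

definition field_norm :: "'a::field_char_0 set \<Rightarrow> 'a \<Rightarrow> rat" where
  "field_norm K \<alpha> = det (mult_matrix (SOME b. ordered_basis K b) \<alpha>)"

definition Z_rank :: "'a::field_char_0 set \<Rightarrow> enat" where
  "Z_rank M = (SUP B\<in>{B. B \<subseteq> M \<and> finite B \<and> int_mod.independent B}. enat (card B))"


section \<open>Integer polynomials and norm forms\<close>

text \<open>A polynomial maps exponent vectors to coefficients; an exponent vector maps the index
  \<open>i\<close> of the variable \<open>x\<^sub>i\<close> to its exponent.\<close>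

type_synonym int_mpoly = "(nat \<Rightarrow>\<^sub>0 nat) \<Rightarrow>\<^sub>0 int"

definition mpoly_in_vars :: "nat set \<Rightarrow> int_mpoly \<Rightarrow> bool" where
  "mpoly_in_vars V F \<longleftrightarrow> (\<forall>t\<in>Poly_Mapping.keys F. Poly_Mapping.keys t \<subseteq> V)"

definition mpoly_homogeneous :: "int_mpoly \<Rightarrow> bool" where
  "mpoly_homogeneous F \<longleftrightarrow>
     (\<exists>d. \<forall>t\<in>Poly_Mapping.keys F. (\<Sum>i\<in>Poly_Mapping.keys t. Poly_Mapping.lookup t i) = d)"

definition mpoly_eval :: "int_mpoly \<Rightarrow> (nat \<Rightarrow> int) \<Rightarrow> int" where
  "mpoly_eval F x = (\<Sum>t\<in>Poly_Mapping.keys F.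
     Poly_Mapping.lookup F t * (\<Prod>i\<in>Poly_Mapping.keys t. x i ^ Poly_Mapping.lookup t i))"

definition is_norm_form :: "'a::field_char_0 set \<Rightarrow> int_mpoly \<Rightarrow> bool" where
  "is_norm_form K F \<longleftrightarrow>
     (let r = field_degree K in
      mpoly_in_vars {1..r} F \<and> mpoly_homogeneous F \<and>
      (\<exists>\<omega> :: nat \<Rightarrow> 'a.
         (\<forall>i\<in>{1..r}. \<omega> i \<in> ring_of_integers K) \<and>
         Z_rank (int_mod.span (\<omega> ` {1..r})) = enat r \<and>
         (\<forall>x :: nat \<Rightarrow> int.
            of_int (mpoly_eval F x) = field_norm K (\<Sum>i=1..r. of_int (x i) * \<omega> i))))"

definition rep_count :: "nat \<Rightarrow> (nat \<Rightarrow> int set) \<Rightarrow> int_mpoly \<Rightarrow> int \<Rightarrow> nat" where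
  "rep_count r A F m = card {a \<in> (\<Pi>\<^sub>E i\<in>{1..r}. A i). mpoly_eval F a = m}"

end

theory Submission
  imports Defs "HOL-Algebra.Algebraic_Closure_Type" "HOL-Number_Theory.Number_Theory"
    "HOL-Computational_Algebra.Field_as_Ring" "HOL-Real_Asymp.Real_Asymp" "HOL-Analysis.Convex"
begin

text \<open>
  Write \<open>S\<close> for the product of the cardinalities of the \<open>A\<^sub>i\<close>.  The norms of points of the box
  are bounded by a constant times \<open>N ^ r\<close>, so about \<open>N ^ r / D\<close> of the possible values are
  multiples of a given \<open>D\<close>.  If many more than \<open>N ^ r / D\<close> points of the product set have a norm
  divisible by \<open>D\<close>, then some value is represented many times.  The proof finds such a \<open>D\<close> among
  the divisors of a product of \<open>k\<close> primes, with \<open>k\<close> of order \<open>ln N / ln (ln N)\<close>.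

  A prime \<open>p\<close> is useful if two different embeddings of the field can be reduced modulo \<open>p\<close>: each
  reduction is a linear form on whose zero hyperplane the norm is divisible by \<open>p\<close>.  A uniformly
  random point lies on one of the two hyperplanes with probability about \<open>2 / p\<close>, twice the density
  of the multiples of \<open>p\<close>.  A product set may avoid the hyperplanes for some \<open>p\<close>, but it pays for
  that with its density.  This is quantified by a reverse Hoelder inequality with exponent \<open>1 / 2\<close>.
  For \<open>\<theta> = 1 / 100\<close>, \<open>p \<ge> 100\<close> and nonnegative functions \<open>f\<^sub>i\<close> of one residue modulo \<open>p\<close> it states
  \<open>E ((\<Prod>i. f\<^sub>i (x\<^sub>i)) * (1 + \<theta> * p * [x on one of the hyperplanes])) \<ge> (1 + 3 / 2 * \<theta>) * (\<Prod>i. (E (sqrt f\<^sub>i))\<^sup>2)\<close>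
  (\<open>reverse_hoelder_two_hyperplanes\<close>).  Because the exponent is less than 1, the inequality can be
  iterated over the primes without loss (\<open>reverse_hoelder_product\<close>), and for functions with values
  between 0 and 1 the quasi-norm \<open>(E (sqrt f))\<^sup>2\<close> is at least the square of the mean.  Expanding
  the product of the weights over the divisors \<open>D\<close> yields a lower bound of order
  \<open>(1 + 3 / 2 * \<theta>) ^ k * S\<^sup>2 / N ^ r\<close> for a sum which is at most of order \<open>(1 + \<theta>) ^ k * g * N ^ r\<close>
  when no value has more than \<open>g\<close> representations.  So \<open>S\<^sup>2\<close> is at most of order
  \<open>g * N ^ (2 * r) * (202 / 203) ^ k\<close> (\<open>product_set_bound\<close>).  As \<open>S \<le> N ^ r\<close> and \<open>r \<ge> 2\<close>, the
  density \<open>S / N ^ r\<close> is at most the power with exponent \<open>1 / r\<close> of its square, and the theorem follows.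

  To have \<open>k\<close> useful primes whose product is at most \<open>N\<close>, it suffices that they number at least a fixed
  power of \<open>x\<close> up to \<open>x\<close>, because then primes bounded by a power of \<open>ln N\<close> are enough.  The two
  embeddings take their values in a field generated by one element \<open>\<eta>\<close> (\<open>ex_two_embeddings\<close>).  Let
  \<open>h\<close> be an integer multiple of the minimal polynomial of \<open>\<eta>\<close>.  If \<open>p\<close> divides \<open>h n\<close>, substituting
  \<open>n\<close> for \<open>\<eta>\<close> reduces both embeddings modulo \<open>p\<close>, up to finitely many exceptional \<open>p\<close>
  (\<open>embedding_gives_hyperplane\<close>, \<open>norm_form_hyperplanes\<close>).  The primes dividing the values of a
  polynomial are numerous by a comparison of the size of these values with Mertens' bound
  (\<open>many_primes_dividing_values\<close>).
\<close>

hide_const (open) Divisibility.prime Divisibility.irreducible Polynomials.degree up_ring.coeff up_ring.monom Polynomials.lead_coeff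

section \<open>A reverse Hoelder inequality for two graphs\<close>

text \<open>Both functions have mean 1 and mean square at most \<open>1 + 2/100\<close>, so they are close to 1 in mean square
and correlate along every bijection.  The bound \<open>t\<^sup>2 \<ge> 2 * t - 1\<close> turns the sum of squares of the
products into the sum of the products.  One exceptional point costs little, since no single product
exceeds \<open>2 + 4/100 * n\<close>.\<close>

lemma sum_off_coincidence_ge:
  fixes a b :: "'b \<Rightarrow> real"
  assumes fin: "finite S" and n: "n = real (card S)" "n \<ge> 100"
    and sa: "(\<Sum>x\<in>S. a x) = n" and sb: "(\<Sum>x\<in>S. b x) = n"
    and pi: "bij_betw \<pi> S S"
    and va: "(\<Sum>x\<in>S. (a x)\<^sup>2) \<le> (1 + 2/100) * n" and vb: "(\<Sum>x\<in>S. (b x)\<^sup>2) \<le> (1 + 2/100) * n"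
    and E: "E \<subseteq> S" "\<And>y y'. y \<in> E \<Longrightarrow> y' \<in> E \<Longrightarrow> y = y'"
  shows "(\<Sum>y\<in>S - E. (b y)\<^sup>2 * (a (\<pi> y))\<^sup>2) \<ge> n - (12/100) * n - 4"
proof -
  have da: "(\<Sum>x\<in>S. (a x - 1)\<^sup>2) \<le> 2/100 * n"
    using va sa n fin by (simp add: power2_diff sum.distrib sum_subtractf flip: sum_distrib_left)
  have db: "(\<Sum>x\<in>S. (b x - 1)\<^sup>2) \<le> 2/100 * n"
    using vb sb n fin by (simp add: power2_diff sum.distrib sum_subtractf flip: sum_distrib_left)
  have dpa: "(\<Sum>y\<in>S. (a (\<pi> y) - 1)\<^sup>2) \<le> 2/100 * n"
    using da sum.reindex_bij_betw[OF pi, of "\<lambda>x. (a x - 1)\<^sup>2"] by simp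
  have spa: "(\<Sum>y\<in>S. a (\<pi> y)) = n"
    using sa sum.reindex_bij_betw[OF pi, of a] by simp
  have "(\<Sum>y\<in>S. b y + a (\<pi> y) - 1 - ((b y - 1)\<^sup>2 + (a (\<pi> y) - 1)\<^sup>2) / 2) \<le> (\<Sum>y\<in>S. b y * a (\<pi> y))"
  proof (rule sum_mono)
    fix y
    have "0 \<le> ((b y - 1) + (a (\<pi> y) - 1))\<^sup>2" by simp
    then show "b y + a (\<pi> y) - 1 - ((b y - 1)\<^sup>2 + (a (\<pi> y) - 1)\<^sup>2) / 2 \<le> b y * a (\<pi> y)"
      by (simp add: power2_eq_square field_simps)
  qed
  note lower = this
  have cross: "(\<Sum>y\<in>S. b y * a (\<pi> y)) \<ge> n - 2/100 * n"
  proof -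
    have "(\<Sum>y\<in>S. b y + a (\<pi> y) - 1 - ((b y - 1)\<^sup>2 + (a (\<pi> y) - 1)\<^sup>2) / 2)
        = n + n - n - ((\<Sum>y\<in>S. (b y - 1)\<^sup>2) + (\<Sum>y\<in>S. (a (\<pi> y) - 1)\<^sup>2)) / 2"
      using spa sb n by (simp add: sum.distrib sum_subtractf flip: sum_divide_distrib)
    with lower db dpa show ?thesis by argo
  qed
  have single: "2 * (b y * a (\<pi> y)) \<le> 4 + 8/100 * n" if "y \<in> S" for y
  proof -
    have "(b y - 1)\<^sup>2 \<le> 2/100 * n"
      using member_le_sum[of y S "\<lambda>y. (b y - 1)\<^sup>2"] that fin db by simp
    moreover have "(a (\<pi> y) - 1)\<^sup>2 \<le> 2/100 * n"
      using member_le_sum[of y S "\<lambda>y. (a (\<pi> y) - 1)\<^sup>2"] that fin dpa by simp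
    moreover have "2 * (b y * a (\<pi> y)) \<le> (2 + 2 * (b y - 1)\<^sup>2) + (2 + 2 * (a (\<pi> y) - 1)\<^sup>2)"
    proof -
      have "0 \<le> (b y - a (\<pi> y))\<^sup>2" "0 \<le> (b y - 2)\<^sup>2" "0 \<le> (a (\<pi> y) - 2)\<^sup>2" by simp_all
      then show ?thesis by (simp add: power2_eq_square algebra_simps)
    qed
    ultimately show ?thesis by linarith
  qed
  have finE: "finite E" using E(1) fin finite_subset by blast
  have drop: "2 * (\<Sum>y\<in>E. b y * a (\<pi> y)) - real (card E) \<le> 4 + 8/100 * n"
  proof (cases "E = {}")
    case True then show ?thesis using n by simp
  next
    case False
    then obtain y where y: "y \<in> E" by blast
    then have "E = {y}" using E(2) by blast
    then show ?thesis using single[of y] y E(1) by auto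
  qed
  have cardE: "card (S - E) = card S - card E" "card E \<le> card S"
    using E(1) fin finE by (auto simp: card_Diff_subset card_mono)
  have "n - (12/100) * n - 4 \<le> 2 * (n - 2/100 * n) - (4 + 8/100 * n) - n"
    by simp
  also have "\<dots> \<le> 2 * (\<Sum>y\<in>S. b y * a (\<pi> y)) - n - (2 * (\<Sum>y\<in>E. b y * a (\<pi> y)) - real (card E))"
    using mult_left_mono[OF cross, of 2] drop by simp
  also have "\<dots> = (\<Sum>y\<in>S - E. 2 * (b y * a (\<pi> y)) - 1)"
    using E(1) fin n cardE by (simp add: sum_subtractf sum_diff sum_distrib_left[symmetric] of_nat_diff)
  also have "\<dots> \<le> (\<Sum>y\<in>S - E. (b y)\<^sup>2 * (a (\<pi> y))\<^sup>2)"
  proof (rule sum_mono)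
    fix y
    have "0 \<le> (b y * a (\<pi> y) - 1)\<^sup>2" by simp
    then show "2 * (b y * a (\<pi> y)) - 1 \<le> (b y)\<^sup>2 * (a (\<pi> y))\<^sup>2"
      by (simp add: power2_eq_square algebra_simps)
  qed
  finally show ?thesis by simp
qed

text \<open>If one of the two mean squares exceeds \<open>1 + 2/100\<close>, the product of the sums suffices on its own.
Otherwise each of the two graphs contributes almost \<open>n\<close>; the second one is counted only where it
differs from the first, which omits at most one point.  The constants leave room: both graphs together
contribute at least \<open>2 * (88/100 * n - 4) \<ge> 3/2 * n\<close> for \<open>n \<ge> 100\<close>.\<close>

lemma reverse_hoelder_two_graphs_normalized:
  fixes a b :: "'b \<Rightarrow> real"
  assumes fin: "finite S" and n: "n = real (card S)" "n \<ge> 100"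
    and sa: "(\<Sum>x\<in>S. a x) = n" and sb: "(\<Sum>x\<in>S. b x) = n"
    and pi: "bij_betw \<pi> S S" and pi': "bij_betw \<pi>' S S"
    and coin: "\<And>y y'. y \<in> S \<Longrightarrow> y' \<in> S \<Longrightarrow> \<pi> y = \<pi>' y \<Longrightarrow> \<pi> y' = \<pi>' y' \<Longrightarrow> y = y'"
  shows "(\<Sum>x\<in>S. (a x)\<^sup>2) * (\<Sum>y\<in>S. (b y)\<^sup>2) + (1/100) * n *
           (\<Sum>y\<in>S. (b y)\<^sup>2 * ((a (\<pi> y))\<^sup>2 + (if \<pi> y = \<pi>' y then 0 else (a (\<pi>' y))\<^sup>2)))
         \<ge> (1 + 3/200) * n\<^sup>2"
proof -
  define U where "U = (\<Sum>x\<in>S. (a x)\<^sup>2)"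
  define V where "V = (\<Sum>x\<in>S. (b x)\<^sup>2)"
  define R where "R = (\<Sum>y\<in>S. (b y)\<^sup>2 * ((a (\<pi> y))\<^sup>2 + (if \<pi> y = \<pi>' y then 0 else (a (\<pi>' y))\<^sup>2)))"
  have U: "U \<ge> n"
  proof -
    have "(\<Sum>x\<in>S. 2 * a x - 1) \<le> U" unfolding U_def
    proof (rule sum_mono)
      fix x have "0 \<le> (a x - 1)\<^sup>2" by simp
      then show "2 * a x - 1 \<le> (a x)\<^sup>2" by (simp add: power2_eq_square algebra_simps)
    qed
    then show ?thesis using sa n by (simp add: sum_subtractf flip: sum_distrib_left)
  qed
  have V: "V \<ge> n"
  proof -
    have "(\<Sum>x\<in>S. 2 * b x - 1) \<le> V" unfolding V_def
    proof (rule sum_mono)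
      fix x have "0 \<le> (b x - 1)\<^sup>2" by simp
      then show "2 * b x - 1 \<le> (b x)\<^sup>2" by (simp add: power2_eq_square algebra_simps)
    qed
    then show ?thesis using sb n by (simp add: sum_subtractf flip: sum_distrib_left)
  qed
  have R0: "R \<ge> 0" unfolding R_def by (intro sum_nonneg mult_nonneg_nonneg add_nonneg_nonneg) auto
  have "U * V + (1/100) * n * R \<ge> (1 + 3/200) * n\<^sup>2"
  proof (cases "U \<le> (1 + 2/100) * n \<and> V \<le> (1 + 2/100) * n")
    case False
    then have "\<not> U \<le> (1 + 2/100) * n \<or> \<not> V \<le> (1 + 2/100) * n" by blast
    then have "U * V \<ge> (1 + 2/100) * n * n"
    proof
      assume "\<not> U \<le> (1 + 2/100) * n"
      then show ?thesis using mult_mono[of "(1 + 2/100) * n" U n V] V n by simp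
    next
      assume "\<not> V \<le> (1 + 2/100) * n"
      then show ?thesis using mult_mono[of n U "(1 + 2/100) * n" V] U n by (simp add: algebra_simps)
    qed
    moreover have "(1 + 3/200) * n\<^sup>2 \<le> (1 + 2/100) * n * n"
      using n by (simp add: power2_eq_square)
    moreover have "(1/100) * n * R \<ge> 0" using R0 n by simp
    ultimately show ?thesis by linarith
  next
    case True
    define E where "E = {y \<in> S. \<pi> y = \<pi>' y}"
    have 1: "(\<Sum>y\<in>S - {}. (b y)\<^sup>2 * (a (\<pi> y))\<^sup>2) \<ge> n - (12/100) * n - 4"
      by (rule sum_off_coincidence_ge[OF fin n sa sb pi]) (use True U_def V_def in auto)
    have 2: "(\<Sum>y\<in>S - E. (b y)\<^sup>2 * (a (\<pi>' y))\<^sup>2) \<ge> n - (12/100) * n - 4"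
      by (rule sum_off_coincidence_ge[OF fin n sa sb pi']) (use True U_def V_def coin E_def in auto)
    have "R = (\<Sum>y\<in>S. (b y)\<^sup>2 * (a (\<pi> y))\<^sup>2) + (\<Sum>y\<in>S. (if \<pi> y = \<pi>' y then 0 else (b y)\<^sup>2 * (a (\<pi>' y))\<^sup>2))"
      unfolding R_def by (simp add: sum.distrib[symmetric] distrib_left if_distrib cong: if_cong)
    also have "(\<Sum>y\<in>S. (if \<pi> y = \<pi>' y then 0 else (b y)\<^sup>2 * (a (\<pi>' y))\<^sup>2)) = (\<Sum>y\<in>S - E. (b y)\<^sup>2 * (a (\<pi>' y))\<^sup>2)"
      by (rule sum.mono_neutral_cong_right) (use fin in \<open>auto simp: E_def\<close>)
    finally have "R \<ge> (3/2) * n" using 1 2 n by simp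
    then have "(1/100) * n * ((3/2) * n) \<le> (1/100) * n * R" using n by (intro mult_left_mono) auto
    moreover have "n * n \<le> U * V" using U V n by (intro mult_mono) auto
    ultimately show ?thesis by (simp add: power2_eq_square algebra_simps)
  qed
  then show ?thesis unfolding U_def V_def R_def .
qed

text \<open>Both sides scale in the same way in \<open>f\<close> and in \<open>g\<close>, so this is the normalised inequality for
\<open>sqrt f\<close> and \<open>sqrt g\<close> divided by their means.\<close>

lemma reverse_hoelder_two_graphs:
  fixes f g :: "'b \<Rightarrow> real"
  assumes fin: "finite S" and n: "n = real (card S)" "n \<ge> 100"
    and f: "\<And>x. x \<in> S \<Longrightarrow> f x \<ge> 0" and g: "\<And>x. x \<in> S \<Longrightarrow> g x \<ge> 0"
    and pi: "bij_betw \<pi> S S" and pi': "bij_betw \<pi>' S S"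
    and coin: "\<And>y y'. y \<in> S \<Longrightarrow> y' \<in> S \<Longrightarrow> \<pi> y = \<pi>' y \<Longrightarrow> \<pi> y' = \<pi>' y' \<Longrightarrow> y = y'"
  shows "(\<Sum>x\<in>S. \<Sum>y\<in>S. (1 + (1/100) * n * of_bool (x = \<pi> y \<or> x = \<pi>' y)) * (f x * g y))
         \<ge> (1 + 3/200) * ((\<Sum>x\<in>S. sqrt (f x))\<^sup>2 / n) * ((\<Sum>x\<in>S. sqrt (g x))\<^sup>2 / n)"
proof -
  define s where "s = (\<Sum>x\<in>S. sqrt (f x)) / n"
  define t where "t = (\<Sum>x\<in>S. sqrt (g x)) / n"
  have sums: "(\<Sum>x\<in>S. sqrt (f x)) = n * s" "(\<Sum>x\<in>S. sqrt (g x)) = n * t"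
    using n by (simp_all add: s_def t_def)
  have st0: "s \<ge> 0" "t \<ge> 0" unfolding s_def t_def using f g n by (auto intro!: divide_nonneg_nonneg sum_nonneg)
  define L where "L = (\<Sum>x\<in>S. \<Sum>y\<in>S. (1 + (1/100) * n * of_bool (x = \<pi> y \<or> x = \<pi>' y)) * (f x * g y))"
  have L0: "L \<ge> 0" unfolding L_def using f g n by (intro sum_nonneg mult_nonneg_nonneg) auto
  have "L \<ge> (1 + 3/200) * n\<^sup>2 * s\<^sup>2 * t\<^sup>2"
  proof (cases "s = 0 \<or> t = 0")
    case True then show ?thesis using L0 by auto
  next
    case False
    then have st: "s > 0" "t > 0" using st0 by auto
    define a where "a x = sqrt (f x) / s" for x
    define b where "b x = sqrt (g x) / t" for x
    have fa: "f x = s\<^sup>2 * (a x)\<^sup>2" if "x \<in> S" for x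
      using f[OF that] st by (simp add: a_def power_divide)
    have gb: "g x = t\<^sup>2 * (b x)\<^sup>2" if "x \<in> S" for x
      using g[OF that] st by (simp add: b_def power_divide)
    have sa: "(\<Sum>x\<in>S. a x) = n" unfolding a_def sum_divide_distrib[symmetric]
      using st sums by simp
    have sb: "(\<Sum>x\<in>S. b x) = n" unfolding b_def sum_divide_distrib[symmetric]
      using st sums by simp
    have piS: "\<pi> y \<in> S" "\<pi>' y \<in> S" if "y \<in> S" for y
      using pi pi' that by (auto simp: bij_betw_def)
    have inner: "(\<Sum>x\<in>S. of_bool (x = \<pi> y \<or> x = \<pi>' y) * (a x)\<^sup>2)
          = (a (\<pi> y))\<^sup>2 + (if \<pi> y = \<pi>' y then 0 else (a (\<pi>' y))\<^sup>2)" if y: "y \<in> S" for y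
    proof -
      have "(\<Sum>x\<in>S. of_bool (x = \<pi> y \<or> x = \<pi>' y) * (a x)\<^sup>2) = (\<Sum>x\<in>{\<pi> y, \<pi>' y}. (a x)\<^sup>2)"
        by (rule sum.mono_neutral_cong_right) (use fin piS[OF y] in auto)
      then show ?thesis by auto
    qed
    have "L = (\<Sum>x\<in>S. \<Sum>y\<in>S. s\<^sup>2 * t\<^sup>2 * ((a x)\<^sup>2 * (b y)\<^sup>2 + (1/100) * n * ((b y)\<^sup>2 * (of_bool (x = \<pi> y \<or> x = \<pi>' y) * (a x)\<^sup>2))))"
      unfolding L_def by (intro sum.cong refl) (simp add: fa gb algebra_simps)
    also have "\<dots> = s\<^sup>2 * t\<^sup>2 * ((\<Sum>x\<in>S. (a x)\<^sup>2) * (\<Sum>y\<in>S. (b y)\<^sup>2) + (1/100) * n *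
           (\<Sum>x\<in>S. \<Sum>y\<in>S. (b y)\<^sup>2 * (of_bool (x = \<pi> y \<or> x = \<pi>' y) * (a x)\<^sup>2)))"
      by (subst sum_product) (simp only: sum_distrib_left sum.distrib[symmetric])
    also have "(\<Sum>x\<in>S. \<Sum>y\<in>S. (b y)\<^sup>2 * (of_bool (x = \<pi> y \<or> x = \<pi>' y) * (a x)\<^sup>2))
        = (\<Sum>y\<in>S. (b y)\<^sup>2 * (\<Sum>x\<in>S. of_bool (x = \<pi> y \<or> x = \<pi>' y) * (a x)\<^sup>2))"
      by (subst sum.swap) (simp only: sum_distrib_left)
    also have "\<dots> = (\<Sum>y\<in>S. (b y)\<^sup>2 * ((a (\<pi> y))\<^sup>2 + (if \<pi> y = \<pi>' y then 0 else (a (\<pi>' y))\<^sup>2)))"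
      by (intro sum.cong refl) (simp only: inner)
    finally have L: "L = s\<^sup>2 * t\<^sup>2 * ((\<Sum>x\<in>S. (a x)\<^sup>2) * (\<Sum>y\<in>S. (b y)\<^sup>2) + (1/100) * n *
       (\<Sum>y\<in>S. (b y)\<^sup>2 * ((a (\<pi> y))\<^sup>2 + (if \<pi> y = \<pi>' y then 0 else (a (\<pi>' y))\<^sup>2))))" .
    have "s\<^sup>2 * t\<^sup>2 * ((1 + 3/200) * n\<^sup>2) \<le> L"
      unfolding L by (rule mult_left_mono[OF reverse_hoelder_two_graphs_normalized[OF fin n sa sb pi pi' coin]]) auto
    then show ?thesis by (simp add: mult_ac)
  qed
  then show ?thesis using n sums unfolding L_def[symmetric]
    by (simp add: power2_eq_square algebra_simps)
qed

section \<open>Iteration over hyperplanes modulo several primes\<close>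

lemma sum_PiE_insert:
  fixes h :: "('i \<Rightarrow> 'b) \<Rightarrow> real"
  assumes "k \<notin> J"
  shows "(\<Sum>v\<in>Pi\<^sub>E (insert k J) (\<lambda>_. B). h v) = (\<Sum>u\<in>Pi\<^sub>E J (\<lambda>_. B). \<Sum>x\<in>B. h (u(k := x)))"
proof -
  have "(\<Sum>v\<in>Pi\<^sub>E (insert k J) (\<lambda>_. B). h v) = (\<Sum>(x, u)\<in>B \<times> Pi\<^sub>E J (\<lambda>_. B). h (u(k := x)))"
    unfolding PiE_insert_eq
    by (subst sum.reindex[OF inj_combinator[OF assms]]) (simp add: case_prod_unfold)
  also have "\<dots> = (\<Sum>x\<in>B. \<Sum>u\<in>Pi\<^sub>E J (\<lambda>_. B). h (u(k := x)))"
    by (simp add: sum.cartesian_product)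
  finally show ?thesis by (simp add: sum.swap[of _ B])
qed

lemma sum_PiE_prod:
  fixes f :: "'i \<Rightarrow> 'b \<Rightarrow> real"
  assumes "finite J" "finite B"
  shows "(\<Sum>v\<in>Pi\<^sub>E J (\<lambda>_. B). \<Prod>i\<in>J. f i (v i)) = (\<Prod>i\<in>J. \<Sum>x\<in>B. f i x)"
  using assms by (simp add: prod_sum_PiE)

lemma int_div_less:
  fixes x Q p :: int
  assumes "Q > 0" "x < Q * p"
  shows "x div Q < p"
proof (rule ccontr)
  assume "\<not> x div Q < p"
  then have "Q * p \<le> Q * (x div Q)" using assms by (intro mult_left_mono) auto
  also have "\<dots> \<le> Q * (x div Q) + x mod Q" using pos_mod_sign[OF assms(1), of x] by linarith
  also have "\<dots> = x" by (rule mult_div_mod_eq)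
  finally show False using assms by simp
qed

lemma int_digits_less:
  fixes a b Q p :: int
  assumes "Q > 0" "a < Q" "b < p"
  shows "a + Q * b < Q * p"
proof -
  have "Q * b \<le> Q * (p - 1)" using assms by (intro mult_left_mono) auto
  then show ?thesis using assms by (simp add: algebra_simps)
qed

lemma sum_base_split:
  fixes h :: "int \<Rightarrow> real"
  assumes Q: "Q > 0"
  shows "(\<Sum>x\<in>{0..<Q * p}. h x) = (\<Sum>u\<in>{0..<Q}. \<Sum>v\<in>{0..<p}. h (u + Q * v))"
proof -
  have "(\<Sum>x\<in>{0..<Q * p}. h x) = (\<Sum>(u, v)\<in>{0..<Q} \<times> {0..<p}. h (u + Q * v))"
  proof (rule sum.reindex_bij_witness[of _ "\<lambda>(u, v). u + Q * v" "\<lambda>x. (x mod Q, x div Q)"], goal_cases)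
    case (2 a)
    then show ?case using Q int_div_less[OF Q] by (simp add: pos_imp_zdiv_nonneg_iff)
  next
    case (3 b)
    then show ?case using Q by (cases b) simp
  next
    case (4 b)
    then show ?case using Q int_digits_less[OF Q] by (cases b) simp
  qed simp_all
  then show ?thesis by (simp add: sum.cartesian_product)
qed

text \<open>Writing a residue modulo \<open>Q * p\<close> as \<open>u + Q * v\<close> splits off one prime without an appeal to the Chinese
remainder theorem: when \<open>Q\<close> is invertible modulo \<open>p\<close>, a hyperplane modulo \<open>p\<close> in the variable
\<open>u + Q * v\<close> is, for fixed \<open>u\<close>, an affine hyperplane in \<open>v\<close>.\<close>

lemma sum_PiE_base_split:
  fixes h :: "('i \<Rightarrow> int) \<Rightarrow> real"
  assumes Q: "Q > 0" and p: "p > 0"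
  shows "(\<Sum>x\<in>Pi\<^sub>E I (\<lambda>_. {0..<Q * p}). h x)
       = (\<Sum>u\<in>Pi\<^sub>E I (\<lambda>_. {0..<Q}). \<Sum>v\<in>Pi\<^sub>E I (\<lambda>_. {0..<p}). h (\<lambda>i\<in>I. u i + Q * v i))"
proof -
  have "(\<Sum>x\<in>Pi\<^sub>E I (\<lambda>_. {0..<Q * p}). h x)
      = (\<Sum>(u, v)\<in>Pi\<^sub>E I (\<lambda>_. {0..<Q}) \<times> Pi\<^sub>E I (\<lambda>_. {0..<p}). h (\<lambda>i\<in>I. u i + Q * v i))"
  proof (rule sum.reindex_bij_witness[of _ "\<lambda>(u, v). \<lambda>i\<in>I. u i + Q * v i"
        "\<lambda>x. (\<lambda>i\<in>I. x i mod Q, \<lambda>i\<in>I. x i div Q)"], goal_cases)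
    case (1 a)
    then show ?case by (auto simp: fun_eq_iff PiE_iff extensional_def)
  next
    case (2 a)
    then show ?case using Q int_div_less[OF Q] by (fastforce simp: PiE_iff pos_imp_zdiv_nonneg_iff)
  next
    case (3 b)
    then show ?case using Q by (fastforce simp: fun_eq_iff PiE_iff extensional_def)
  next
    case (4 b)
    then show ?case using Q int_digits_less[OF Q] by (auto simp: PiE_iff)
  next
    case (5 a)
    then have "(\<lambda>i\<in>I. (\<lambda>i\<in>I. a i mod Q) i + Q * (\<lambda>i\<in>I. a i div Q) i) = a"
      by (auto simp: fun_eq_iff PiE_iff extensional_def)
    then show ?case by simp
  qed
  then show ?thesis by (simp add: sum.cartesian_product)
qed

definition on_hyperplane :: "'i set \<Rightarrow> ('i \<Rightarrow> int) \<Rightarrow> int \<Rightarrow> int \<Rightarrow> ('i \<Rightarrow> int) \<Rightarrow> bool" where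
  "on_hyperplane I w s p x \<longleftrightarrow> p dvd (\<Sum>i\<in>I. w i * x i) + s"

text \<open>On a plane where only the coordinates \<open>k\<close> and \<open>l\<close> vary, two hyperplanes with these normal vectors cut
out two graphs of bijections between the two coordinates (by the first four conditions) that meet in at
most one point (by the last).\<close>

definition transversal :: "int \<Rightarrow> 'i \<Rightarrow> 'i \<Rightarrow> ('i \<Rightarrow> int) \<Rightarrow> ('i \<Rightarrow> int) \<Rightarrow> bool" where
  "transversal p k l w w' \<longleftrightarrow> \<not> p dvd w k \<and> \<not> p dvd w l \<and> \<not> p dvd w' k \<and> \<not> p dvd w' l \<and>
     \<not> p dvd w k * w' l - w' k * w l"

lemma line_is_graph:
  fixes p a b c :: int
  assumes p: "prime p" and a: "\<not> p dvd a" and b: "\<not> p dvd b"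
  obtains \<pi> where "bij_betw \<pi> {0..<p} {0..<p}"
    and "\<And>x y. x \<in> {0..<p} \<Longrightarrow> y \<in> {0..<p} \<Longrightarrow> p dvd a * x + b * y + c \<longleftrightarrow> x = \<pi> y"
proof -
  have p0: "p > 0" using p by (simp add: prime_gt_0_int)
  have "coprime a p" using prime_imp_coprime[OF p a] by (simp add: coprime_commute)
  then obtain a' where a': "[a * a' = 1] (mod p)" using cong_solve_coprime_int by blast
  define \<pi> where "\<pi> y = (- a' * (b * y + c)) mod p" for y
  have eqd: "x = y" if "x \<in> {0..<p}" "y \<in> {0..<p}" "p dvd x - y" for x y
    using that by (metis atLeastLessThan_iff mod_eq_dvd_iff mod_pos_pos_trivial)
  have iff: "p dvd a * x + b * y + c \<longleftrightarrow> x = \<pi> y" if x: "x \<in> {0..<p}" for x y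
  proof -
    have 1: "p dvd a * \<pi> y + b * y + c"
    proof -
      have "[a * \<pi> y + b * y + c = a * (- a' * (b * y + c)) + b * y + c] (mod p)"
        unfolding \<pi>_def by (intro cong_add cong_mult cong_refl) (simp add: cong_def)
      also have "a * (- a' * (b * y + c)) + b * y + c = (b * y + c) - (a * a') * (b * y + c)"
        by (simp add: algebra_simps)
      also have "[(b * y + c) - (a * a') * (b * y + c) = (b * y + c) - 1 * (b * y + c)] (mod p)"
        by (intro cong_diff cong_mult cong_refl a')
      finally show ?thesis by (simp add: cong_0_iff)
    qed
    show ?thesis
    proof
      assume "p dvd a * x + b * y + c"
      then have "p dvd (a * x + b * y + c) - (a * \<pi> y + b * y + c)" using 1 by (rule dvd_diff)
      then have "p dvd a * (x - \<pi> y)" by (simp add: algebra_simps)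
      then have "p dvd x - \<pi> y" using p a by (simp add: prime_dvd_mult_iff)
      moreover have "\<pi> y \<in> {0..<p}" using p0 by (simp add: \<pi>_def)
      ultimately show "x = \<pi> y" using eqd x by blast
    next
      assume "x = \<pi> y" then show "p dvd a * x + b * y + c" using 1 by simp
    qed
  qed
  have into: "\<pi> ` {0..<p} \<subseteq> {0..<p}" using p0 by (auto simp: \<pi>_def)
  moreover have "inj_on \<pi> {0..<p}"
  proof (rule inj_onI)
    fix y z assume y: "y \<in> {0..<p}" and z: "z \<in> {0..<p}" and e: "\<pi> y = \<pi> z"
    have "p dvd a * \<pi> y + b * y + c" "p dvd a * \<pi> z + b * z + c"
      using iff into y z by blast+
    then have "p dvd (a * \<pi> y + b * y + c) - (a * \<pi> z + b * z + c)" by (rule dvd_diff)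
    then have "p dvd b * (y - z)" using e by (simp add: algebra_simps)
    then have "p dvd y - z" using p b by (simp add: prime_dvd_mult_iff)
    then show "y = z" using eqd y z by blast
  qed
  ultimately have "bij_betw \<pi> {0..<p} {0..<p}"
    by (simp add: bij_betw_def endo_inj_surj)
  then show thesis using that iff by blast
qed

text \<open>Once the coordinates other than \<open>k\<close> and \<open>l\<close> are fixed, the hyperplanes become two graphs and
\<open>reverse_hoelder_two_graphs\<close> applies.  In the remaining coordinates the Cauchy-Schwarz inequality
replaces the sum of \<open>f i\<close> by its quasi-norm.  The offsets \<open>s\<close> and \<open>s'\<close> are needed for the iteration
over several primes.\<close>

lemma reverse_hoelder_two_hyperplanes:
  fixes f :: "'i \<Rightarrow> int \<Rightarrow> real" and p :: int
  assumes I: "finite I" "k \<in> I" "l \<in> I" "k \<noteq> l" and p: "prime p" "p \<ge> 100"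
    and tr: "transversal p k l w w'" and f: "\<And>i x. f i x \<ge> 0"
  shows "(\<Sum>v\<in>Pi\<^sub>E I (\<lambda>_. {0..<p}).
            (1 + (1/100) * real_of_int p * of_bool (on_hyperplane I w s p v \<or> on_hyperplane I w' s' p v)) * (\<Prod>i\<in>I. f i (v i)))
     \<ge> (1 + 3/200) * (\<Prod>i\<in>I. (\<Sum>x\<in>{0..<p}. sqrt (f i x))\<^sup>2 / real_of_int p)"
proof -
  define J where "J = I - {k, l}"
  define wt where "wt v = 1 + (1/100) * real_of_int p * of_bool (on_hyperplane I w s p v \<or> on_hyperplane I w' s' p v)" for v
  have IJ: "I = insert k (insert l J)" and J: "k \<notin> insert l J" "l \<notin> J" "finite J" "k \<notin> J"
    using I by (auto simp: J_def)
  let ?B = "{0..<p}"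
  define m where "m i = (\<Sum>x\<in>?B. sqrt (f i x))\<^sup>2 / real_of_int p" for i
  have p0: "real_of_int p > 0" using p by simp
  have m0: "m i \<ge> 0" for i using p0 by (simp add: m_def)
  have sl: "(\<Sum>x\<in>?B. \<Sum>y\<in>?B. wt (u(l := y, k := x)) * (f k x * f l y))
       \<ge> (1 + 3/200) * m k * m l" for u
  proof -
    define c where "c = (\<Sum>i\<in>J. w i * u i) + s"
    define c' where "c' = (\<Sum>i\<in>J. w' i * u i) + s'"
    have split: "(\<Sum>i\<in>I. w i * (u(l := y, k := x)) i) = w k * x + w l * y + (\<Sum>i\<in>J. w i * u i)" for w :: "'i \<Rightarrow> int" and x y
    proof -
      have "(\<Sum>i\<in>J. w i * (u(l := y, k := x)) i) = (\<Sum>i\<in>J. w i * u i)"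
        using J by (intro sum.cong refl) auto
      then show ?thesis unfolding IJ using J I(4) by simp
    qed
    have oh: "on_hyperplane I w s p (u(l := y, k := x)) \<longleftrightarrow> p dvd w k * x + w l * y + c"
             "on_hyperplane I w' s' p (u(l := y, k := x)) \<longleftrightarrow> p dvd w' k * x + w' l * y + c'" for x y
      unfolding on_hyperplane_def split c_def c'_def by (simp_all add: algebra_simps)
    obtain \<pi> where pi: "bij_betw \<pi> ?B ?B"
        "\<And>x y. x \<in> ?B \<Longrightarrow> y \<in> ?B \<Longrightarrow> p dvd w k * x + w l * y + c \<longleftrightarrow> x = \<pi> y"
      using line_is_graph[OF p(1), of "w k" "w l" c] tr unfolding transversal_def by blast
    obtain \<pi>' where pi': "bij_betw \<pi>' ?B ?B"
        "\<And>x y. x \<in> ?B \<Longrightarrow> y \<in> ?B \<Longrightarrow> p dvd w' k * x + w' l * y + c' \<longleftrightarrow> x = \<pi>' y"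
      using line_is_graph[OF p(1), of "w' k" "w' l" c'] tr unfolding transversal_def by blast
    have coin: "y = z" if y: "y \<in> ?B" and z: "z \<in> ?B" and e: "\<pi> y = \<pi>' y" "\<pi> z = \<pi>' z" for y z
    proof -
      have in_B: "\<pi> y \<in> ?B" "\<pi> z \<in> ?B" using pi(1) y z by (auto simp: bij_betw_def)
      have "p dvd (w k * \<pi> y + w l * y + c) - (w k * \<pi> z + w l * z + c)"
        using in_B y z by (intro dvd_diff) (simp_all add: pi(2))
      then have 1: "p dvd w k * (\<pi> y - \<pi> z) + w l * (y - z)" by (simp add: algebra_simps)
      have "p dvd (w' k * \<pi> y + w' l * y + c') - (w' k * \<pi> z + w' l * z + c')"
        using in_B y z e by (intro dvd_diff) (simp_all add: pi'(2))
      then have 2: "p dvd w' k * (\<pi> y - \<pi> z) + w' l * (y - z)" by (simp add: algebra_simps)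
      have "p dvd w k * (w' k * (\<pi> y - \<pi> z) + w' l * (y - z)) - w' k * (w k * (\<pi> y - \<pi> z) + w l * (y - z))"
        using 1 2 by (intro dvd_diff dvd_mult) auto
      then have "p dvd (w k * w' l - w' k * w l) * (y - z)" by (simp add: algebra_simps)
      then have "p dvd y - z" using p tr by (simp add: prime_dvd_mult_iff transversal_def)
      then show "y = z" using y z by (metis atLeastLessThan_iff mod_eq_dvd_iff mod_pos_pos_trivial)
    qed
    have "(1 + 3/200) * m k * m l \<le> (\<Sum>x\<in>?B. \<Sum>y\<in>?B. (1 + (1/100) * real_of_int p * of_bool (x = \<pi> y \<or> x = \<pi>' y)) * (f k x * f l y))"
      unfolding m_def
      by (rule reverse_hoelder_two_graphs) (use p f pi pi' coin in \<open>auto\<close>)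
    also have "\<dots> = (\<Sum>x\<in>?B. \<Sum>y\<in>?B. wt (u(l := y, k := x)) * (f k x * f l y))"
      by (intro sum.cong refl) (simp only: wt_def oh pi(2) pi'(2))
    finally show ?thesis .
  qed
  have mJ: "(\<Sum>x\<in>?B. f i x) \<ge> m i" for i
  proof -
    have "(\<Sum>x\<in>?B. sqrt (f i x))\<^sup>2 \<le> (\<Sum>x\<in>?B. (sqrt (f i x))\<^sup>2) * real (card ?B)"
      by (rule sum_squared_le_sum_of_squares)
    then show ?thesis using p0 p f by (simp add: m_def divide_le_eq)
  qed
  have "(1 + 3/200) * (\<Prod>i\<in>I. m i) = (1 + 3/200) * m k * m l * (\<Prod>i\<in>J. m i)"
    unfolding IJ using J I(4) by simp
  also have "\<dots> \<le> (1 + 3/200) * m k * m l * (\<Prod>i\<in>J. \<Sum>x\<in>?B. f i x)"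
    using m0 mJ by (intro mult_left_mono prod_mono) auto
  also have "\<dots> = (\<Sum>u\<in>Pi\<^sub>E J (\<lambda>_. ?B). (1 + 3/200) * m k * m l * (\<Prod>i\<in>J. f i (u i)))"
    unfolding sum_distrib_left[symmetric] by (simp add: sum_PiE_prod J)
  also have "\<dots> \<le> (\<Sum>u\<in>Pi\<^sub>E J (\<lambda>_. ?B). 
     (\<Sum>x\<in>?B. \<Sum>y\<in>?B. wt (u(l := y, k := x)) * (f k x * f l y)) * (\<Prod>i\<in>J. f i (u i)))"
    by (intro sum_mono mult_right_mono sl prod_nonneg ballI f)
  also have "\<dots> = (\<Sum>u\<in>Pi\<^sub>E J (\<lambda>_. ?B). \<Sum>y\<in>?B. \<Sum>x\<in>?B. 
      wt (u(l := y, k := x)) * (\<Prod>i\<in>I. f i ((u(l := y, k := x)) i)))"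
  proof (intro sum.cong refl)
    fix u
    have pr: "(\<Prod>i\<in>I. f i ((u(l := y, k := x)) i)) = f k x * f l y * (\<Prod>i\<in>J. f i (u i))" for x y
    proof -
      have "(\<Prod>i\<in>J. f i ((u(l := y, k := x)) i)) = (\<Prod>i\<in>J. f i (u i))"
        using J by (intro prod.cong refl) auto
      then show ?thesis unfolding IJ using J I(4) by simp
    qed
    show "(\<Sum>x\<in>?B. \<Sum>y\<in>?B. wt (u(l := y, k := x)) * (f k x * f l y)) * (\<Prod>i\<in>J. f i (u i))
      = (\<Sum>y\<in>?B. \<Sum>x\<in>?B. 
      wt (u(l := y, k := x)) * (\<Prod>i\<in>I. f i ((u(l := y, k := x)) i)))"
      unfolding pr by (subst sum.swap) (simp only: sum_distrib_right mult.assoc)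
  qed
  also have "\<dots> = (\<Sum>v\<in>Pi\<^sub>E I (\<lambda>_. ?B). wt v * (\<Prod>i\<in>I. f i (v i)))"
    unfolding IJ by (simp only: sum_PiE_insert[OF J(1)] sum_PiE_insert[OF J(2)])
  finally show ?thesis unfolding m_def wt_def .
qed

lemma on_hyperplane_cong:
  fixes p :: int
  assumes "\<And>i. i \<in> I \<Longrightarrow> [x i = y i] (mod p)"
  shows "on_hyperplane I w s p x \<longleftrightarrow> on_hyperplane I w s p y"
proof -
  have "[(\<Sum>i\<in>I. w i * x i) + s = (\<Sum>i\<in>I. w i * y i) + s] (mod p)"
    using assms by (intro cong_add cong_sum cong_mult cong_refl) auto
  then show ?thesis unfolding on_hyperplane_def by (rule cong_dvd_iff)
qed

text \<open>Induction over the primes: for the last prime \<open>p\<close> the inequality for two hyperplanes is applied on every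
fibre \<open>u + Q * v\<close> with \<open>u\<close> fixed, where the weights of the other primes are constant.  The fibrewise
quasi-norms \<open>h i u\<close> are again a product of functions of the single coordinates, and the sum of
\<open>sqrt (h i u)\<close> over \<open>u\<close> is, up to normalisation, the sum of \<open>sqrt (f i x)\<close> over all \<open>x\<close>.  This is
the point of an exponent less than 1: the induction hypothesis for \<open>h\<close> gives exactly the quasi-norm of
\<open>f\<close>.\<close>

lemma reverse_hoelder_product:
  fixes f :: "'i \<Rightarrow> int \<Rightarrow> real" and P :: "int set" and w w' :: "int \<Rightarrow> 'i \<Rightarrow> int"
  assumes I: "finite I" "k \<in> I" "l \<in> I" "k \<noteq> l"
    and P: "finite P" "\<And>p. p \<in> P \<Longrightarrow> prime p \<and> p \<ge> 100 \<and> transversal p k l (w p) (w' p)"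
    and f: "\<And>i x. f i x \<ge> 0"
  shows "(\<Sum>x\<in>Pi\<^sub>E I (\<lambda>_. {0..<\<Prod>P}).
            (\<Prod>p\<in>P. 1 + (1/100) * real_of_int p * of_bool (on_hyperplane I (w p) 0 p x \<or> on_hyperplane I (w' p) 0 p x)) * (\<Prod>i\<in>I. f i (x i)))
     \<ge> (1 + 3/200) ^ card P * (\<Prod>i\<in>I. (\<Sum>x\<in>{0..<\<Prod>P}. sqrt (f i x))\<^sup>2 / real_of_int (\<Prod>P))"
  using P f
proof (induction P arbitrary: f rule: finite_induct)
  case empty
  have "{0..<1::int} = {0}" by auto
  moreover have "Pi\<^sub>E I (\<lambda>_. {0::int}) = {\<lambda>i\<in>I. 0}"
    by (auto simp: PiE_iff extensional_def fun_eq_iff)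
  ultimately show ?case using empty by simp
next
  case (insert p P)
  define Q where "Q = \<Prod>P"
  have pp: "prime p" "p \<ge> 100" "transversal p k l (w p) (w' p)" and PP: "\<And>q. q \<in> P \<Longrightarrow> prime q \<and> q \<ge> 100 \<and> transversal q k l (w q) (w' q)"
    using insert.prems by auto
  have f: "f i x \<ge> 0" for i x by (rule insert.prems)
  have Q0: "Q > 0" unfolding Q_def using PP by (intro prod_pos) force
  have pQ: "\<not> p dvd Q"
  proof
    assume "p dvd Q"
    then obtain q where "q \<in> P" "p dvd q"
      using pp(1) insert.hyps(1) unfolding Q_def by (auto simp: prime_dvd_prod_iff)
    moreover have "p = q" using pp(1) PP[OF \<open>q \<in> P\<close>] \<open>p dvd q\<close> by (simp add: primes_dvd_imp_eq)
    ultimately show False using insert.hyps(2) by simp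
  qed
  have Pi: "\<Prod>(insert p P) = Q * p" using insert.hyps by (simp add: Q_def mult.commute)
  define W where "W q x = 1 + (1/100) * real_of_int q * of_bool (on_hyperplane I (w q) 0 q x \<or> on_hyperplane I (w' q) 0 q x)" for q x
  have W0: "W q x \<ge> 0" if "q \<in> P" for q x
    using PP[OF that] by (simp add: W_def)
  define h where "h i u = (\<Sum>v\<in>{0..<p}. sqrt (f i (u + Q * v)))\<^sup>2 / real_of_int p" for i u
  have p0: "real_of_int p > 0" using pp by simp
  have h0: "h i u \<ge> 0" for i u using p0 by (simp add: h_def)
  have sqrt_h: "sqrt (h i u) = (\<Sum>v\<in>{0..<p}. sqrt (f i (u + Q * v))) / sqrt (real_of_int p)" for i u
    using f by (simp add: h_def real_sqrt_divide sum_nonneg)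
  have inner: "(1 + 3/200) * (\<Prod>i\<in>I. h i (u i)) \<le>
     (\<Sum>v\<in>Pi\<^sub>E I (\<lambda>_. {0..<p}). W p (\<lambda>i\<in>I. u i + Q * v i) * (\<Prod>i\<in>I. f i (u i + Q * v i)))" for u
  proof -
    have tr: "transversal p k l (\<lambda>i. w p i * Q) (\<lambda>i. w' p i * Q)"
    proof -
      have "(w p k * Q) * (w' p l * Q) - (w' p k * Q) * (w p l * Q) = (w p k * w' p l - w' p k * w p l) * (Q * Q)"
        by (simp add: algebra_simps)
      then show ?thesis using pp pQ by (simp add: transversal_def prime_dvd_mult_iff)
    qed
    have oh: "on_hyperplane I w 0 p (\<lambda>i\<in>I. u i + Q * v i) \<longleftrightarrow> on_hyperplane I (\<lambda>i. w i * Q) (\<Sum>i\<in>I. w i * u i) p v"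
      for w :: "'i \<Rightarrow> int" and v
    proof -
      have "(\<Sum>i\<in>I. w i * (\<lambda>i\<in>I. u i + Q * v i) i) = (\<Sum>i\<in>I. w i * u i + w i * Q * v i)"
        by (intro sum.cong refl) (simp add: algebra_simps)
      then show ?thesis unfolding on_hyperplane_def by (simp add: sum.distrib algebra_simps)
    qed
    show ?thesis unfolding h_def W_def oh
      by (rule reverse_hoelder_two_hyperplanes[OF I pp(1,2) tr, of "\<lambda>i v. f i (u i + Q * v)"]) (rule f)
  qed
  have Wper: "W q (\<lambda>i\<in>I. u i + Q * v i) = W q u" if q: "q \<in> P" for q u v
  proof -
    have "q dvd Q" unfolding Q_def using dvd_prodI[OF insert.hyps(1) q, of "\<lambda>x. x"] by simp
    then have "[(\<lambda>i\<in>I. u i + Q * v i) i = u i] (mod q)" if "i \<in> I" for i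
      using that by (auto simp: cong_iff_dvd_diff)
    then have "on_hyperplane I a 0 q (\<lambda>i\<in>I. u i + Q * v i) = on_hyperplane I a 0 q u" for a
      by (rule on_hyperplane_cong)
    then show ?thesis by (simp only: W_def)
  qed
  have IH: "(1 + 3/200) ^ card P * (\<Prod>i\<in>I. (\<Sum>x\<in>{0..<Q}. sqrt (h i x))\<^sup>2 / real_of_int Q)
     \<le> (\<Sum>x\<in>Pi\<^sub>E I (\<lambda>_. {0..<Q}). (\<Prod>p\<in>P. W p x) * (\<Prod>i\<in>I. h i (x i)))"
    unfolding Q_def W_def by (rule insert.IH) (use PP h0 in auto)
  have norms: "(\<Sum>x\<in>{0..<Q}. sqrt (h i x))\<^sup>2 / real_of_int Q = (\<Sum>x\<in>{0..<Q * p}. sqrt (f i x))\<^sup>2 / real_of_int (Q * p)" for i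
  proof -
    have "(\<Sum>x\<in>{0..<Q * p}. sqrt (f i x)) = (\<Sum>u\<in>{0..<Q}. \<Sum>v\<in>{0..<p}. sqrt (f i (u + Q * v)))"
      by (rule sum_base_split[OF Q0])
    also have "\<dots> = sqrt (real_of_int p) * (\<Sum>x\<in>{0..<Q}. sqrt (h i x))"
      using p0 by (simp add: sqrt_h sum_divide_distrib[symmetric])
    finally show ?thesis using p0 by (simp add: power_mult_distrib)
  qed
  have "(1 + 3/200) ^ card (insert p P) * (\<Prod>i\<in>I. (\<Sum>x\<in>{0..<Q * p}. sqrt (f i x))\<^sup>2 / real_of_int (Q * p))
      = (1 + 3/200) * ((1 + 3/200) ^ card P * (\<Prod>i\<in>I. (\<Sum>x\<in>{0..<Q}. sqrt (h i x))\<^sup>2 / real_of_int Q))"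
    using insert.hyps by (simp add: norms)
  also have "\<dots> \<le> (1 + 3/200) * (\<Sum>x\<in>Pi\<^sub>E I (\<lambda>_. {0..<Q}). (\<Prod>p\<in>P. W p x) * (\<Prod>i\<in>I. h i (x i)))"
    using IH by (rule mult_left_mono) simp
  also have "\<dots> = (\<Sum>x\<in>Pi\<^sub>E I (\<lambda>_. {0..<Q}). (\<Prod>p\<in>P. W p x) * ((1 + 3/200) * (\<Prod>i\<in>I. h i (x i))))"
    by (simp only: sum_distrib_left mult.left_commute)
  also have "\<dots> \<le> (\<Sum>u\<in>Pi\<^sub>E I (\<lambda>_. {0..<Q}). (\<Prod>p\<in>P. W p u) *
     (\<Sum>v\<in>Pi\<^sub>E I (\<lambda>_. {0..<p}). W p (\<lambda>i\<in>I. u i + Q * v i) * (\<Prod>i\<in>I. f i (u i + Q * v i))))"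
    by (intro sum_mono mult_left_mono inner prod_nonneg W0)
  also have "\<dots> = (\<Sum>u\<in>Pi\<^sub>E I (\<lambda>_. {0..<Q}). \<Sum>v\<in>Pi\<^sub>E I (\<lambda>_. {0..<p}).
      (\<Prod>q\<in>insert p P. W q (\<lambda>i\<in>I. u i + Q * v i)) * (\<Prod>i\<in>I. f i ((\<lambda>i\<in>I. u i + Q * v i) i)))"
  proof -
    have "(\<Prod>q\<in>insert p P. W q (\<lambda>i\<in>I. u i + Q * v i)) * (\<Prod>i\<in>I. f i ((\<lambda>i\<in>I. u i + Q * v i) i))
        = (\<Prod>p\<in>P. W p u) * (W p (\<lambda>i\<in>I. u i + Q * v i) * (\<Prod>i\<in>I. f i (u i + Q * v i)))" for u v
    proof -
      have "(\<Prod>q\<in>P. W q (\<lambda>i\<in>I. u i + Q * v i)) = (\<Prod>q\<in>P. W q u)"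
        by (intro prod.cong refl Wper)
      moreover have "(\<Prod>i\<in>I. f i ((\<lambda>i\<in>I. u i + Q * v i) i)) = (\<Prod>i\<in>I. f i (u i + Q * v i))"
        by (intro prod.cong refl) simp
      ultimately show ?thesis by (simp only: prod.insert[OF insert.hyps(1,2)] mult_ac)
    qed
    then show ?thesis by (simp only: sum_distrib_left)
  qed
  also have "\<dots> = (\<Sum>x\<in>Pi\<^sub>E I (\<lambda>_. {0..<Q * p}). (\<Prod>q\<in>insert p P. W q x) * (\<Prod>i\<in>I. f i (x i)))"
    using Q0 pp(2) by (simp only: sum_PiE_base_split)
  finally show ?case unfolding W_def Pi .
qed

section \<open>From hyperplanes to many representations\<close>

lemma card_residue_class_le:
  fixes Q y :: int
  assumes Q: "Q > 0" and S: "S \<subseteq> {1..int N}"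
  shows "real (card {a \<in> S. a mod Q = y}) \<le> real N / real_of_int Q + 1"
proof -
  have "inj_on (\<lambda>a. a div Q) {a \<in> S. a mod Q = y}"
    by (rule inj_onI) (metis (mono_tags, lifting) mem_Collect_eq mult_div_mod_eq)
  moreover have "(\<lambda>a. a div Q) ` {a \<in> S. a mod Q = y} \<subseteq> {0..int N div Q}"
    using S Q by (auto simp: pos_imp_zdiv_nonneg_iff intro!: zdiv_mono1)
  ultimately have "card {a \<in> S. a mod Q = y} \<le> card {0..int N div Q}"
    by (intro card_inj_on_le) auto
  then have "real (card {a \<in> S. a mod Q = y}) \<le> real (nat (int N div Q + 1))" by simp
  also have "\<dots> = real_of_int (int N div Q) + 1" using Q by (simp add: pos_imp_zdiv_nonneg_iff)
  also have "real_of_int (int N div Q) \<le> real N / real_of_int Q"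
    using real_of_int_div4[of "int N" Q] by simp
  finally show ?thesis by simp
qed

lemma card_multiples_le:
  fixes D :: int and B :: real
  assumes D: "D > 0" and B: "B \<ge> 0"
  shows "finite {m :: int. D dvd m \<and> \<bar>real_of_int m\<bar> \<le> B}" 
    and "real (card {m :: int. D dvd m \<and> \<bar>real_of_int m\<bar> \<le> B}) \<le> 2 * B / real_of_int D + 1"
proof -
  let ?M = "{m :: int. D dvd m \<and> \<bar>real_of_int m\<bar> \<le> B}" and ?z = "\<lfloor>B / real_of_int D\<rfloor>"
  have sub: "?M \<subseteq> (\<lambda>j. D * j) ` {- ?z..?z}"
  proof
    fix m assume m: "m \<in> ?M"
    then obtain j where j: "m = D * j" by (auto elim: dvdE)
    have "\<bar>real_of_int j\<bar> \<le> B / real_of_int D"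
      using m D unfolding j by (simp add: le_divide_eq abs_mult mult.commute)
    then have "\<bar>j\<bar> \<le> ?z" by (simp add: le_floor_iff)
    then show "m \<in> (\<lambda>j. D * j) ` {- ?z..?z}" unfolding j by (intro image_eqI[OF refl]) (simp add: abs_le_iff)
  qed
  then show "finite ?M" by (rule finite_subset) simp
  have "card ?M \<le> card ((\<lambda>j. D * j) ` {- ?z..?z})" by (rule card_mono[OF _ sub]) simp
  also have "\<dots> \<le> card {- ?z..?z}" by (rule card_image_le) simp
  finally have "real (card ?M) \<le> real (nat (2 * ?z + 1))" by (simp add: algebra_simps)
  also have "\<dots> = 2 * real_of_int ?z + 1" using B D by simp
  also have "\<dots> \<le> 2 * (B / real_of_int D) + 1" using of_int_floor_le[of "B / real_of_int D"] by argo
  finally show "real (card ?M) \<le> 2 * B / real_of_int D + 1" by simp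
qed

lemma prod_primes_dvd:
  fixes m :: int
  assumes "finite S" "\<And>p. p \<in> S \<Longrightarrow> prime p" "\<And>p. p \<in> S \<Longrightarrow> p dvd m"
  shows "\<Prod>S dvd m"
  using assms
proof (induction S rule: finite_induct)
  case (insert p S)
  have p: "prime p" by (rule insert.prems) simp
  have "\<not> p dvd \<Prod>S"
  proof
    assume "p dvd \<Prod>S"
    then obtain q where q: "q \<in> S" "p dvd q"
      using prime_dvd_prod_iff[OF insert.hyps(1) p, of "\<lambda>x. x"] by auto
    moreover have "prime q" by (rule insert.prems) (simp add: q)
    ultimately have "p = q" using p by (intro primes_dvd_imp_eq) 
    then show False using q insert.hyps by simp
  qed
  then have "coprime p (\<Prod>S)" by (rule prime_imp_coprime[OF p])
  moreover have "\<Prod>S dvd m" by (rule insert.IH) (simp_all add: insert.prems)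
  moreover have "p dvd m" by (rule insert.prems) simp
  ultimately have "p * \<Prod>S dvd m" by (intro divides_mult)
  then show ?case by (simp only: prod.insert[OF insert.hyps(1,2)])
qed simp

text \<open>The sum \<open>T\<close> of the weights over the product set is bounded in two ways.  Grouping by residues modulo
\<open>Q\<close>, the number of elements of \<open>A i\<close> in a class is at most \<open>2 * N / Q\<close>, so
\<open>reverse_hoelder_product\<close> gives the lower bound \<open>(203/200) ^ card P\<close> times the square of the
product of the cardinalities, divided by \<open>(2 * N) ^ r\<close>.  Expanding the weights, the term of a subset with product \<open>D\<close> counts points
whose value is a multiple of \<open>D\<close>; within the bound \<open>B * N ^ r\<close> there are at most \<open>(2 * B + 1) * N ^ r / D\<close> such values, each taken
at most \<open>g\<close> times.  Summed over the subsets this gives the upper bound of order \<open>(101/100) ^ card P\<close>, and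
\<open>202/203\<close> is the quotient.\<close>

lemma product_set_bound:
  fixes Fn :: "('i \<Rightarrow> int) \<Rightarrow> int" and A :: "'i \<Rightarrow> int set" and w w' :: "int \<Rightarrow> 'i \<Rightarrow> int"
  assumes I: "finite I" "k \<in> I" "l \<in> I" "k \<noteq> l"
    and P: "finite P" "\<And>p. p \<in> P \<Longrightarrow> prime p \<and> p \<ge> 100 \<and> transversal p k l (w p) (w' p)"
    and dvd: "\<And>p a. p \<in> P \<Longrightarrow> on_hyperplane I (w p) 0 p a \<or> on_hyperplane I (w' p) 0 p a \<Longrightarrow> p dvd Fn a"
    and A: "\<And>i. i \<in> I \<Longrightarrow> A i \<subseteq> {1..int N}"
    and QN: "\<Prod>P \<le> int N" and N: "N \<ge> 1"
    and B: "B \<ge> 0" "\<And>a. a \<in> Pi\<^sub>E I A \<Longrightarrow> \<bar>real_of_int (Fn a)\<bar> \<le> B * real N ^ card I"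
    and g: "\<And>m. real (card {a \<in> Pi\<^sub>E I A. Fn a = m}) \<le> g"
  shows "(\<Prod>i\<in>I. real (card (A i)))\<^sup>2 \<le> 2 ^ card I * (2 * B + 1) * g * (real N ^ card I)\<^sup>2 * (202/203) ^ card P"
proof -
  define Q where "Q = \<Prod>P"
  define r where "r = card I"
  have r1: "r \<ge> 1" unfolding r_def using I by (metis card_gt_0_iff empty_iff Suc_leI One_nat_def)
  have Q0: "Q > 0" unfolding Q_def using P by (intro prod_pos) force
  have finA: "finite (A i)" if "i \<in> I" for i using A[OF that] finite_subset by blast
  have finPi: "finite (Pi\<^sub>E I A)" using finA I by (intro finite_PiE) auto
  have g0: "g \<ge> 0" using g[of 0] by (meson of_nat_0_le_iff order_trans)
  define hit where "hit p a \<longleftrightarrow> on_hyperplane I (w p) 0 p a \<or> on_hyperplane I (w' p) 0 p a" for p a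
  define W where "W a = (\<Prod>p\<in>P. 1 + (1/100) * real_of_int p * of_bool (hit p a))" for a
  define f where "f i y = real (card {a \<in> A i. a mod Q = y})" for i y
  define T where "T = (\<Sum>a\<in>Pi\<^sub>E I A. W a)"
  have Wmod: "W (\<lambda>i\<in>I. a i mod Q) = W a" for a
  proof -
    have "hit p (\<lambda>i\<in>I. a i mod Q) = hit p a" if "p \<in> P" for p
    proof -
      have "p dvd Q" unfolding Q_def using dvd_prodI[OF P(1) that, of "\<lambda>x. x"] by simp
      then have "[(\<lambda>i\<in>I. a i mod Q) i = a i] (mod p)" if "i \<in> I" for i
        using that mod_mod_cancel[OF \<open>p dvd Q\<close>, of "a i"] by (simp add: Cong.cong_def)
      then have "on_hyperplane I v 0 p (\<lambda>i\<in>I. a i mod Q) = on_hyperplane I v 0 p a" for v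
        by (rule on_hyperplane_cong)
      then show ?thesis by (simp only: hit_def)
    qed
    then show ?thesis unfolding W_def by (intro prod.cong) auto
  qed
  have T1: "T = (\<Sum>x\<in>Pi\<^sub>E I (\<lambda>_. {0..<Q}). W x * (\<Prod>i\<in>I. f i (x i)))"
  proof -
    have "T = (\<Sum>x\<in>Pi\<^sub>E I (\<lambda>_. {0..<Q}). \<Sum>a\<in>{a. a \<in> Pi\<^sub>E I A \<and> (\<lambda>i\<in>I. a i mod Q) = x}. W a)"
      unfolding T_def by (rule sum.group[symmetric]) (use finPi I Q0 in \<open>auto intro!: finite_PiE\<close>)
    also have "\<dots> = (\<Sum>x\<in>Pi\<^sub>E I (\<lambda>_. {0..<Q}). W x * (\<Prod>i\<in>I. f i (x i)))"
    proof (intro sum.cong refl)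
      fix x :: "'i \<Rightarrow> int" assume x: "x \<in> Pi\<^sub>E I (\<lambda>_. {0..<Q})"
      have eq: "{a. a \<in> Pi\<^sub>E I A \<and> (\<lambda>i\<in>I. a i mod Q) = x} = Pi\<^sub>E I (\<lambda>i. {a \<in> A i. a mod Q = x i})"
        using x by (fastforce simp: PiE_iff extensional_def fun_eq_iff)
      have "(\<Sum>a\<in>{a. a \<in> Pi\<^sub>E I A \<and> (\<lambda>i\<in>I. a i mod Q) = x}. W a) = (\<Sum>a\<in>{a. a \<in> Pi\<^sub>E I A \<and> (\<lambda>i\<in>I. a i mod Q) = x}. W x)"
        by (intro sum.cong refl) (use Wmod in auto)
      also have "\<dots> = real (card (Pi\<^sub>E I (\<lambda>i. {a \<in> A i. a mod Q = x i}))) * W x"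
        unfolding eq by simp
      also have "\<dots> = W x * (\<Prod>i\<in>I. f i (x i))"
        using I by (simp add: card_PiE f_def)
      finally show "(\<Sum>a\<in>{a. a \<in> Pi\<^sub>E I A \<and> (\<lambda>i\<in>I. a i mod Q) = x}. W a) = W x * (\<Prod>i\<in>I. f i (x i))" .
    qed
    finally show ?thesis .
  qed
  have f0: "f i y \<ge> 0" for i y by (simp add: f_def)
  define M where "M = real N / real_of_int Q + 1"
  have M0: "M > 0" unfolding M_def using Q0 by (intro add_nonneg_pos) auto
  have fM: "f i y \<le> M" if "i \<in> I" for i y
    unfolding f_def M_def by (rule card_residue_class_le[OF Q0 A[OF that]])
  have MQ: "M * real_of_int Q \<le> 2 * real N"
    using Q0 QN by (simp add: M_def Q_def[symmetric] algebra_simps)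
  have low: "(real (card (A i)))\<^sup>2 / (2 * real N) \<le> (\<Sum>x\<in>{0..<Q}. sqrt (f i x))\<^sup>2 / real_of_int Q" if i: "i \<in> I" for i
  proof -
    have "real (card (A i)) = (\<Sum>a\<in>A i. 1)" by simp
    also have "\<dots> = (\<Sum>x\<in>{0..<Q}. \<Sum>a\<in>{a. a \<in> A i \<and> a mod Q = x}. 1)"
      by (rule sum.group[symmetric]) (use finA[OF i] Q0 in auto)
    also have "\<dots> = (\<Sum>x\<in>{0..<Q}. f i x)" by (simp add: f_def)
    also have "\<dots> \<le> (\<Sum>x\<in>{0..<Q}. sqrt M * sqrt (f i x))"
    proof (rule sum_mono)
      fix x
      have "f i x = sqrt (f i x) * sqrt (f i x)" using f0 by simp
      also have "\<dots> \<le> sqrt M * sqrt (f i x)" using fM[OF i] f0 by (intro mult_right_mono) auto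
      finally show "f i x \<le> sqrt M * sqrt (f i x)" .
    qed
    finally have "real (card (A i)) \<le> sqrt M * (\<Sum>x\<in>{0..<Q}. sqrt (f i x))"
      by (simp only: sum_distrib_left)
    then have "(real (card (A i)))\<^sup>2 \<le> (sqrt M * (\<Sum>x\<in>{0..<Q}. sqrt (f i x)))\<^sup>2"
      by (intro power_mono) auto
    then have le: "(real (card (A i)))\<^sup>2 \<le> M * (\<Sum>x\<in>{0..<Q}. sqrt (f i x))\<^sup>2"
      using M0 by (simp add: power_mult_distrib)
    have "(real (card (A i)))\<^sup>2 / (2 * real N) \<le> (real (card (A i)))\<^sup>2 / (M * real_of_int Q)"
      using MQ M0 Q0 N by (intro divide_left_mono) auto
    also have "\<dots> \<le> M * (\<Sum>x\<in>{0..<Q}. sqrt (f i x))\<^sup>2 / (M * real_of_int Q)"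
      using le M0 Q0 by (intro divide_right_mono) auto
    finally show ?thesis using M0 by simp
  qed
  have "(1 + 3/200) ^ card P * (\<Prod>i\<in>I. (real (card (A i)))\<^sup>2 / (2 * real N)) 
      \<le> (1 + 3/200) ^ card P * (\<Prod>i\<in>I. (\<Sum>x\<in>{0..<Q}. sqrt (f i x))\<^sup>2 / real_of_int Q)"
    by (intro mult_left_mono prod_mono conjI low) auto
  also have "\<dots> \<le> T"
    unfolding T1 W_def hit_def Q_def
    by (rule reverse_hoelder_product[OF I P(1)]) (use P f0 in auto)
  finally have lower: "(1 + 3/200) ^ card P * (\<Prod>i\<in>I. (real (card (A i)))\<^sup>2 / (2 * real N)) \<le> T" .
  \<comment> \<open>The subsets \<open>S\<close> of \<open>P\<close> stand for the squarefree divisors of \<open>Q\<close>.\<close>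
  have "T = (\<Sum>a\<in>Pi\<^sub>E I A. \<Sum>S\<in>Pow P. (\<Prod>p\<in>S. (1/100) * real_of_int p * of_bool (hit p a)))"
    unfolding T_def W_def by (subst add.commute, subst prod_add[OF P(1)]) simp
  also have "\<dots> = (\<Sum>S\<in>Pow P. (1/100) ^ card S * real_of_int (\<Prod>S) * real (card {a \<in> Pi\<^sub>E I A. \<forall>p\<in>S. hit p a}))"
  proof (subst sum.swap, intro sum.cong refl)
    fix S assume "S \<in> Pow P"
    then have finS: "finite S" using P(1) finite_subset by blast
    have "(\<Prod>p\<in>S. (1/100) * real_of_int p * of_bool (hit p a)) = (1/100) ^ card S * real_of_int (\<Prod>S) * of_bool (\<forall>p\<in>S. hit p a)" for a
    proof (cases "\<forall>p\<in>S. hit p a")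
      case True then show ?thesis by (simp add: prod_dividef power_divide)
    next
      case False then show ?thesis using finS by (auto intro!: prod_zero)
    qed
    then show "(\<Sum>a\<in>Pi\<^sub>E I A. \<Prod>p\<in>S. (1/100) * real_of_int p * of_bool (hit p a))
      = (1/100) ^ card S * real_of_int (\<Prod>S) * real (card {a \<in> Pi\<^sub>E I A. \<forall>p\<in>S. hit p a})"
      using finPi by (simp add: sum_distrib_left[symmetric] Int_def)
  qed
  also have "\<dots> \<le> (\<Sum>S\<in>Pow P. (1/100) ^ card S * ((2 * B + 1) * g * real N ^ r))"
  proof (rule sum_mono)
    fix S assume "S \<in> Pow P"
    then have S: "S \<subseteq> P" "finite S" using P(1) finite_subset by auto
    define D where "D = \<Prod>S"
    have D0: "D > 0" unfolding D_def using P S by (intro prod_pos) force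
    have "D dvd Q" unfolding D_def Q_def using S P(1) by (intro prod_dvd_prod_subset) auto
    then have "D \<le> int N" using zdvd_imp_le[of D Q] Q0 QN Q_def by simp
    then have "real_of_int D \<le> real N" by (metis of_int_le_iff of_int_of_nat_eq)
    also have "real N \<le> real N ^ r" using N r1 by (intro self_le_power) auto
    finally have DN: "real_of_int D \<le> real N ^ r" .
    define Ms where "Ms = {m :: int. D dvd m \<and> \<bar>real_of_int m\<bar> \<le> B * real N ^ r}"
    have BN: "B * real N ^ r \<ge> 0" using B by simp
    have Ms: "finite Ms" "real (card Ms) \<le> 2 * (B * real N ^ r) / real_of_int D + 1"
      unfolding Ms_def using card_multiples_le[OF D0 BN] by auto
    have "{a \<in> Pi\<^sub>E I A. \<forall>p\<in>S. hit p a} \<subseteq> (\<Union>m\<in>Ms. {a \<in> Pi\<^sub>E I A. Fn a = m})"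
    proof
      fix a assume a: "a \<in> {a \<in> Pi\<^sub>E I A. \<forall>p\<in>S. hit p a}"
      have "D dvd Fn a" unfolding D_def
      proof (rule prod_primes_dvd[OF S(2)])
        fix p assume p: "p \<in> S"
        then have "hit p a" using a by blast
        then show "p dvd Fn a" using dvd[of p a] p S(1) unfolding hit_def by blast
      qed (use P S in blast)
      then show "a \<in> (\<Union>m\<in>Ms. {a \<in> Pi\<^sub>E I A. Fn a = m})"
        using a B(2)[of a] by (auto simp: Ms_def r_def)
    qed
    then have "card {a \<in> Pi\<^sub>E I A. \<forall>p\<in>S. hit p a} \<le> card (\<Union>m\<in>Ms. {a \<in> Pi\<^sub>E I A. Fn a = m})"
      using Ms(1) finPi by (intro card_mono) auto
    also have "\<dots> \<le> (\<Sum>m\<in>Ms. card {a \<in> Pi\<^sub>E I A. Fn a = m})" by (rule card_UN_le[OF Ms(1)])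
    finally have "real (card {a \<in> Pi\<^sub>E I A. \<forall>p\<in>S. hit p a}) \<le> (\<Sum>m\<in>Ms. real (card {a \<in> Pi\<^sub>E I A. Fn a = m}))"
      by (simp only: of_nat_le_iff of_nat_sum[symmetric])
    also have "\<dots> \<le> (\<Sum>m\<in>Ms. g)" by (intro sum_mono g)
    also have "\<dots> = real (card Ms) * g" by simp
    also have "\<dots> \<le> (2 * (B * real N ^ r) / real_of_int D + 1) * g"
      using Ms(2) g0 by (rule mult_right_mono)
    finally have "real_of_int D * real (card {a \<in> Pi\<^sub>E I A. \<forall>p\<in>S. hit p a}) \<le> real_of_int D * ((2 * (B * real N ^ r) / real_of_int D + 1) * g)"
      using D0 by (intro mult_left_mono) auto
    also have "\<dots> = (2 * (B * real N ^ r) + real_of_int D) * g"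
    proof -
      have "real_of_int D * (z / real_of_int D + 1) = z + real_of_int D" for z
        using D0 by (simp add: distrib_left)
      then show ?thesis by (simp only: mult.assoc[symmetric])
    qed
    also have "\<dots> \<le> (2 * (B * real N ^ r) + real N ^ r) * g"
      using DN g0 by (intro mult_right_mono) auto
    also have "\<dots> = (2 * B + 1) * g * real N ^ r" by (simp add: algebra_simps)
    finally show "(1/100) ^ card S * real_of_int (\<Prod>S) * real (card {a \<in> Pi\<^sub>E I A. \<forall>p\<in>S. hit p a})
       \<le> (1/100) ^ card S * ((2 * B + 1) * g * real N ^ r)"
      unfolding D_def mult.assoc[of "(1/100) ^ card S"] by (intro mult_left_mono) auto
  qed
  also have "\<dots> = (1 + 1/100) ^ card P * ((2 * B + 1) * g * real N ^ r)"
  proof -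
    have "(\<Sum>S\<in>Pow P. (1/100::real) ^ card S) = (\<Prod>p\<in>P. 1/100 + 1)"
      by (subst prod_add[OF P(1)]) simp
    then show ?thesis by (simp add: sum_distrib_right[symmetric])
  qed
  finally have upper: "T \<le> (1 + 1/100) ^ card P * ((2 * B + 1) * g * real N ^ r)" .
  have prod: "(\<Prod>i\<in>I. (real (card (A i)))\<^sup>2 / (2 * real N)) = (\<Prod>i\<in>I. real (card (A i)))\<^sup>2 / (2 * real N) ^ r"
    by (simp add: prod_dividef r_def prod_power_distrib)
  have N0: "real N > 0" using N by simp
  have "(1 + 3/200) ^ card P * ((\<Prod>i\<in>I. real (card (A i)))\<^sup>2 / (2 * real N) ^ r) \<le> (1 + 1/100) ^ card P * ((2 * B + 1) * g * real N ^ r)"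
    using lower upper unfolding prod by linarith
  then have "(\<Prod>i\<in>I. real (card (A i)))\<^sup>2 \<le> (2 * real N) ^ r * ((1 + 1/100) ^ card P * ((2 * B + 1) * g * real N ^ r)) / (1 + 3/200) ^ card P"
    using N0 by (simp add: field_simps)
  also have "\<dots> = 2 ^ r * (2 * B + 1) * g * (real N ^ r)\<^sup>2 * ((1 + 1/100) ^ card P / (1 + 3/200) ^ card P)"
    by (simp only: power_mult_distrib power2_eq_square) simp
  also have "(1 + 1/100) ^ card P / (1 + 3/200) ^ card P = (202/203::real) ^ card P"
    by (simp only: power_divide[symmetric]) simp
  finally show ?thesis unfolding r_def .
qed

section \<open>Many primes divide the values of a polynomial\<close>

lemma card_roots_mod_prime_le:
  fixes H :: "int poly" and p :: int
  assumes p: "prime p" and "\<not> p dvd coeff H i"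
  shows "card {x \<in> {0..<p}. p dvd poly H x} \<le> degree H"
  using assms(2)
proof (induction "degree H" arbitrary: H i)
  case 0
  then obtain c where c: "H = [:c:]" by (metis degree_eq_zeroE)
  then have "\<not> p dvd c" using 0 by (cases i) (auto simp: coeff_pCons)
  then have e: "{x \<in> {0..<p}. p dvd poly H x} = {}" by (auto simp: c)
  show ?case by (simp only: e) simp
next
  case (Suc d)
  show ?case
  proof (cases "{x \<in> {0..<p}. p dvd poly H x} = {}")
    case True then show ?thesis by (simp only: True) simp
  next
    case False
    then obtain a where a: "a \<in> {0..<p}" "p dvd poly H a" by blast
    define G where "G = synthetic_div H a"
    have H: "H = [:- a, 1:] * G + [:poly H a:]"
      unfolding G_def by (simp only: synthetic_div_correct')
    have dG: "d = degree G" using Suc(2) by (simp add: G_def degree_synthetic_div)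
    have "\<exists>j. \<not> p dvd coeff G j"
    proof (rule ccontr)
      assume "\<not> (\<exists>j. \<not> p dvd coeff G j)"
      then have "p dvd coeff ([:- a, 1:] * G + [:poly H a:]) i"
        using a by (auto simp: coeff_pCons split: nat.split)
      then show False using Suc.prems by (simp only: H[symmetric])
    qed
    then obtain j where j: "\<not> p dvd coeff G j" by blast
    have "{x \<in> {0..<p}. p dvd poly H x} \<subseteq> insert a {x \<in> {0..<p}. p dvd poly G x}"
    proof
      fix x assume x: "x \<in> {x \<in> {0..<p}. p dvd poly H x}"
      have "poly H x = (x - a) * poly G x + poly H a" by (subst H) (simp add: algebra_simps)
      then have "p dvd (x - a) * poly G x" using x a by (simp add: dvd_add_left_iff)
      then have "p dvd x - a \<or> p dvd poly G x" using p by (simp add: prime_dvd_mult_iff)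
      moreover have "x = a" if "p dvd x - a"
        using that x a by (metis (no_types, lifting) atLeastLessThan_iff mem_Collect_eq mod_eq_dvd_iff mod_pos_pos_trivial)
      ultimately show "x \<in> insert a {x \<in> {0..<p}. p dvd poly G x}" using x by auto
    qed
    then have "card {x \<in> {0..<p}. p dvd poly H x} \<le> card (insert a {x \<in> {0..<p}. p dvd poly G x})"
      by (rule card_mono[rotated]) (simp add: finite_subset[OF Collect_restrict] del: mem_Collect_eq atLeastLessThan_iff)
    also have "\<dots> \<le> Suc (card {x \<in> {0..<p}. p dvd poly G x})" by (rule card_insert_le_m1) simp_all
    also have "\<dots> \<le> Suc d" using Suc(1)[OF dG j] dG by simp
    finally show ?thesis using Suc(2) by simp
  qed
qed

lemma poly_taylor_int:
  fixes H :: "int poly"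
  obtains c where "poly H y = poly H x + (y - x) * poly (pderiv H) x + (y - x)\<^sup>2 * c"
proof -
  have "\<exists>c. poly H y = poly H x + (y - x) * poly (pderiv H) x + (y - x)\<^sup>2 * c"
  proof (induction H)
    case 0 then show ?case by simp
  next
    case (pCons a H)
    then obtain c where c: "poly H y = poly H x + (y - x) * poly (pderiv H) x + (y - x)\<^sup>2 * c" by blast
    have "poly (pCons a H) y = poly (pCons a H) x + (y - x) * poly (pderiv (pCons a H)) x + (y - x)\<^sup>2 * (poly (pderiv H) x + y * c)"
      by (simp add: c pderiv_pCons algebra_simps power2_eq_square)
    then show ?case by blast
  qed
  then show thesis using that by blast
qed

text \<open>Uniqueness in Hensel's lemma: by Taylor's formula the difference of the two values is \<open>y - x\<close> times an
integer congruent to the derivative, hence prime to \<open>p\<close>.\<close>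

lemma simple_root_lift_unique:
  fixes H :: "int poly" and p :: int
  assumes p: "prime p" and i: "i \<ge> 1" and x: "p ^ i dvd poly H x" and y: "p ^ i dvd poly H y"
    and xy: "p dvd y - x" and d: "\<not> p dvd poly (pderiv H) x"
  shows "p ^ i dvd y - x"
proof -
  obtain c where c: "poly H y = poly H x + (y - x) * poly (pderiv H) x + (y - x)\<^sup>2 * c"
    by (rule poly_taylor_int)
  have "p ^ i dvd poly H y - poly H x" using x y by (rule dvd_diff[rotated])
  also have "poly H y - poly H x = (poly (pderiv H) x + (y - x) * c) * (y - x)"
    unfolding c by (simp add: algebra_simps power2_eq_square)
  finally have dv: "p ^ i dvd (poly (pderiv H) x + (y - x) * c) * (y - x)" .
  have "\<not> p dvd poly (pderiv H) x + (y - x) * c"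
    using d xy by (metis dvd_add_left_iff dvd_mult2)
  then have "coprime (p ^ i) (poly (pderiv H) x + (y - x) * c)"
    using prime_imp_coprime[OF p] by (simp add: coprime_power_left_iff)
  then show ?thesis using dv by (simp add: coprime_dvd_mult_right_iff)
qed

text \<open>As roots modulo \<open>p\<close> lift uniquely, there are no more roots modulo \<open>p ^ i\<close> than modulo \<open>p\<close>, that is, at
most the degree.\<close>

lemma card_prime_power_dvd_values_le:
  fixes H :: "int poly" and p :: int
  assumes p: "prime p" and i: "i \<ge> 1" and c: "\<not> p dvd coeff H n"
    and sep: "\<And>x. p dvd poly H x \<Longrightarrow> \<not> p dvd poly (pderiv H) x"
  shows "real (card {j \<in> {1..int N}. p ^ i dvd poly H j}) \<le> real (degree H) * (real N / real_of_int (p ^ i) + 1)"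
proof -
  let ?q = "p ^ i"
  have p1: "p > 1" using p by (simp add: prime_gt_1_int)
  then have q0: "?q > 0" by simp
  define R where "R = {x \<in> {0..<?q}. ?q dvd poly H x}"
  have pq: "p dvd ?q" using i by (simp add: dvd_power)
  have finR: "finite R" unfolding R_def by (rule finite_subset[OF Collect_restrict]) simp
  have "card R \<le> card {x \<in> {0..<p}. p dvd poly H x}"
  proof (rule card_inj_on_le[of "\<lambda>x. x mod p"])
    show "inj_on (\<lambda>x. x mod p) R"
    proof (rule inj_onI)
      fix x y assume x: "x \<in> R" and y: "y \<in> R" and e: "x mod p = y mod p"
      have "p dvd y - x" using e by (simp add: mod_eq_dvd_iff dvd_diff_commute)
      moreover have "p dvd poly H x" using x pq by (auto simp: R_def intro: dvd_trans)
      ultimately have "?q dvd y - x"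
        using x y simple_root_lift_unique[OF p i _ _ _ sep] by (simp add: R_def)
      then show "x = y" using x y unfolding R_def
        by (metis (no_types, lifting) atLeastLessThan_iff mem_Collect_eq mod_eq_dvd_iff mod_pos_pos_trivial)
    qed
    show "(\<lambda>x. x mod p) ` R \<subseteq> {x \<in> {0..<p}. p dvd poly H x}"
    proof
      fix z assume "z \<in> (\<lambda>x. x mod p) ` R"
      then obtain x where x: "x \<in> R" "z = x mod p" by blast
      have "p dvd poly H x" using x pq by (auto simp: R_def intro: dvd_trans)
      obtain c where c: "poly H z = poly H x + (z - x) * poly (pderiv H) x + (z - x)\<^sup>2 * c"
        by (rule poly_taylor_int)
      have "p dvd z - x" using x by (simp add: mod_eq_dvd_iff[symmetric])
      then have "p dvd poly H z" unfolding c using \<open>p dvd poly H x\<close> by (simp add: power2_eq_square)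
      then show "z \<in> {x \<in> {0..<p}. p dvd poly H x}" using x p1 by simp
    qed
  qed (rule finite_subset[OF Collect_restrict], simp)
  then have cR: "card R \<le> degree H" using card_roots_mod_prime_le[OF p c] by linarith
  have "{j \<in> {1..int N}. ?q dvd poly H j} \<subseteq> (\<Union>x\<in>R. {j \<in> {1..int N}. j mod ?q = x})"
  proof
    fix j assume j: "j \<in> {j \<in> {1..int N}. ?q dvd poly H j}"
    obtain c where c: "poly H (j mod ?q) = poly H j + (j mod ?q - j) * poly (pderiv H) j + (j mod ?q - j)\<^sup>2 * c"
      by (rule poly_taylor_int)
    have "?q dvd j mod ?q - j" by (simp add: mod_eq_dvd_iff[symmetric])
    then have "?q dvd poly H (j mod ?q)" unfolding c using j by (simp add: power2_eq_square)
    then show "j \<in> (\<Union>x\<in>R. {j \<in> {1..int N}. j mod ?q = x})" using j q0 by (auto simp: R_def)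
  qed
  then have "card {j \<in> {1..int N}. ?q dvd poly H j} \<le> card (\<Union>x\<in>R. {j \<in> {1..int N}. j mod ?q = x})"
    by (rule card_mono[rotated]) (intro finite_UN_I finR finite_subset[OF Collect_restrict], simp)
  also have "\<dots> \<le> (\<Sum>x\<in>R. card {j \<in> {1..int N}. j mod ?q = x})" by (rule card_UN_le[OF finR])
  finally have "real (card {j \<in> {1..int N}. ?q dvd poly H j}) \<le> (\<Sum>x\<in>R. real (card {j \<in> {1..int N}. j mod ?q = x}))"
    by (simp only: of_nat_le_iff of_nat_sum[symmetric])
  also have "\<dots> \<le> (\<Sum>x\<in>R. real N / real_of_int ?q + 1)"
    by (intro sum_mono card_residue_class_le[OF q0]) simp
  also have "\<dots> = real (card R) * (real N / real_of_int ?q + 1)" by simp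
  also have "\<dots> \<le> real (degree H) * (real N / real_of_int ?q + 1)"
    using cR p1 by (intro mult_right_mono add_nonneg_nonneg divide_nonneg_nonneg) auto
  finally show ?thesis .
qed

text \<open>One half of Mertens' first theorem: the logarithm of \<open>m\<close> is at least the sum of \<open>ln p\<close> over the primes
dividing \<open>m\<close>.  Summing over \<open>m \<le> n\<close>, each prime \<open>p \<le> n\<close> is counted for at least \<open>n / (2 * p)\<close>
multiples.\<close>

lemma sum_ln_prime_div_le:
  fixes n :: nat
  assumes n: "n \<ge> 1"
  shows "(\<Sum>p\<in>{p. prime p \<and> p \<le> int n}. ln (real_of_int p) / real_of_int p) \<le> 2 * ln (real n)"
proof -
  define P where "P = {p. prime p \<and> p \<le> int n}"
  have "P \<subseteq> {0..int n}" by (auto simp: P_def prime_ge_0_int)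
  then have finP: "finite P" using finite_subset by blast
  have pP: "p > 1" "p \<le> int n" if "p \<in> P" for p using that by (auto simp: P_def prime_gt_1_int)
  have mult: "real n / 2 \<le> real_of_int p * real (card {m \<in> {1..int n}. p dvd m})" if p: "p \<in> P" for p
  proof -
    have p0: "p > 0" using pP[OF p] by simp
    have "(\<lambda>j. p * j) ` {1..int n div p} \<subseteq> {m \<in> {1..int n}. p dvd m}"
    proof
      fix m assume "m \<in> (\<lambda>j. p * j) ` {1..int n div p}"
      then obtain j where "j \<in> {1..int n div p}" and m: "m = p * j" by blast
      then have j: "m = p * j" "1 \<le> j" "j \<le> int n div p" by simp_all
      have "p * j \<le> p * (int n div p)" using j p0 by (intro mult_left_mono) auto
      also have "\<dots> \<le> p * (int n div p) + int n mod p" using pos_mod_sign[OF p0, of "int n"] by linarith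
      also have "\<dots> = int n" by (rule mult_div_mod_eq)
      finally have "p * j \<le> int n" .
      moreover have "p * j \<ge> 1" using mult_mono[of 1 p 1 j] j p0 by simp
      ultimately show "m \<in> {m \<in> {1..int n}. p dvd m}" using j by simp
    qed
    then have "card ((\<lambda>j. p * j) ` {1..int n div p}) \<le> card {m \<in> {1..int n}. p dvd m}"
      by (rule card_mono[rotated]) (rule finite_subset[OF Collect_restrict], simp)
    also have "card ((\<lambda>j. p * j) ` {1..int n div p}) = nat (int n div p)"
      using p0 by (subst card_image) (auto simp: inj_on_def)
    finally have 1: "real_of_int (int n div p) \<le> real (card {m \<in> {1..int n}. p dvd m})"
      using p0 by (simp add: nat_le_iff pos_imp_zdiv_nonneg_iff)
    have "int n div p \<ge> 1" using pP[OF p] p0 zdiv_mono1[of p "int n" p] by simp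
    then have "p \<le> p * (int n div p)" using p0 by simp
    moreover have "int n = p * (int n div p) + int n mod p" by simp
    moreover have "int n mod p < p" using p0 by simp
    ultimately have "int n \<le> 2 * (p * (int n div p))" by linarith
    then have "real n \<le> 2 * (real_of_int p * real_of_int (int n div p))"
      by (metis (mono_tags, opaque_lifting) of_int_le_iff of_int_mult of_int_numeral of_int_of_nat_eq)
    also have "\<dots> \<le> 2 * (real_of_int p * real (card {m \<in> {1..int n}. p dvd m}))"
      using 1 p0 by (intro mult_left_mono) auto
    finally show ?thesis by simp
  qed
  have m_bound: "(\<Sum>p\<in>{p \<in> P. p dvd m}. ln (real_of_int p)) \<le> ln (real n)" if m: "m \<in> {1..int n}" for m
  proof -
    have "\<Prod>{p \<in> P. p dvd m} dvd m" 
      by (rule prod_primes_dvd[OF finite_subset[OF Collect_restrict finP]]) (auto simp: P_def)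
    then have "\<Prod>{p \<in> P. p dvd m} \<le> int n" using m zdvd_imp_le[of "\<Prod>{p \<in> P. p dvd m}" m] by auto
    then have "real_of_int (\<Prod>{p \<in> P. p dvd m}) \<le> real_of_int (int n)" by (simp only: of_int_le_iff)
    then have le: "(\<Prod>p\<in>{p \<in> P. p dvd m}. real_of_int p) \<le> real n"
      by (simp only: of_int_prod of_int_of_nat_eq)
    have pos: "(\<Prod>p\<in>{p \<in> P. p dvd m}. real_of_int p) > 0" using pP by (intro prod_pos) force
    have "(\<Sum>p\<in>{p \<in> P. p dvd m}. ln (real_of_int p)) = ln (\<Prod>p\<in>{p \<in> P. p dvd m}. real_of_int p)"
      by (rule ln_prod[OF finite_subset[OF Collect_restrict finP], symmetric]) (use pP in force)
    also have "\<dots> \<le> ln (real n)" using le pos by (subst ln_le_cancel_iff) auto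
    finally show ?thesis .
  qed
  have "(\<Sum>p\<in>P. ln (real_of_int p) * (real n / 2 / real_of_int p)) \<le> (\<Sum>p\<in>P. ln (real_of_int p) * real (card {m \<in> {1..int n}. p dvd m}))"
  proof (intro sum_mono mult_left_mono)
    fix p assume p: "p \<in> P"
    then show "real n / 2 / real_of_int p \<le> real (card {m \<in> {1..int n}. p dvd m})"
      using mult[OF p] pP[OF p] by (simp add: divide_le_eq mult.commute)
    show "0 \<le> ln (real_of_int p)" using pP[OF p] by simp
  qed
  also have "\<dots> = (\<Sum>p\<in>P. \<Sum>m\<in>{1..int n}. ln (real_of_int p) * of_bool (p dvd m))"
    by (simp add: sum_distrib_left[symmetric] Int_def)
  also have "\<dots> = (\<Sum>m\<in>{1..int n}. \<Sum>p\<in>P. ln (real_of_int p) * of_bool (p dvd m))" by (rule sum.swap)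
  also have "\<dots> = (\<Sum>m\<in>{1..int n}. \<Sum>p\<in>{p \<in> P. p dvd m}. ln (real_of_int p))"
    by (intro sum.cong refl sum.mono_neutral_cong_right) (use finP in auto)
  also have "\<dots> \<le> (\<Sum>m\<in>{1..int n}. ln (real n))" by (intro sum_mono m_bound)
  also have "\<dots> = real n * ln (real n)" by simp
  finally have "(\<Sum>p\<in>P. ln (real_of_int p) * (real n / 2 / real_of_int p)) \<le> real n * ln (real n)" .
  moreover have "(\<Sum>p\<in>P. ln (real_of_int p) * (real n / 2 / real_of_int p)) = real n / 2 * (\<Sum>p\<in>P. ln (real_of_int p) / real_of_int p)"
    by (simp add: sum_distrib_left mult_ac)
  ultimately have "real n * ((\<Sum>p\<in>P. ln (real_of_int p) / real_of_int p) / 2) \<le> real n * ln (real n)" by simp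
  then have "(\<Sum>p\<in>P. ln (real_of_int p) / real_of_int p) / 2 \<le> ln (real n)" using n by simp
  then show ?thesis unfolding P_def by simp
qed

text \<open>The primes up to the square of the cardinality \<open>s\<close> of \<open>P\<close> are treated by the preceding bound.  For larger
ones \<open>ln p \<le> 2 * sqrt p\<close> makes every term at most \<open>2 / s\<close>, so they contribute at most 2.\<close>

lemma sum_ln_prime_div_card_le:
  fixes P :: "int set"
  assumes fin: "finite P" and pr: "\<And>p. p \<in> P \<Longrightarrow> prime p" 
  shows "(\<Sum>p\<in>P. ln (real_of_int p) / real_of_int p) \<le> 4 * ln (real (card P)) + 2"
proof (cases "P = {}")
  case False
  define s where "s = card P"
  have s0: "s > 0" using False fin by (simp add: s_def card_gt_0_iff)
  have p1: "p > 1" if "p \<in> P" for p using pr[OF that] by (simp add: prime_gt_1_int)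
  define S where "S = {p. prime p \<and> p \<le> int (s\<^sup>2)}"
  have finS: "finite S" unfolding S_def by (rule finite_subset[of _ "{0..int (s\<^sup>2)}"]) (auto simp: prime_ge_0_int)
  have S1: "p > 1" if "p \<in> S" for p using that by (simp add: S_def prime_gt_1_int)
  have "(\<Sum>p\<in>P \<inter> S. ln (real_of_int p) / real_of_int p) \<le> (\<Sum>p\<in>S. ln (real_of_int p) / real_of_int p)"
    using finS S1 by (intro sum_mono2) (force intro!: divide_nonneg_nonneg)+
  also have "\<dots> \<le> 2 * ln (real (s\<^sup>2))" unfolding S_def by (rule sum_ln_prime_div_le) (use s0 in simp)
  also have "\<dots> = 4 * ln (real s)" using s0 by (simp add: ln_realpow)
  finally have 1: "(\<Sum>p\<in>P \<inter> S. ln (real_of_int p) / real_of_int p) \<le> 4 * ln (real s)" .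
  have "(\<Sum>p\<in>P - S. ln (real_of_int p) / real_of_int p) \<le> (\<Sum>p\<in>P - S. 2 / real s)"
  proof (rule sum_mono)
    fix p assume p: "p \<in> P - S"
    then have big: "p > int (s\<^sup>2)" using pr by (auto simp: S_def)
    have p0: "real_of_int p > 0" using p1 p by force
    have "real_of_int (int (s\<^sup>2)) \<le> real_of_int p" using big by (simp only: of_int_le_iff)
    then have "(real s)\<^sup>2 \<le> real_of_int p" by simp
    then have rs: "real s \<le> sqrt (real_of_int p)" by (simp add: real_le_rsqrt)
    have "ln (real_of_int p) = 2 * ln (sqrt (real_of_int p))" using p0 by (simp add: ln_sqrt)
    also have "\<dots> \<le> 2 * sqrt (real_of_int p)" using p0 by (intro mult_left_mono ln_bound) auto
    finally have "ln (real_of_int p) / real_of_int p \<le> 2 * sqrt (real_of_int p) / real_of_int p"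
      using p0 by (intro divide_right_mono) auto
    also have "\<dots> = 2 / sqrt (real_of_int p)"
      using p0 by (simp add: real_div_sqrt field_simps)
    also have "\<dots> \<le> 2 / real s" using rs s0 p0 by (intro divide_left_mono) auto
    finally show "ln (real_of_int p) / real_of_int p \<le> 2 / real s" .
  qed
  also have "\<dots> = real (card (P - S)) * (2 / real s)" by simp
  also have "\<dots> \<le> real s * (2 / real s)"
    using card_mono[OF fin, of "P - S"] by (intro mult_right_mono) (auto simp: s_def)
  also have "\<dots> = 2" using s0 by simp
  finally have 2: "(\<Sum>p\<in>P - S. ln (real_of_int p) / real_of_int p) \<le> 2" .
  have "(\<Sum>p\<in>P. ln (real_of_int p) / real_of_int p) = (\<Sum>p\<in>P \<inter> S. ln (real_of_int p) / real_of_int p) + (\<Sum>p\<in>P - S. ln (real_of_int p) / real_of_int p)"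
    using fin by (metis sum.Int_Diff)
  then show ?thesis using 1 2 unfolding s_def by linarith
qed simp

definition prime_power_exps :: "int \<Rightarrow> real \<Rightarrow> nat set" where
  "prime_power_exps p B = {i. 1 \<le> i \<and> real_of_int p ^ i \<le> B}"

lemma prime_power_exps:
  assumes p: "p > 1" and B: "B \<ge> 1"
  shows "finite (prime_power_exps p B)" "real (card (prime_power_exps p B)) * ln (real_of_int p) \<le> ln B"
proof -
  have lp: "ln (real_of_int p) > 0" using p by simp
  define z where "z = nat \<lfloor>ln B / ln (real_of_int p)\<rfloor>"
  have q: "ln B / ln (real_of_int p) \<ge> 0" using lp B by simp
  have sub: "prime_power_exps p B \<subseteq> {1..z}"
  proof
    fix i assume i: "i \<in> prime_power_exps p B"
    then have "real_of_int p ^ i \<le> B" by (simp add: prime_power_exps_def)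
    then have "ln (real_of_int p ^ i) \<le> ln B" using p B by (subst ln_le_cancel_iff) auto
    then have "real i * ln (real_of_int p) \<le> ln B" using p by (simp add: ln_realpow)
    then have "real i \<le> ln B / ln (real_of_int p)" using lp by (simp add: le_divide_eq)
    then have "i \<le> z" unfolding z_def by (simp add: le_nat_floor)
    then show "i \<in> {1..z}" using i by (simp add: prime_power_exps_def)
  qed
  then show "finite (prime_power_exps p B)" by (rule finite_subset) simp
  have "card (prime_power_exps p B) \<le> z" using card_mono[OF _ sub] by simp
  then have "real (card (prime_power_exps p B)) \<le> real z" by simp
  also have "\<dots> \<le> ln B / ln (real_of_int p)" unfolding z_def using q by (simp add: of_nat_nat)
  finally show "real (card (prime_power_exps p B)) * ln (real_of_int p) \<le> ln B"
    using lp by (simp add: le_divide_eq)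
qed

lemma ln_eq_sum_prime_powers:
  fixes m :: int
  assumes m: "m \<noteq> 0" "\<bar>real_of_int m\<bar> \<le> B" and P: "finite P" "\<And>p. p \<in> P \<Longrightarrow> prime p"
    "\<And>p. prime p \<Longrightarrow> p dvd m \<Longrightarrow> p \<in> P"
  shows "ln \<bar>real_of_int m\<bar> = (\<Sum>p\<in>P. \<Sum>i\<in>prime_power_exps p B. ln (real_of_int p) * of_bool (p ^ i dvd m))"
proof -
  have B1: "B \<ge> 1" using m by linarith
  have inner: "(\<Sum>i\<in>prime_power_exps p B. ln (real_of_int p) * of_bool (p ^ i dvd m)) = real (multiplicity p m) * ln (real_of_int p)"
    if p: "p \<in> P" for p
  proof -
    have p1: "p > 1" using P(2)[OF p] by (simp add: prime_gt_1_int)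
    have iff: "p ^ i dvd m \<longleftrightarrow> i \<le> multiplicity p m" for i
      using m p1 by (intro power_dvd_iff_le_multiplicity) auto
    have "{i \<in> prime_power_exps p B. p ^ i dvd m} = {1..multiplicity p m}"
    proof (intro equalityI subsetI)
      fix i assume "i \<in> {1..multiplicity p m}"
      then have i: "1 \<le> i" "p ^ i dvd m" by (auto simp: iff)
      then have "\<bar>p ^ i\<bar> \<le> \<bar>m\<bar>" using m by (intro dvd_imp_le_int)
      then have "p ^ i \<le> \<bar>m\<bar>" using p1 by simp
      then have "real_of_int (p ^ i) \<le> real_of_int \<bar>m\<bar>" by (simp only: of_int_le_iff)
      then have "real_of_int p ^ i \<le> B" using m by simp
      then show "i \<in> {i \<in> prime_power_exps p B. p ^ i dvd m}" using i by (simp add: prime_power_exps_def)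
    qed (auto simp: prime_power_exps_def iff)
    moreover have "(\<Sum>i\<in>prime_power_exps p B. ln (real_of_int p) * of_bool (p ^ i dvd m)) = (\<Sum>i\<in>{i \<in> prime_power_exps p B. p ^ i dvd m}. ln (real_of_int p))"
      by (rule sum.mono_neutral_cong_right) (use prime_power_exps(1)[OF p1 B1] in auto)
    ultimately show ?thesis by simp
  qed
  have sub: "prime_factors m \<subseteq> P" using P(3) by (auto simp: in_prime_factors_iff)
  have "(\<Prod>p\<in>prime_factors m. p ^ multiplicity p m) = \<bar>m\<bar>"
    using prod_prime_factors[OF m(1)] by simp
  then have "real_of_int \<bar>m\<bar> = real_of_int (\<Prod>p\<in>prime_factors m. p ^ multiplicity p m)" by (simp only:)
  then have "\<bar>real_of_int m\<bar> = (\<Prod>p\<in>prime_factors m. real_of_int p ^ multiplicity p m)"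
    by (simp only: of_int_abs of_int_power of_int_prod)
  also have "ln \<dots> = (\<Sum>p\<in>prime_factors m. ln (real_of_int p ^ multiplicity p m))"
    by (rule ln_prod) (auto simp: in_prime_factors_iff)
  also have "\<dots> = (\<Sum>p\<in>prime_factors m. real (multiplicity p m) * ln (real_of_int p))"
    by (intro sum.cong refl ln_realpow)
  also have "\<dots> = (\<Sum>p\<in>P. real (multiplicity p m) * ln (real_of_int p))"
    by (rule sum.mono_neutral_left[OF P(1) sub])
       (use m P(2) in \<open>auto simp: in_prime_factors_iff not_dvd_imp_multiplicity_0\<close>)
  also have "\<dots> = (\<Sum>p\<in>P. \<Sum>i\<in>prime_power_exps p B. ln (real_of_int p) * of_bool (p ^ i dvd m))"
    by (intro sum.cong refl) (simp only: inner)
  finally show ?thesis .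
qed

lemma sum_powers_le:
  fixes x :: real
  assumes x: "0 \<le> x" "x \<le> 1/2" and I: "finite I" "\<And>i. i \<in> I \<Longrightarrow> 1 \<le> i"
  shows "(\<Sum>i\<in>I. x ^ i) \<le> 2 * x"
proof -
  have "(\<Sum>i\<in>{1..M}. x ^ i) \<le> 2 * x" for M
  proof (induction M)
    case (Suc M)
    have "(\<Sum>i\<in>{1..Suc M}. x ^ i) = x * (1 + (\<Sum>i\<in>{1..M}. x ^ i))"
    proof -
      have "(\<Sum>i\<in>{1..Suc M}. x ^ i) = (\<Sum>k<Suc M. x ^ Suc k)" unfolding One_nat_def by (rule sum.atLeast1_atMost_eq)
      also have "\<dots> = x ^ Suc 0 + (\<Sum>k<M. x ^ Suc (Suc k))" by (rule sum.lessThan_Suc_shift)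
      also have "(\<Sum>k<M. x ^ Suc (Suc k)) = x * (\<Sum>k<M. x ^ Suc k)" by (simp add: sum_distrib_left)
      also have "(\<Sum>k<M. x ^ Suc k) = (\<Sum>i\<in>{1..M}. x ^ i)" unfolding One_nat_def by (rule sum.atLeast1_atMost_eq[symmetric])
      finally show ?thesis by (simp add: distrib_left)
    qed
    also have "\<dots> \<le> x * (1 + 2 * x)" using Suc x by (intro mult_left_mono add_mono) auto
    also have "\<dots> \<le> x * 2" using x by (intro mult_left_mono) auto
    finally show ?case by simp
  qed (use x in simp)
  moreover obtain M where "I \<subseteq> {1..M}"
    using I by (metis atLeastAtMost_iff finite_nat_set_iff_bounded_le subsetI)
  then have "(\<Sum>i\<in>I. x ^ i) \<le> (\<Sum>i\<in>{1..M}. x ^ i)" using x by (intro sum_mono2) auto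
  ultimately show ?thesis using order_trans by blast
qed

lemma poly_int_bound:
  fixes H :: "int poly"
  obtains C where "C \<ge> 0" "\<And>j N. j \<in> {1..int N} \<Longrightarrow> \<bar>real_of_int (poly H j)\<bar> \<le> C * real N ^ degree H"
proof -
  define C where "C = (\<Sum>i\<le>degree H. \<bar>real_of_int (coeff H i)\<bar>)"
  have "\<bar>real_of_int (poly H j)\<bar> \<le> C * real N ^ degree H" if j: "j \<in> {1..int N}" for j N
  proof -
    have "\<bar>real_of_int (poly H j)\<bar> = \<bar>\<Sum>i\<le>degree H. real_of_int (coeff H i) * real_of_int j ^ i\<bar>"
      by (simp add: poly_altdef)
    also have "\<dots> \<le> (\<Sum>i\<le>degree H. \<bar>real_of_int (coeff H i) * real_of_int j ^ i\<bar>)" by (rule sum_abs)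
    also have "\<dots> \<le> (\<Sum>i\<le>degree H. \<bar>real_of_int (coeff H i)\<bar> * real N ^ degree H)"
    proof (rule sum_mono)
      fix i assume i: "i \<in> {..degree H}"
      have jN: "1 \<le> real_of_int j" "real_of_int j \<le> real N" using j by auto
      have "real_of_int j ^ i \<le> real_of_int j ^ degree H" using i jN by (intro power_increasing) auto
      also have "\<dots> \<le> real N ^ degree H" using jN by (intro power_mono) auto
      finally show "\<bar>real_of_int (coeff H i) * real_of_int j ^ i\<bar> \<le> \<bar>real_of_int (coeff H i)\<bar> * real N ^ degree H"
        using jN by (simp add: abs_mult mult_left_mono)
    qed
    finally show ?thesis by (simp add: C_def sum_distrib_right)
  qed
  moreover have "C \<ge> 0" by (simp add: C_def sum_nonneg)
  ultimately show thesis using that by blast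
qed

lemma card_small_values_le:
  fixes H :: "int poly"
  assumes d: "degree H \<ge> 1"
  shows "real (card {j \<in> {1..int N}. (real_of_int (poly H j))\<^sup>2 \<le> real N}) \<le> real (degree H) * (2 * sqrt (real N) + 1)"
proof -
  let ?T = "{j \<in> {1..int N}. (real_of_int (poly H j))\<^sup>2 \<le> real N}"
  define z where "z = \<lfloor>sqrt (real N)\<rfloor>"
  have z0: "z \<ge> 0" by (simp add: z_def)
  have nz: "H - [:m:] \<noteq> 0" for m using d by (metis degree_pCons_0 eq_iff_diff_eq_0 not_one_le_zero)
  have fin: "finite {j. poly H j = m}" and le: "card {j. poly H j = m} \<le> degree H" for m
  proof -
    have e: "{j. poly H j = m} = {j. poly (H - [:m:]) j = 0}" by auto
    show "finite {j. poly H j = m}" unfolding e by (rule poly_roots_finite[OF nz])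
    have "card {j. poly (H - [:m:]) j = 0} \<le> degree (H - [:m:])" by (rule card_poly_roots_bound[OF nz])
    also have "\<dots> \<le> degree H" by (rule degree_diff_le) auto
    finally show "card {j. poly H j = m} \<le> degree H" unfolding e .
  qed
  have "?T \<subseteq> (\<Union>m\<in>{-z..z}. {j. poly H j = m})"
  proof
    fix j assume "j \<in> ?T"
    then have "\<bar>real_of_int (poly H j)\<bar> \<le> sqrt (real N)" using real_le_rsqrt[of "\<bar>real_of_int (poly H j)\<bar>"] by simp
    then have "\<bar>poly H j\<bar> \<le> z" unfolding z_def by (simp add: le_floor_iff)
    then show "j \<in> (\<Union>m\<in>{-z..z}. {j. poly H j = m})" by (auto simp: abs_le_iff)
  qed
  then have "card ?T \<le> card (\<Union>m\<in>{-z..z}. {j. poly H j = m})"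
    by (rule card_mono[rotated]) (use fin in auto)
  also have "\<dots> \<le> (\<Sum>m\<in>{-z..z}. card {j. poly H j = m})" by (rule card_UN_le) simp
  also have "\<dots> \<le> (\<Sum>m\<in>{-z..z}. degree H)" by (intro sum_mono le)
  finally have "card ?T \<le> degree H * nat (2 * z + 1)"
    by (simp add: algebra_simps)
  then have "real (card ?T) \<le> real (degree H * nat (2 * z + 1))"
    by (simp only: of_nat_le_iff)
  also have "\<dots> = real (degree H) * (2 * real_of_int z + 1)" using z0 by simp
  also have "\<dots> \<le> real (degree H) * (2 * sqrt (real N) + 1)"
    unfolding z_def by (intro mult_left_mono add_mono) auto
  finally show ?thesis .
qed

text \<open>At least half of the values \<open>H j\<close> with \<open>1 \<le> j \<le> N\<close> exceed \<open>sqrt N\<close> in size, so the logarithms of these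
values add up to at least \<open>N / 4 * ln N\<close>.  On the other hand the power of a single prime \<open>p\<close> in their
product contributes at most \<open>2 * d * N * ln p / p + d * ln Y\<close>, where \<open>d\<close> is the degree
and \<open>Y = N ^ (d + 1)\<close> bounds the values.  By Mertens' bound, \<open>s\<close> primes therefore contribute at most about
\<open>8 * d * N * ln s + s * d * (d + 1) * ln N\<close>.  With fewer than \<open>N powr (1 / (65 * d))\<close> primes this is
too small, because \<open>8/65 < 1/4\<close>.  The constant coefficient 1 ensures that \<open>H\<close> does not vanish
identically modulo any prime.\<close>

lemma many_primes_dividing_values:
  fixes H :: "int poly"
  assumes d: "degree H \<ge> 1" and c: "coeff H 0 = 1"
    and sep: "\<And>p x. prime p \<Longrightarrow> p dvd poly H x \<Longrightarrow> \<not> p dvd poly (pderiv H) x"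
  shows "\<forall>\<^sub>F N in sequentially. real N powr (1 / (65 * real (degree H)))
     \<le> real (card {p. prime p \<and> p \<le> int N ^ (degree H + 1) \<and> (\<exists>j. p dvd poly H j)})"
proof -
  define d where "d = degree H"
  have d1: "d \<ge> 1" using assms(1) by (simp add: d_def)
  obtain C where C: "C \<ge> 0" "\<And>j N. j \<in> {1..int N} \<Longrightarrow> \<bar>real_of_int (poly H j)\<bar> \<le> C * real N ^ degree H"
    by (rule poly_int_bound[of H]) blast
  have "filterlim (\<lambda>N. real N) at_top sequentially" by real_asymp
  then have ev1: "\<forall>\<^sub>F N in sequentially. max C 3 \<le> real N" by (simp only: filterlim_at_top)
  have "filterlim (\<lambda>N. sqrt (real N) / 50) at_top sequentially" by real_asymp
  then have ev2: "\<forall>\<^sub>F N in sequentially. real d * (real d + 1) \<le> sqrt (real N) / 50" by (simp only: filterlim_at_top)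
  have "filterlim (\<lambda>N. ln (real N) / 10) at_top sequentially" by real_asymp
  then have ev3: "\<forall>\<^sub>F N in sequentially. 4 * real d + 1 \<le> ln (real N) / 10" by (simp only: filterlim_at_top)
  show ?thesis using ev1 ev2 ev3
  proof eventually_elim
    fix N assume N1: "max C 3 \<le> real N" and N2: "real d * (real d + 1) \<le> sqrt (real N) / 50"
      and N3: "4 * real d + 1 \<le> ln (real N) / 10"
    define P where "P = {p. prime p \<and> p \<le> int N ^ (degree H + 1) \<and> (\<exists>j. p dvd poly H j)}"
    define Y where "Y = real N ^ (d + 1)"
    have N0: "real N \<ge> 3" using N1 by simp
    have X1: "Y \<ge> 1" unfolding Y_def using N0 by (intro one_le_power) auto
    have HX: "\<bar>real_of_int (poly H j)\<bar> \<le> Y" if "j \<in> {1..int N}" for j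
    proof -
      have "\<bar>real_of_int (poly H j)\<bar> \<le> C * real N ^ d" using C(2)[OF that] by (simp add: d_def)
      also have "\<dots> \<le> real N * real N ^ d" using N1 by (intro mult_right_mono) auto
      finally show ?thesis by (simp add: Y_def)
    qed
    have finP: "finite P" unfolding P_def
      by (rule finite_subset[of _ "{0..int N ^ (degree H + 1)}"]) (auto simp: prime_ge_0_int)
    have prP: "prime p" if "p \<in> P" for p using that by (simp add: P_def)
    have P1: "p > 1" if "p \<in> P" for p using prP[OF that] by (simp add: prime_gt_1_int)
    define J where "J = {j \<in> {1..int N}. \<not> (real_of_int (poly H j))\<^sup>2 \<le> real N}"
    have finJ: "finite J" unfolding J_def by (rule finite_subset[OF Collect_restrict]) simp
    have cJ: "real (card J) \<ge> real N / 2"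
    proof -
      have "J = {1..int N} - {j \<in> {1..int N}. (real_of_int (poly H j))\<^sup>2 \<le> real N}" by (auto simp: J_def)
      then have "card J = N - card {j \<in> {1..int N}. (real_of_int (poly H j))\<^sup>2 \<le> real N}"
        by (simp only:) (subst card_Diff_subset[OF finite_subset[OF Collect_restrict] Collect_restrict], simp_all)
      moreover have "real (card {j \<in> {1..int N}. (real_of_int (poly H j))\<^sup>2 \<le> real N}) \<le> real d * (2 * sqrt (real N) + 1)"
        unfolding d_def by (rule card_small_values_le[OF assms(1)])
      moreover have "real d * (2 * sqrt (real N) + 1) \<le> real N / 2"
      proof -
        have s1: "sqrt (real N) \<ge> 1" using N0 by simp
        have "real d * 1 \<le> real d * (real d + 1)" by (intro mult_left_mono) auto
        then have "real d \<le> sqrt (real N) / 50" using N2 by linarith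
        then have "real d * (2 * sqrt (real N) + 1) \<le> sqrt (real N) / 50 * (3 * sqrt (real N))"
          using s1 by (intro mult_mono) auto
        also have "\<dots> \<le> real N / 2" by simp
        finally show ?thesis .
      qed
      ultimately show ?thesis by linarith
    qed
    have lowJ: "ln (real N) / 2 \<le> ln \<bar>real_of_int (poly H j)\<bar>" if j: "j \<in> J" for j
    proof -
      have "real N < (real_of_int (poly H j))\<^sup>2" using j by (simp add: J_def)
      then have "ln (real N) \<le> ln (\<bar>real_of_int (poly H j)\<bar>\<^sup>2)" using N0 by (intro ln_mono) auto
      also have "\<dots> = 2 * ln \<bar>real_of_int (poly H j)\<bar>"
      proof -
        have "poly H j \<noteq> 0" using \<open>real N < _\<close> N0 by auto
        then show ?thesis by (subst ln_realpow) auto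
      qed
      finally show ?thesis by simp
    qed
    have "real N / 2 * (ln (real N) / 2) \<le> real (card J) * (ln (real N) / 2)"
      using cJ N0 by (intro mult_right_mono) auto
    also have "\<dots> = (\<Sum>j\<in>J. ln (real N) / 2)" by simp
    also have "\<dots> \<le> (\<Sum>j\<in>J. ln \<bar>real_of_int (poly H j)\<bar>)" by (intro sum_mono lowJ)
    also have "\<dots> = (\<Sum>j\<in>J. \<Sum>p\<in>P. \<Sum>i\<in>prime_power_exps p Y. ln (real_of_int p) * of_bool (p ^ i dvd poly H j))"
    proof (rule sum.cong[OF refl])
      fix j assume j: "j \<in> J"
      then have jN: "j \<in> {1..int N}" and nz: "poly H j \<noteq> 0" by (auto simp: J_def)
      show "ln \<bar>real_of_int (poly H j)\<bar> = (\<Sum>p\<in>P. \<Sum>i\<in>prime_power_exps p Y. ln (real_of_int p) * of_bool (p ^ i dvd poly H j))"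
      proof (rule ln_eq_sum_prime_powers[OF nz HX[OF jN] finP prP])
        fix p assume p: "prime p" "p dvd poly H j"
        then have "\<bar>p\<bar> \<le> \<bar>poly H j\<bar>" using nz by (intro dvd_imp_le_int)
        then have "real_of_int p \<le> Y" using HX[OF jN] by linarith
        also have "Y = real_of_int (int N ^ (degree H + 1))" by (simp add: Y_def d_def)
        finally have "p \<le> int N ^ (degree H + 1)" by (simp only: of_int_le_iff)
        then show "p \<in> P" using p by (auto simp: P_def)
      qed
    qed
    also have "\<dots> = (\<Sum>p\<in>P. \<Sum>i\<in>prime_power_exps p Y. \<Sum>j\<in>J. ln (real_of_int p) * of_bool (p ^ i dvd poly H j))"
      by (subst sum.swap) (intro sum.cong refl sum.swap)
    also have "\<dots> \<le> (\<Sum>p\<in>P. 2 * real d * real N * (ln (real_of_int p) / real_of_int p) + real d * ln Y)"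
    proof (rule sum_mono)
      fix p assume p: "p \<in> P"
      let ?E = "prime_power_exps p Y"
      have lp: "ln (real_of_int p) > 0" using P1[OF p] by simp
      have E: "finite ?E" "real (card ?E) * ln (real_of_int p) \<le> ln Y"
        using prime_power_exps[OF P1[OF p] X1] by auto
      have "(\<Sum>i\<in>?E. \<Sum>j\<in>J. ln (real_of_int p) * of_bool (p ^ i dvd poly H j))
          \<le> (\<Sum>i\<in>?E. ln (real_of_int p) * (real d * (real N / real_of_int (p ^ i) + 1)))"
      proof (rule sum_mono)
        fix i assume i: "i \<in> ?E"
        have cp: "\<not> p dvd coeff H 0" using c P1[OF p] by simp
        have "(\<Sum>j\<in>J. ln (real_of_int p) * of_bool (p ^ i dvd poly H j)) = ln (real_of_int p) * real (card {j \<in> J. p ^ i dvd poly H j})"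
          using finJ by (simp add: sum_distrib_left[symmetric] Int_def)
        also have "card {j \<in> J. p ^ i dvd poly H j} \<le> card {j \<in> {1..int N}. p ^ i dvd poly H j}"
          by (rule card_mono[OF finite_subset[OF Collect_restrict]]) (auto simp: J_def)
        also have "real (card {j \<in> {1..int N}. p ^ i dvd poly H j}) \<le> real d * (real N / real_of_int (p ^ i) + 1)"
          unfolding d_def
          by (rule card_prime_power_dvd_values_le[OF prP[OF p] _ cp]) (use i sep prP[OF p] in \<open>auto simp: prime_power_exps_def\<close>)
        finally show "(\<Sum>j\<in>J. ln (real_of_int p) * of_bool (p ^ i dvd poly H j)) \<le> ln (real_of_int p) * (real d * (real N / real_of_int (p ^ i) + 1))"
          using lp by simp
      qed
      also have "\<dots> = real d * real N * ln (real_of_int p) * (\<Sum>i\<in>?E. (1 / real_of_int p) ^ i) + real d * (real (card ?E) * ln (real_of_int p))"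
        by (simp add: sum_distrib_left sum.distrib algebra_simps power_divide)
      also have "\<dots> \<le> real d * real N * ln (real_of_int p) * (2 * (1 / real_of_int p)) + real d * ln Y"
        using lp E P1[OF p]
        by (intro add_mono mult_left_mono sum_powers_le) (auto simp: prime_power_exps_def)
      finally show "(\<Sum>i\<in>?E. \<Sum>j\<in>J. ln (real_of_int p) * of_bool (p ^ i dvd poly H j)) \<le> 2 * real d * real N * (ln (real_of_int p) / real_of_int p) + real d * ln Y"
        by (simp add: mult_ac)
    qed
    also have "\<dots> = 2 * real d * real N * (\<Sum>p\<in>P. ln (real_of_int p) / real_of_int p) + real (card P) * (real d * ln Y)"
      by (simp add: sum.distrib sum_distrib_left)
    also have "\<dots> \<le> 2 * real d * real N * (4 * ln (real (card P)) + 2) + real (card P) * (real d * ln Y)"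
      by (intro add_mono mult_left_mono sum_ln_prime_div_card_le finP prP) auto
    also have "ln Y = (real d + 1) * ln (real N)" unfolding Y_def by (subst ln_realpow) simp
    finally have main: "real N / 2 * (ln (real N) / 2) \<le> 2 * real d * real N * (4 * ln (real (card P)) + 2) + real (card P) * (real d * ((real d + 1) * ln (real N)))" .
    define L where "L = ln (real N)"
    have L: "L \<ge> 40 * real d + 10" using N3 by (simp add: L_def)
    have "real N powr (1 / (65 * real d)) \<le> real (card P)"
    proof (rule ccontr)
      assume neg: "\<not> real N powr (1 / (65 * real d)) \<le> real (card P)"
      have l: "ln (real (card P)) \<le> L / (65 * real d)"
      proof (cases "card P = 0")
        case True then show ?thesis using L d1 by simp
      next
        case False
        then have "ln (real (card P)) \<le> ln (real N powr (1 / (65 * real d)))" using neg N0 by (subst ln_le_cancel_iff) auto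
        then show ?thesis using N0 by (simp add: ln_powr L_def)
      qed
      have "real N powr (1 / (65 * real d)) \<le> real N powr (1/2)"
        using N0 d1 by (intro powr_mono) (auto simp: field_simps)
      then have s: "real (card P) \<le> sqrt (real N)" using neg N0 by (simp add: powr_half_sqrt)
      have "real (card P) * (real d * ((real d + 1) * L)) = real (card P) * (real d * (real d + 1)) * L" by simp
      also have "\<dots> \<le> sqrt (real N) * (sqrt (real N) / 50) * L"
        using s N2 L by (intro mult_right_mono mult_mono) auto
      also have "\<dots> = real N * (L / 50)" by simp
      finally have b: "real (card P) * (real d * ((real d + 1) * L)) \<le> real N * (L / 50)" .
      have "2 * real d * real N * (4 * ln (real (card P)) + 2) \<le> 2 * real d * real N * (4 * (L / (65 * real d)) + 2)"
        using l by (intro mult_left_mono add_mono) auto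
      also have "\<dots> = real N * (8 / 65 * L + 4 * real d)" using d1 by (simp add: field_simps)
      finally have calculation: "2 * real d * real N * (4 * ln (real (card P)) + 2) \<le> real N * (8 / 65 * L + 4 * real d)" .
      have "real N * (L / 4) \<le> real N * (8 / 65 * L + 4 * real d) + real N * (L / 50)"
      proof -
        have "real N / 2 * (L / 2) = real N * (L / 4)" by simp
        then show ?thesis using main b calculation unfolding L_def[symmetric] by linarith
      qed
      then have "real N * (L / 4) \<le> real N * (8 / 65 * L + 4 * real d + L / 50)" by (simp only: distrib_left)
      then have "L / 4 \<le> 8 / 65 * L + 4 * real d + L / 50" using N0 by simp
      then show False using L by simp
    qed
    then show "real N powr (1 / (65 * real (degree H))) \<le> real (card {p. prime p \<and> p \<le> int N ^ (degree H + 1) \<and> (\<exists>j. p dvd poly H j)})"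
      unfolding P_def d_def .
  qed
qed

text \<open>Let \<open>e\<close> be the product of the primes to be avoided and \<open>b = h n0\<close> a nonzero value.  The polynomial
\<open>h (n0 + b * e * x) / b\<close> has integer coefficients and is congruent to 1 modulo \<open>e\<close>, so no prime to be
avoided divides any of its values, while every prime that does divide one also divides a value of \<open>h\<close>.\<close>

lemma many_primes_outside_finite_set:
  fixes h :: "int poly" and E :: "int set"
  assumes d: "degree h \<ge> 1" and E: "finite E"
    and sep: "\<And>p x. prime p \<Longrightarrow> p \<notin> E \<Longrightarrow> p dvd poly h x \<Longrightarrow> \<not> p dvd poly (pderiv h) x"
  shows "\<forall>\<^sub>F N in sequentially. real N powr (1 / (65 * real (degree h)))
     \<le> real (card {p. prime p \<and> p \<le> int N ^ (degree h + 1) \<and> p \<notin> E \<and> (\<exists>j. p dvd poly h j)})"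
proof -
  have "finite {x. poly h x = 0}" using d by (intro poly_roots_finite) auto
  then obtain n0 where n0: "poly h n0 \<noteq> 0"
    using infinite_UNIV_int by (metis (mono_tags, lifting) UNIV_eq_I mem_Collect_eq)
  define b where "b = poly h n0"
  define e where "e = \<Prod>{p \<in> E. prime p}"
  have e0: "e \<noteq> 0" unfolding e_def using E by auto
  have pe: "p dvd e \<longleftrightarrow> p \<in> E" if prp: "prime p" for p
  proof
    assume "p \<in> E"
    then show "p dvd e" unfolding e_def using prp E dvd_prodI[of "{p \<in> E. prime p}" p "\<lambda>x. x"] by auto
  next
    assume "p dvd e"
    then obtain q where q: "q \<in> {p \<in> E. prime p}" "p dvd q"
      unfolding e_def using prp E prime_dvd_prod_iff[of "{p \<in> E. prime p}" p "\<lambda>x. x"] by auto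
    then have "p = q" using prp by (intro primes_dvd_imp_eq) auto
    then show "p \<in> E" using q by simp
  qed
  obtain a g where g: "pcompose h [:n0, 1:] = pCons a g" by (metis pCons_cases)
  have ab: "a = b" using arg_cong[OF g, of "\<lambda>q. poly q 0"] by (simp add: poly_pcompose b_def)
  define H where "H = pCons 1 (smult e (pcompose g [:0, b * e:]))"
  have hH: "b * poly H x = poly h (n0 + b * e * x)" for x
  proof -
    have "poly h (n0 + b * e * x) = poly (pcompose h [:n0, 1:]) (b * e * x)" by (simp add: poly_pcompose)
    also have "\<dots> = b + (b * e * x) * poly g (b * e * x)" unfolding g ab by simp
    also have "\<dots> = b * poly H x" by (simp add: H_def poly_pcompose algebra_simps)
    finally show ?thesis by simp
  qed
  have be: "b * e \<noteq> 0" using n0 e0 by (simp add: b_def)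
  have poly_eq: "smult b H = pcompose h [:n0, b * e:]"
    by (rule poly_eq_poly_eq_iff[THEN iffD1], rule ext) (simp add: hH poly_pcompose mult.commute)
  have dH: "degree H = degree h"
  proof -
    have "degree H = degree (smult b H)" using n0 by (simp add: b_def)
    then show ?thesis unfolding poly_eq using be by (simp add: degree_pcompose)
  qed
  have H0: "coeff H 0 = 1" by (simp add: H_def)
  have der: "poly (pderiv H) x = e * poly (pderiv h) (n0 + b * e * x)" for x
  proof -
    have "b * poly (pderiv H) x = poly (pderiv (smult b H)) x" by (simp add: pderiv_smult)
    also have "\<dots> = poly (pderiv h) (n0 + b * e * x) * (b * e)"
      unfolding poly_eq by (simp add: pderiv_pcompose poly_pcompose pderiv_pCons mult.commute)
    finally show ?thesis using n0 by (simp add: b_def)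
  qed
  have outside: "p \<notin> E" if p: "prime p" "p dvd poly H x" for p x
  proof
    assume "p \<in> E"
    then have "p dvd e" using pe p by simp
    moreover have "poly H x = 1 + e * (x * poly g (b * e * x))"
      by (simp add: H_def poly_pcompose algebra_simps)
    ultimately have "p dvd 1" using p(2) by (metis dvd_add_left_iff dvd_mult2)
    then show False using p(1) by (metis not_prime_unit)
  qed
  have "\<forall>\<^sub>F N in sequentially. real N powr (1 / (65 * real (degree H)))
     \<le> real (card {p. prime p \<and> p \<le> int N ^ (degree H + 1) \<and> (\<exists>j. p dvd poly H j)})"
  proof (rule many_primes_dividing_values[OF _ H0])
    show "degree H \<ge> 1" using d dH by simp
    fix p x assume p: "prime p" "p dvd poly H x"
    have "p dvd b * poly H x" using p by simp
    then have "p dvd poly h (n0 + b * e * x)" by (simp only: hH)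
    then have "\<not> p dvd poly (pderiv h) (n0 + b * e * x)" using sep p outside[OF p] by blast
    moreover have "\<not> p dvd e" using pe p outside[OF p] by simp
    ultimately show "\<not> p dvd poly (pderiv H) x" using p(1) by (simp add: der prime_dvd_mult_iff)
  qed
  then show ?thesis
  proof eventually_elim
    case (elim N)
    have "{p. prime p \<and> p \<le> int N ^ (degree H + 1) \<and> (\<exists>j. p dvd poly H j)}
       \<subseteq> {p. prime p \<and> p \<le> int N ^ (degree h + 1) \<and> p \<notin> E \<and> (\<exists>j. p dvd poly h j)}"
    proof
      fix p assume "p \<in> {p. prime p \<and> p \<le> int N ^ (degree H + 1) \<and> (\<exists>j. p dvd poly H j)}"
      then obtain j where p: "prime p" "p \<le> int N ^ (degree H + 1)" "p dvd poly H j" by blast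
      have "p dvd b * poly H j" using p by simp
      then have "p dvd poly h (n0 + b * e * j)" by (simp only: hH)
      then show "p \<in> {p. prime p \<and> p \<le> int N ^ (degree h + 1) \<and> p \<notin> E \<and> (\<exists>j. p dvd poly h j)}"
        using p outside[OF p(1,3)] dH by auto
    qed
    moreover have "finite {p. prime p \<and> p \<le> int N ^ (degree h + 1) \<and> p \<notin> E \<and> (\<exists>j. p dvd poly h j)}"
      by (rule finite_subset[of _ "{0..int N ^ (degree h + 1)}"]) (auto simp: prime_ge_0_int)
    ultimately have "card {p. prime p \<and> p \<le> int N ^ (degree H + 1) \<and> (\<exists>j. p dvd poly H j)}
       \<le> card {p. prime p \<and> p \<le> int N ^ (degree h + 1) \<and> p \<notin> E \<and> (\<exists>j. p dvd poly h j)}"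
      by (rule card_mono[rotated])
    then show ?case using elim unfolding dH by linarith
  qed
qed

section \<open>Algebraic elements and primitive elements over the rationals\<close>

definition qeval :: "rat poly \<Rightarrow> 'a::field_char_0 \<Rightarrow> 'a" where
  "qeval P x = poly (map_poly of_rat P) x"

lemma qeval_0 [simp]: "qeval 0 x = 0"
  by (simp add: qeval_def)

lemma qeval_pCons [simp]: "qeval (pCons c P) x = of_rat c + x * qeval P x"
  by (simp add: qeval_def map_poly_pCons)

lemma qeval_1 [simp]: "qeval 1 x = 1"
  by (simp add: one_pCons)

lemma qeval_add [simp]: "qeval (P + R) x = qeval P x + qeval R x"
proof -
  have "map_poly of_rat (P + R) = map_poly (of_rat :: rat \<Rightarrow> 'a) P + map_poly of_rat R"
    by (rule poly_eqI) (simp add: coeff_map_poly of_rat_add)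
  then show ?thesis by (simp add: qeval_def)
qed

lemma qeval_smult [simp]: "qeval (smult c P) x = of_rat c * qeval P x"
  by (induction P) (simp_all add: of_rat_mult algebra_simps)

lemma qeval_uminus [simp]: "qeval (- P) x = - qeval P x"
  by (induction P) (simp_all add: of_rat_minus algebra_simps)

lemma qeval_diff [simp]: "qeval (P - R) x = qeval P x - qeval R x"
  using qeval_add[of P "- R" x] by simp

lemma qeval_mult [simp]: "qeval (P * R) x = qeval P x * qeval R x"
  by (induction P) (simp_all add: mult_pCons_left algebra_simps)

lemma qeval_sum: "qeval (\<Sum>i\<in>I. P i) x = (\<Sum>i\<in>I. qeval (P i) x)"
  by (induction I rule: infinite_finite_induct) simp_all

lemma qeval_monom [simp]: "qeval (monom c n) x = of_rat c * x ^ n"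
  by (simp add: qeval_def map_poly_monom poly_monom)

lemma qeval_pcompose [simp]: "qeval (pcompose P R) x = qeval P (qeval R x)"
  by (induction P) (simp_all add: pcompose_pCons algebra_simps)

lemma to_ac_of_rat [simp]: "to_ac (of_rat q) = of_rat q"
  by (cases q) (simp add: of_rat_rat)

lemma to_ac_qeval [simp]: "to_ac (qeval P x) = qeval P (to_ac x)"
  by (induction P) simp_all

definition algebraic_over_rat :: "'a::field_char_0 \<Rightarrow> bool" where
  "algebraic_over_rat x \<longleftrightarrow> (\<exists>P. P \<noteq> 0 \<and> qeval P x = 0)"

lemma algebraic_over_rat_to_ac [simp]: "algebraic_over_rat (to_ac x) \<longleftrightarrow> algebraic_over_rat x"
proof -
  have "qeval P (to_ac x) = 0 \<longleftrightarrow> qeval P x = 0" for P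
    by (metis to_ac_eq_0_iff to_ac_qeval)
  then show ?thesis by (simp add: algebraic_over_rat_def)
qed

definition minimal_rat_poly :: "'a::field_char_0 \<Rightarrow> rat poly \<Rightarrow> bool" where
  "minimal_rat_poly x m \<longleftrightarrow> m \<noteq> 0 \<and> qeval m x = 0 \<and> (\<forall>P. P \<noteq> 0 \<longrightarrow> qeval P x = 0 \<longrightarrow> degree m \<le> degree P)"

lemma ex_minimal_rat_poly:
  assumes "algebraic_over_rat x"
  obtains m where "minimal_rat_poly x m"
proof -
  obtain P where "P \<noteq> 0 \<and> qeval P x = 0" using assms by (auto simp: algebraic_over_rat_def)
  then obtain m where "m \<noteq> 0 \<and> qeval m x = 0 \<and> (\<forall>P. P \<noteq> 0 \<and> qeval P x = 0 \<longrightarrow> degree m \<le> degree P)"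
    using ex_has_least_nat[of "\<lambda>P. P \<noteq> 0 \<and> qeval P x = 0" P degree] by blast
  then show thesis using that unfolding minimal_rat_poly_def by blast
qed

lemma minimal_rat_poly_dvd:
  assumes m: "minimal_rat_poly x m" and P: "qeval P x = 0"
  shows "m dvd P"
proof (rule ccontr)
  assume "\<not> m dvd P"
  then have nz: "P mod m \<noteq> 0" by (simp add: mod_eq_0_iff_dvd)
  have "qeval (P mod m) x = qeval (P - (P div m) * m) x" by (simp add: minus_div_mult_eq_mod)
  also have "\<dots> = 0" using m P by (simp add: minimal_rat_poly_def)
  finally have "degree m \<le> degree (P mod m)" using m nz by (auto simp: minimal_rat_poly_def)
  moreover have "degree (P mod m) < degree m"
    using nz m degree_mod_less[of m P] by (auto simp: minimal_rat_poly_def)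
  ultimately show False by simp
qed

lemma degree_minimal_rat_poly:
  assumes "minimal_rat_poly x m"
  shows "degree m \<ge> 1"
proof (rule ccontr)
  assume "\<not> degree m \<ge> 1"
  then have "degree m = 0" by simp
  then obtain c where "m = [:c:]" by (rule degree_eq_zeroE)
  then show False using assms by (auto simp: minimal_rat_poly_def)
qed

lemma minimal_rat_poly_simple_root:
  assumes m: "minimal_rat_poly x m"
  shows "qeval (pderiv m) x \<noteq> 0"
proof
  assume "qeval (pderiv m) x = 0"
  moreover have "pderiv m \<noteq> 0" using degree_minimal_rat_poly[OF m] by (simp add: pderiv_eq_0_iff)
  ultimately have "degree m \<le> degree (pderiv m)" using m by (auto simp: minimal_rat_poly_def)
  then show False using degree_minimal_rat_poly[OF m] by (simp add: degree_pderiv)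
qed

lemma minimal_rat_poly_bezout:
  assumes m: "minimal_rat_poly x m" and P: "qeval P x \<noteq> 0"
  obtains A B where "A * P + B * m = 1"
proof -
  define g where "g = gcd P m"
  obtain q where q: "m = g * q" unfolding g_def by (metis gcd_dvd2 dvdE)
  obtain t where t: "P = g * t" unfolding g_def by (metis gcd_dvd1 dvdE)
  have "qeval g x \<noteq> 0" using P by (auto simp: t)
  then have "qeval q x = 0" using m by (simp add: q minimal_rat_poly_def)
  moreover have nz: "q \<noteq> 0" "g \<noteq> 0" using m by (auto simp: q minimal_rat_poly_def)
  ultimately have "degree m \<le> degree q" using m by (auto simp: minimal_rat_poly_def)
  then have "degree g = 0" using nz by (simp add: q degree_mult_eq)
  then have "is_unit g" using nz by (simp add: is_unit_iff_degree)
  then have "gcd P m = 1" unfolding g_def by (simp add: is_unit_gcd_iff)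
  then have "fst (bezout_coefficients P m) * P + snd (bezout_coefficients P m) * m = 1"
    using bezout_coefficients_fst_snd[of P m] by simp
  then show thesis using that by blast
qed

definition rat_adjoin :: "'a::field_char_0 \<Rightarrow> 'a set" where
  "rat_adjoin x = range (\<lambda>P. qeval P x)"

lemma rat_adjoinI: "qeval P x \<in> rat_adjoin x"
  by (simp add: rat_adjoin_def)

lemma rat_adjoin_of_rat [simp]: "of_rat c \<in> rat_adjoin x"
  using rat_adjoinI[of "[:c:]" x] by simp

lemma rat_adjoin_0 [simp]: "0 \<in> rat_adjoin x" and rat_adjoin_1 [simp]: "1 \<in> rat_adjoin x"
  using rat_adjoin_of_rat[of 0 x] rat_adjoin_of_rat[of 1 x] by simp_all

lemma rat_adjoin_self [simp]: "x \<in> rat_adjoin x"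
  using rat_adjoinI[of "[:0, 1:]" x] by simp

lemma rat_adjoin_add: "a \<in> rat_adjoin x \<Longrightarrow> b \<in> rat_adjoin x \<Longrightarrow> a + b \<in> rat_adjoin x"
  by (auto simp: rat_adjoin_def qeval_add[symmetric] simp del: qeval_add)

lemma rat_adjoin_diff: "a \<in> rat_adjoin x \<Longrightarrow> b \<in> rat_adjoin x \<Longrightarrow> a - b \<in> rat_adjoin x"
  by (auto simp: rat_adjoin_def qeval_diff[symmetric] simp del: qeval_diff)

lemma rat_adjoin_mult: "a \<in> rat_adjoin x \<Longrightarrow> b \<in> rat_adjoin x \<Longrightarrow> a * b \<in> rat_adjoin x"
  by (auto simp: rat_adjoin_def qeval_mult[symmetric] simp del: qeval_mult)

lemma rat_adjoin_inverse:
  assumes "algebraic_over_rat x" "a \<in> rat_adjoin x"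
  shows "inverse a \<in> rat_adjoin x"
proof (cases "a = 0")
  case False
  obtain m where m: "minimal_rat_poly x m" using ex_minimal_rat_poly[OF assms(1)] .
  obtain P where P: "a = qeval P x" using assms(2) by (auto simp: rat_adjoin_def)
  obtain A B where "A * P + B * m = 1" using minimal_rat_poly_bezout[OF m] False P by blast
  then have "qeval (A * P + B * m) x = 1" by simp
  then have "qeval A x * a = 1" using m by (simp add: P minimal_rat_poly_def)
  then have "inverse a = qeval A x" using False by (simp add: field_simps)
  then show ?thesis by (simp add: rat_adjoinI)
qed simp

lemma rat_adjoin_trans:
  assumes "y \<in> rat_adjoin x" "z \<in> rat_adjoin y"
  shows "z \<in> rat_adjoin x"
proof -
  obtain P R where "y = qeval P x" "z = qeval R y" using assms by (auto simp: rat_adjoin_def)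
  then have "z = qeval (pcompose R P) x" by simp
  then show ?thesis by (simp only: rat_adjoinI)
qed

lemma rat_span_subset_rat_adjoin:
  assumes "S \<subseteq> rat_adjoin x"
  shows "rat_vs.span S \<subseteq> rat_adjoin x"
proof (rule rat_vs.span_minimal[OF assms])
  show "rat_vs.subspace (rat_adjoin x)"
    by (auto simp: rat_vs.subspace_def rat_adjoin_add rat_adjoin_mult)
qed

text \<open>The powers of \<open>x\<close> times a nonzero element of \<open>S\<close> stay in the span of the finite set \<open>S\<close>, so they satisfy
a linear relation.\<close>

lemma algebraic_over_rat_of_stable_span:
  fixes x :: "'a::field_char_0"
  assumes fin: "finite S" and stable: "\<And>s. s \<in> S \<Longrightarrow> x * s \<in> rat_vs.span S" and s0: "s0 \<in> S" "s0 \<noteq> 0"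
  shows "algebraic_over_rat x"
proof -
  have step: "x * v \<in> rat_vs.span S" if "v \<in> rat_vs.span S" for v
    using that
  proof (induction rule: rat_vs.span_induct_alt)
    case base then show ?case by (simp add: rat_vs.span_zero)
  next
    case (step c s y)
    have "x * (of_rat c * s + y) = of_rat c * (x * s) + x * y" by (simp add: algebra_simps)
    then show ?case using step stable by (simp add: rat_vs.span_add rat_vs.span_scale)
  qed
  have pow: "x ^ i * s0 \<in> rat_vs.span S" for i
    by (induction i) (use s0 step in \<open>auto simp: rat_vs.span_base mult.assoc\<close>)
  show ?thesis
  proof (cases "inj_on (\<lambda>i. x ^ i * s0) {..card S}")
    case False
    then obtain i j where ij: "i \<noteq> j" "x ^ i * s0 = x ^ j * s0" by (auto simp: inj_on_def)
    then have "qeval (monom 1 i - monom 1 j) x = 0" using s0 by simp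
    moreover have "coeff (monom 1 i - monom 1 j) i \<noteq> (0::rat)" using ij by simp
    then have "monom 1 i - monom 1 j \<noteq> (0 :: rat poly)" by (metis coeff_0)
    ultimately show ?thesis unfolding algebraic_over_rat_def by blast
  next
    case True
    define T where "T = (\<lambda>i. x ^ i * s0) ` {..card S}"
    have cT: "finite T" "card T = Suc (card S)" using True by (simp_all add: T_def card_image)
    have "T \<subseteq> rat_vs.span S" using pow by (auto simp: T_def)
    then have "\<not> rat_vs.independent T"
      using rat_vs.independent_span_bound[OF fin, of T] cT by auto
    then obtain u where u: "\<exists>v\<in>T. u v \<noteq> 0" "(\<Sum>v\<in>T. of_rat (u v) * v) = 0"
      using rat_vs.dependent_finite[OF cT(1)] by auto
    define P where "P = (\<Sum>i\<le>card S. monom (u (x ^ i * s0)) i)"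
    have "qeval P x * s0 = (\<Sum>i\<le>card S. of_rat (u (x ^ i * s0)) * (x ^ i * s0))"
      by (simp add: P_def qeval_sum sum_distrib_right mult.assoc)
    also have "\<dots> = (\<Sum>v\<in>T. of_rat (u v) * v)"
      unfolding T_def by (subst sum.reindex[OF True]) simp
    finally have "qeval P x = 0" using u s0 by simp
    moreover obtain i where i: "i \<le> card S" "u (x ^ i * s0) \<noteq> 0" using u(1) by (auto simp: T_def)
    have "coeff P i = u (x ^ i * s0)" using i by (simp add: P_def coeff_sum)
    then have "P \<noteq> 0" using i by auto
    ultimately show ?thesis unfolding algebraic_over_rat_def by blast
  qed
qed

lemma algebraic_power_reduction:
  assumes "algebraic_over_rat a"
  obtains m c where "m \<ge> 1" "a ^ m = (\<Sum>i<m. of_rat (c i) * a ^ i)"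
proof -
  obtain P where P: "minimal_rat_poly a P" using ex_minimal_rat_poly[OF assms] .
  define m where "m = degree P"
  have lc: "coeff P m \<noteq> 0" using P by (simp add: m_def minimal_rat_poly_def)
  have "0 = qeval P a" using P by (simp add: minimal_rat_poly_def)
  also have "\<dots> = (\<Sum>i\<le>m. of_rat (coeff P i) * a ^ i)"
    by (simp add: qeval_def poly_altdef m_def coeff_map_poly degree_map_poly)
  also have "\<dots> = (\<Sum>i<m. of_rat (coeff P i) * a ^ i) + of_rat (coeff P m) * a ^ m"
    by (simp add: lessThan_Suc_atMost[symmetric])
  finally have "of_rat (coeff P m) * a ^ m = - (\<Sum>i<m. of_rat (coeff P i) * a ^ i)"
    by (simp add: add_eq_0_iff)
  then have "a ^ m = - (\<Sum>i<m. of_rat (coeff P i) * a ^ i) / of_rat (coeff P m)"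
    using lc by (simp add: field_simps)
  also have "\<dots> = (\<Sum>i<m. of_rat (- coeff P i / coeff P m) * a ^ i)"
    by (simp add: sum_divide_distrib sum_negf[symmetric] of_rat_minus of_rat_divide)
  finally have red: "a ^ m = (\<Sum>i<m. of_rat (- coeff P i / coeff P m) * a ^ i)" .
  have "m \<ge> 1" unfolding m_def by (rule degree_minimal_rat_poly[OF P])
  then show thesis by (rule that[OF _ red])
qed

text \<open>The products \<open>a ^ i * b ^ j\<close> with exponents below the degrees span a space stable under both elements.\<close>

lemma algebraic_over_rat_combination:
  fixes a b :: "'a::field_char_0"
  assumes "algebraic_over_rat a" "algebraic_over_rat b"
  shows "algebraic_over_rat (a + of_rat c * b)"
proof -
  obtain m u where m: "m \<ge> 1" "a ^ m = (\<Sum>i<m. of_rat (u i) * a ^ i)"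
    using algebraic_power_reduction[OF assms(1)] by blast
  obtain n w where n: "n \<ge> 1" "b ^ n = (\<Sum>i<n. of_rat (w i) * b ^ i)"
    using algebraic_power_reduction[OF assms(2)] by blast
  define S where "S = (\<lambda>(i, j). a ^ i * b ^ j) ` ({..<m} \<times> {..<n})"
  have SI: "a ^ i * b ^ j \<in> rat_vs.span S" if "i < m" "j < n" for i j
    using that by (intro rat_vs.span_base) (auto simp: S_def)
  have a: "a * (a ^ i * b ^ j) \<in> rat_vs.span S" if ij: "i < m" "j < n" for i j
  proof (cases "Suc i < m")
    case True then show ?thesis using SI[OF True ij(2)] by (simp add: mult.assoc)
  next
    case False
    then have "Suc i = m" using ij by simp
    then have "a * (a ^ i * b ^ j) = a ^ m * b ^ j" by (auto simp: mult.assoc[symmetric])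
    also have "\<dots> = (\<Sum>i<m. of_rat (u i) * (a ^ i * b ^ j))" by (simp add: m(2) sum_distrib_right mult.assoc)
    finally show ?thesis using SI ij by (auto intro!: rat_vs.span_sum rat_vs.span_scale)
  qed
  have b: "b * (a ^ i * b ^ j) \<in> rat_vs.span S" if ij: "i < m" "j < n" for i j
  proof (cases "Suc j < n")
    case True then show ?thesis using SI[OF ij(1) True] by (simp add: mult.left_commute)
  next
    case False
    then have "Suc j = n" using ij by simp
    then have "b * (a ^ i * b ^ j) = b ^ n * a ^ i" by (auto simp: mult_ac)
    also have "\<dots> = (\<Sum>j<n. of_rat (w j) * (a ^ i * b ^ j))" by (simp add: n(2) sum_distrib_left sum_distrib_right mult_ac)
    finally show ?thesis using SI ij by (auto intro!: rat_vs.span_sum rat_vs.span_scale)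
  qed
  show ?thesis
  proof (rule algebraic_over_rat_of_stable_span[of S _ 1])
    show "finite S" by (simp add: S_def)
    show "1 \<in> S" using m(1) n(1) unfolding S_def by (intro image_eqI[of _ _ "(0, 0)"]) auto
    fix s assume "s \<in> S"
    then obtain i j where s: "s = a ^ i * b ^ j" "i < m" "j < n" by (auto simp: S_def)
    have "(a + of_rat c * b) * s = a * s + of_rat c * (b * s)" by (simp add: algebra_simps)
    then show "(a + of_rat c * b) * s \<in> rat_vs.span S"
      using a b s by (simp add: rat_vs.span_add rat_vs.span_scale)
  qed simp
qed

lemma qeval_of_rat: "qeval P (of_rat q) = of_rat (poly P q)"
  by (induction P) (simp_all add: of_rat_add of_rat_mult)

lemma degree_le_1_of_unique_simple_root:
  fixes M :: "'c::{alg_closed_field,field_char_0} poly"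
  assumes uniq: "\<And>\<beta>. poly M \<beta> = 0 \<Longrightarrow> \<beta> = b" and simple: "poly (pderiv M) b \<noteq> 0"
  shows "degree M \<le> 1"
proof (rule ccontr)
  assume "\<not> degree M \<le> 1"
  then have d: "degree M > 1" by simp
  obtain \<beta> where "poly M \<beta> = 0" using alg_closed_imp_poly_has_root[of M] d by auto
  then have "poly M b = 0" using uniq by metis
  then obtain G where G: "M = [:- b, 1:] * G" by (metis poly_eq_0_iff_dvd dvdE)
  have "degree M = 1 + degree G" using d unfolding G by (subst degree_mult_eq) auto
  then obtain \<gamma> where g: "poly G \<gamma> = 0" using alg_closed_imp_poly_has_root[of G] d by auto
  then have "\<gamma> = b" using uniq[of \<gamma>] by (simp add: G)
  then have "poly (pderiv M) b = 0" using g
    by (simp only: G pderiv_mult poly_add poly_mult) (simp add: pderiv_pCons)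
  then show False using simple by simp
qed

definition coeffs_in :: "'c::field_char_0 set \<Rightarrow> 'c poly \<Rightarrow> bool" where
  "coeffs_in E P \<longleftrightarrow> (\<forall>i. coeff P i \<in> E)"

lemma coeffs_in_rat_adjoin:
  fixes x :: "'c::field_char_0"
  defines "E \<equiv> rat_adjoin x"
  shows coeffs_in_0: "coeffs_in E 0"
    and coeffs_in_pCons: "c \<in> E \<Longrightarrow> coeffs_in E P \<Longrightarrow> coeffs_in E (pCons c P)"
    and coeffs_in_add: "coeffs_in E P \<Longrightarrow> coeffs_in E R \<Longrightarrow> coeffs_in E (P + R)"
    and coeffs_in_diff: "coeffs_in E P \<Longrightarrow> coeffs_in E R \<Longrightarrow> coeffs_in E (P - R)"
    and coeffs_in_smult: "c \<in> E \<Longrightarrow> coeffs_in E P \<Longrightarrow> coeffs_in E (smult c P)"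
  unfolding coeffs_in_def E_def
  by (auto simp: rat_adjoin_add rat_adjoin_diff rat_adjoin_mult coeff_pCons split: nat.split)

lemma coeffs_in_mult:
  "coeffs_in (rat_adjoin x) P \<Longrightarrow> coeffs_in (rat_adjoin x) R \<Longrightarrow> coeffs_in (rat_adjoin x) (P * R)"
proof (induction P)
  case 0 then show ?case by (simp add: coeffs_in_0)
next
  case (pCons a P)
  have "a \<in> rat_adjoin x" using pCons(3) unfolding coeffs_in_def by (metis coeff_pCons_0)
  moreover have "coeffs_in (rat_adjoin x) P" using pCons(3) unfolding coeffs_in_def by (metis coeff_pCons_Suc)
  ultimately show ?case using pCons
    by (simp add: mult_pCons_left coeffs_in_add coeffs_in_smult coeffs_in_pCons)
qed

lemma coeffs_in_map_of_rat: "coeffs_in (rat_adjoin x) (map_poly of_rat P)"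
  by (simp add: coeffs_in_def coeff_map_poly)

lemma coeffs_in_pcompose:
  assumes "coeffs_in (rat_adjoin x) R"
  shows "coeffs_in (rat_adjoin x) (pcompose (map_poly of_rat P) R)"
proof (induction P)
  case 0 then show ?case by (simp add: coeffs_in_0)
next
  case (pCons a P)
  then show ?case using assms
    by (simp add: map_poly_pCons pcompose_pCons coeffs_in_add coeffs_in_mult coeffs_in_pCons coeffs_in_0)
qed

text \<open>This is division with remainder by \<open>M\<close>, one step at a time: the coefficients stay in the field
\<open>rat_adjoin x\<close> because only the leading coefficient of \<open>M\<close> is inverted.\<close>

lemma minimal_poly_over_rat_adjoin_dvd:
  fixes x b :: "'c::field_char_0"
  assumes alg: "algebraic_over_rat x"
    and M: "M \<noteq> 0" "coeffs_in (rat_adjoin x) M" "poly M b = 0"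
    and least: "\<And>P. P \<noteq> 0 \<Longrightarrow> coeffs_in (rat_adjoin x) P \<Longrightarrow> poly P b = 0 \<Longrightarrow> degree M \<le> degree P"
    and P: "coeffs_in (rat_adjoin x) P" "poly P b = 0"
  shows "M dvd P"
  using P
proof (induction "degree P" arbitrary: P rule: less_induct)
  case less
  show ?case
  proof (cases "P = 0")
    case False
    have le: "degree M \<le> degree P" using least False less.prems by blast
    define c where "c = coeff P (degree P) * inverse (coeff M (degree M))"
    define T where "T = monom c (degree P - degree M)"
    have c: "c \<in> rat_adjoin x" unfolding c_def
      using less.prems(1) M(2) alg by (auto simp: coeffs_in_def intro!: rat_adjoin_mult rat_adjoin_inverse)
    have c0: "c \<noteq> 0" using False M(1) by (simp add: c_def)
    have T0: "T \<noteq> 0" using c0 by (simp add: T_def)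
    have dT: "degree (T * M) = degree P" using T0 M(1) le c0 by (simp add: degree_mult_eq T_def degree_monom_eq)
    have lT: "coeff (T * M) (degree P) = coeff P (degree P)"
      using lead_coeff_mult[of T M] M(1) le c0 dT by (simp add: T_def degree_monom_eq c_def)
    define R where "R = P - T * M"
    have R: "coeffs_in (rat_adjoin x) R" "poly R b = 0"
      unfolding R_def T_def using less.prems M c
      by (auto intro!: coeffs_in_diff coeffs_in_mult simp: coeffs_in_def[of _ "monom _ _"])
    have "M dvd R"
    proof (cases "R = 0")
      case False
      have "coeff R (degree P) = 0" using lT by (simp add: R_def)
      moreover have "degree R \<le> degree P" unfolding R_def using dT by (intro degree_diff_le) auto
      ultimately have "degree R < degree P"
        using False by (metis leading_coeff_0_iff order_le_imp_less_or_eq)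
      then show ?thesis using less.hyps R by blast
    qed simp
    then have "M dvd R + T * M" by simp
    then show ?thesis by (simp add: R_def)
  qed simp
qed

lemma finite_qeval_roots: "P \<noteq> 0 \<Longrightarrow> finite {x :: 'c::field_char_0. qeval P x = 0}"
  unfolding qeval_def by (rule poly_roots_finite) (simp add: map_poly_eq_0_iff)

text \<open>The classical argument: \<open>c\<close> is chosen such that, for \<open>\<gamma> = a + c * b\<close>, the polynomials \<open>g\<close> and
\<open>f (\<gamma> - c * X)\<close> have only the root \<open>b\<close> in common, where \<open>f\<close> and \<open>g\<close> are the minimal polynomials of
\<open>a\<close> and \<open>b\<close>.  A polynomial \<open>M\<close> of least degree over \<open>rat_adjoin \<gamma>\<close> with root \<open>b\<close> divides both, so it
has no other root; the root is simple since it is a simple root of \<open>g\<close>.  Hence \<open>M\<close> is linear and \<open>b\<close>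
is a quotient of its coefficients.\<close>

lemma primitive_element_alg_closed:
  fixes a b :: "'c::{alg_closed_field,field_char_0}"
  assumes alg: "algebraic_over_rat a" "algebraic_over_rat b"
  obtains c where "a \<in> rat_adjoin (a + of_rat c * b)" "b \<in> rat_adjoin (a + of_rat c * b)"
proof -
  obtain f where f: "minimal_rat_poly a f" using ex_minimal_rat_poly[OF alg(1)] .
  obtain g where g: "minimal_rat_poly b g" using ex_minimal_rat_poly[OF alg(2)] .
  define A where "A = {x :: 'c. qeval f x = 0}"
  define B where "B = {x :: 'c. qeval g x = 0}"
  have fin: "finite A" "finite B" using f g unfolding A_def B_def minimal_rat_poly_def
    by (auto intro!: finite_qeval_roots)
  have "finite ((of_rat :: rat \<Rightarrow> 'c) -` ((\<lambda>(\<alpha>, \<beta>). (\<alpha> - a) / (b - \<beta>)) ` (A \<times> B)))"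
    using fin by (intro finite_vimageI) (auto simp: inj_def)
  then obtain c :: rat where c: "of_rat c \<notin> (\<lambda>(\<alpha>, \<beta>). (\<alpha> - a) / (b - \<beta>)) ` (A \<times> B)"
    using infinite_UNIV_char_0[where 'a=rat] by (metis UNIV_eq_I vimageI)
  define \<gamma> where "\<gamma> = a + of_rat c * b"
  let ?E = "rat_adjoin \<gamma>"
  have alg_g: "algebraic_over_rat \<gamma>" unfolding \<gamma>_def by (rule algebraic_over_rat_combination[OF alg])
  let ?ok = "\<lambda>P. P \<noteq> 0 \<and> coeffs_in ?E P \<and> poly P b = 0"
  have gok: "?ok (map_poly of_rat g)"
    using g by (auto simp: minimal_rat_poly_def qeval_def map_poly_eq_0_iff coeffs_in_map_of_rat)
  then obtain M where M: "?ok M" "\<And>P. ?ok P \<Longrightarrow> degree M \<le> degree P"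
    using ex_has_least_nat[of ?ok _ degree] by blast
  have dvd: "M dvd P" if "coeffs_in ?E P" "poly P b = 0" for P
    using minimal_poly_over_rat_adjoin_dvd[OF alg_g] M that by blast
  have Mg: "M dvd map_poly of_rat g" using dvd gok by blast
  have Mf: "M dvd pcompose (map_poly of_rat f) [:\<gamma>, - of_rat c:]"
  proof (rule dvd)
    have "- of_rat c \<in> ?E" by (metis of_rat_minus rat_adjoin_of_rat)
    then show "coeffs_in ?E (pcompose (map_poly of_rat f) [:\<gamma>, - of_rat c:])"
      by (intro coeffs_in_pcompose coeffs_in_pCons coeffs_in_0) auto
    show "poly (pcompose (map_poly of_rat f) [:\<gamma>, - of_rat c:]) b = 0"
      using f by (simp add: poly_pcompose \<gamma>_def minimal_rat_poly_def qeval_def algebra_simps)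
  qed
  have uniq: "\<beta> = b" if "poly M \<beta> = 0" for \<beta>
  proof (rule ccontr)
    assume "\<beta> \<noteq> b"
    have "poly (map_poly of_rat g) \<beta> = 0" using Mg that by (auto elim!: dvdE)
    then have "\<beta> \<in> B" by (simp add: B_def qeval_def)
    have "poly (pcompose (map_poly of_rat f) [:\<gamma>, - of_rat c:]) \<beta> = 0" using Mf that by (auto elim!: dvdE)
    then have "\<gamma> - of_rat c * \<beta> \<in> A" by (simp add: A_def qeval_def poly_pcompose mult.commute)
    moreover have "(\<gamma> - of_rat c * \<beta> - a) / (b - \<beta>) = of_rat c"
      using \<open>\<beta> \<noteq> b\<close> by (simp add: \<gamma>_def field_simps)
    ultimately have "of_rat c \<in> (\<lambda>(\<alpha>, \<beta>). (\<alpha> - a) / (b - \<beta>)) ` (A \<times> B)"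
      using \<open>\<beta> \<in> B\<close> by (intro image_eqI[of _ _ "(\<gamma> - of_rat c * \<beta>, \<beta>)"]) auto
    then show False using c by simp
  qed
  have "poly (pderiv M) b \<noteq> 0"
  proof
    assume z: "poly (pderiv M) b = 0"
    obtain T where T: "map_poly of_rat g = M * T" using Mg by (auto elim: dvdE)
    have "pderiv (map_poly (of_rat :: rat \<Rightarrow> 'c) g) = map_poly of_rat (pderiv g)"
      by (rule poly_eqI) (simp add: coeff_pderiv coeff_map_poly of_rat_mult of_rat_add)
    then have "qeval (pderiv g) b = poly (pderiv (M * T)) b" by (simp add: qeval_def flip: T)
    also have "\<dots> = 0" using z M(1) by (simp add: pderiv_mult)
    finally show False using minimal_rat_poly_simple_root[OF g] by simp
  qed
  then have "degree M \<le> 1" using degree_le_1_of_unique_simple_root uniq by blast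
  moreover obtain u v R where "M = pCons u (pCons v R)" by (metis pCons_cases)
  ultimately have M1: "M = [:u, v:]" by (auto split: if_splits)
  have uv: "u + b * v = 0" "v \<noteq> 0" using M(1) unfolding M1 by auto
  have "u \<in> ?E" "v \<in> ?E" using M(1) unfolding M1 coeffs_in_def by (metis coeff_pCons_0, metis coeff_pCons_0 coeff_pCons_Suc)
  then have "(0 - u) * inverse v \<in> ?E"
    using alg_g by (intro rat_adjoin_mult rat_adjoin_diff rat_adjoin_inverse) auto
  moreover have "b = (0 - u) * inverse v" using uv by (simp add: field_simps eq_neg_iff_add_eq_0)
  ultimately have b: "b \<in> ?E" by simp
  have "\<gamma> - of_rat c * b \<in> ?E" using b by (intro rat_adjoin_diff rat_adjoin_mult) auto
  then have "a \<in> ?E" by (simp add: \<gamma>_def)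
  then show thesis using b that unfolding \<gamma>_def by blast
qed

text \<open>Roots are needed only inside the proof: the polynomials found in the algebraic closure have rational
coefficients, so they express \<open>a\<close> and \<open>b\<close> in the original field as well.\<close>

lemma primitive_element:
  fixes a b :: "'a::field_char_0"
  assumes alg: "algebraic_over_rat a" "algebraic_over_rat b"
  obtains c where "a \<in> rat_adjoin (a + of_rat c * b)" "b \<in> rat_adjoin (a + of_rat c * b)"
proof -
  obtain c where c: "to_ac a \<in> rat_adjoin (to_ac a + of_rat c * to_ac b)" "to_ac b \<in> rat_adjoin (to_ac a + of_rat c * to_ac b)"
    using primitive_element_alg_closed[of "to_ac a" "to_ac b"] alg by auto
  have pull: "y \<in> rat_adjoin (a + of_rat c * b)" if y: "to_ac y \<in> rat_adjoin (to_ac a + of_rat c * to_ac b)" for y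
  proof -
    obtain P where "to_ac y = qeval P (to_ac a + of_rat c * to_ac b)" using y by (auto simp: rat_adjoin_def)
    also have "\<dots> = to_ac (qeval P (a + of_rat c * b))" by simp
    finally have "y = qeval P (a + of_rat c * b)" by (simp only: to_ac_eq_iff)
    then show ?thesis by (simp add: rat_adjoinI)
  qed
  show thesis using that pull c by blast
qed

section \<open>Two embeddings of a number field\<close>

lemma subfieldD:
  assumes "is_subfield K"
  shows "1 \<in> K" "0 \<in> K" "x \<in> K \<Longrightarrow> y \<in> K \<Longrightarrow> x * y \<in> K" "x \<in> K \<Longrightarrow> y \<in> K \<Longrightarrow> x - y \<in> K" "x \<in> K \<Longrightarrow> y \<in> K \<Longrightarrow> x + y \<in> K"
proof -
  show 1: "1 \<in> K" and m: "x \<in> K \<Longrightarrow> y \<in> K \<Longrightarrow> x * y \<in> K" and d: "x \<in> K \<Longrightarrow> y \<in> K \<Longrightarrow> x - y \<in> K" for x y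
    using assms by (auto simp: is_subfield_def)
  show 0: "0 \<in> K" using d[OF 1 1] by simp
  show "x \<in> K \<Longrightarrow> y \<in> K \<Longrightarrow> x + y \<in> K" using d[of x "0 - y"] d[of 0 y] 0 by simp
qed

lemma number_field_algebraic:
  assumes K: "number_field K" and x: "x \<in> K"
  shows "algebraic_over_rat x"
proof -
  obtain B where B: "finite B" "rat_vs.span B = K" and sf: "is_subfield K" using K by (auto simp: number_field_def)
  have BK: "B \<subseteq> K" using rat_vs.span_superset[of B] B(2) by simp
  have "\<exists>s\<in>B. s \<noteq> 0"
  proof (rule ccontr)
    assume "\<not> (\<exists>s\<in>B. s \<noteq> 0)"
    then have "B \<subseteq> {0}" by auto
    then have "rat_vs.span B \<subseteq> rat_vs.span {0}" by (rule rat_vs.span_mono)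
    then have "1 \<in> rat_vs.span ({0} :: 'a set)" using B(2) subfieldD(1)[OF sf] by auto
    then show False by (auto simp: rat_vs.span_singleton)
  qed
  then obtain s where s: "s \<in> B" "s \<noteq> 0" by blast
  show ?thesis
  proof (rule algebraic_over_rat_of_stable_span[OF B(1) _ s])
    fix t assume "t \<in> B"
    then show "x * t \<in> rat_vs.span B" unfolding B(2) using BK x subfieldD(3)[OF sf] by blast
  qed
qed

lemma of_rat_in_number_field:
  assumes "number_field K" shows "of_rat c \<in> K"
proof -
  obtain B where B: "rat_vs.span B = K" and sf: "is_subfield K" using assms by (auto simp: number_field_def)
  have "of_rat c * 1 \<in> rat_vs.span B" using subfieldD(1)[OF sf] unfolding B[symmetric] by (intro rat_vs.span_scale)
  then show ?thesis using B by simp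
qed

lemma number_field_primitive:
  assumes K: "number_field K"
  obtains \<theta> where "\<theta> \<in> K" "K = rat_adjoin \<theta>"
proof -
  obtain B where B: "finite B" "rat_vs.span B = K" and sf: "is_subfield K" using K by (auto simp: number_field_def)
  have BK: "B \<subseteq> K" using rat_vs.span_superset[of B] B(2) by simp
  have "\<exists>\<theta>\<in>K. B \<subseteq> rat_adjoin \<theta>" using B(1) BK
  proof (induction B rule: finite_induct)
    case empty then show ?case using subfieldD(2)[OF sf] by auto
  next
    case (insert x B)
    then obtain \<theta> where t: "\<theta> \<in> K" "B \<subseteq> rat_adjoin \<theta>" by auto
    obtain c where c: "\<theta> \<in> rat_adjoin (\<theta> + of_rat c * x)" "x \<in> rat_adjoin (\<theta> + of_rat c * x)"
      using primitive_element[of \<theta> x] number_field_algebraic[OF K] t insert.prems by auto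
    have "\<theta> + of_rat c * x \<in> K" using t insert.prems of_rat_in_number_field[OF K]
      by (intro subfieldD[OF sf]) auto
    moreover have "B \<subseteq> rat_adjoin (\<theta> + of_rat c * x)" using t(2) c(1) rat_adjoin_trans by blast
    ultimately show ?case using c(2) by blast
  qed
  then obtain \<theta> where t: "\<theta> \<in> K" "B \<subseteq> rat_adjoin \<theta>" by blast
  have "K \<subseteq> rat_adjoin \<theta>" using rat_span_subset_rat_adjoin[OF t(2)] B(2) by simp
  moreover have "qeval P \<theta> \<in> K" for P
  proof (induction P)
    case 0 then show ?case using subfieldD(2)[OF sf] by simp
  next
    case (pCons a P)
    then show ?case using subfieldD[OF sf] of_rat_in_number_field[OF K] t(1) by simp
  qed
  then have "rat_adjoin \<theta> \<subseteq> K" by (auto simp: rat_adjoin_def)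
  ultimately show thesis using that t(1) by blast
qed

definition rat_embedding :: "'a::field_char_0 set \<Rightarrow> ('a \<Rightarrow> 'b::field_char_0) \<Rightarrow> bool" where
  "rat_embedding K \<sigma> \<longleftrightarrow> (\<forall>q. \<sigma> (of_rat q) = of_rat q) \<and>
     (\<forall>x\<in>K. \<forall>y\<in>K. \<sigma> (x + y) = \<sigma> x + \<sigma> y \<and> \<sigma> (x * y) = \<sigma> x * \<sigma> y)"

text \<open>The field is generated by one element \<open>\<theta>\<close> of degree at least 2, whose minimal polynomial has a simple root
at \<open>\<theta>\<close> and hence a second root in the algebraic closure.  Sending \<open>\<theta>\<close> to that root defines an embedding
\<open>\<sigma>\<close> different from the inclusion.  The element \<open>\<eta>\<close> is primitive for the field generated by both roots.\<close>

lemma ex_two_embeddings: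
  fixes K :: "'a::field_char_0 set"
  assumes K: "number_field K" and deg: "field_degree K \<ge> 2"
  obtains \<sigma> :: "'a \<Rightarrow> 'a alg_closure" and \<theta> \<eta>
  where "rat_embedding K \<sigma>" "\<theta> \<in> K" "\<sigma> \<theta> \<noteq> to_ac \<theta>" "algebraic_over_rat \<eta>"
    "\<And>y. y \<in> K \<Longrightarrow> \<sigma> y \<in> rat_adjoin \<eta> \<and> to_ac y \<in> rat_adjoin \<eta>"
proof -
  obtain \<theta> where t: "\<theta> \<in> K" "K = rat_adjoin \<theta>" using number_field_primitive[OF K] .
  have alg: "algebraic_over_rat \<theta>" using number_field_algebraic[OF K t(1)] .
  obtain m where m: "minimal_rat_poly \<theta> m" using ex_minimal_rat_poly[OF alg] .
  have dm: "degree m \<ge> 2"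
  proof (rule ccontr)
    assume "\<not> degree m \<ge> 2"
    then have "degree m = 1" using degree_minimal_rat_poly[OF m] by simp
    moreover obtain u m' where m1: "m = pCons u m'" by (metis pCons_cases)
    ultimately have "degree m' = 0" by (simp split: if_splits)
    then obtain v where "m' = [:v:]" by (rule degree_eq_zeroE)
    then have uv: "m = [:u, v:]" "v \<noteq> 0" using m1 \<open>degree m = 1\<close> by auto
    have "of_rat u + \<theta> * of_rat v = 0" using m by (simp add: uv minimal_rat_poly_def)
    then have "\<theta> = of_rat (- u / v)" using uv(2) by (simp add: of_rat_divide of_rat_minus field_simps eq_neg_iff_add_eq_0)
    then have "qeval P \<theta> = of_rat (poly P (- u / v)) * 1" for P
      by (simp only: qeval_of_rat mult_1_right)
    then have sc: "qeval P \<theta> \<in> rat_vs.span {1}" for P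
      unfolding rat_vs.span_singleton by blast
    have "K \<subseteq> rat_vs.span {1}" unfolding t(2) using sc by (auto simp: rat_adjoin_def)
    then have "rat_vs.dim K \<le> card {1 :: 'a}" by (rule rat_vs.dim_le_card) simp
    then show False using deg by (simp add: field_degree_def)
  qed
  let ?m = "map_poly of_rat m :: 'a alg_closure poly"
  have dM: "degree ?m = degree m" by (rule degree_map_poly) simp
  have "pderiv ?m = map_poly of_rat (pderiv m)"
    by (rule poly_eqI) (simp add: coeff_pderiv coeff_map_poly of_rat_mult of_rat_add)
  then have "poly (pderiv ?m) (to_ac \<theta>) = to_ac (qeval (pderiv m) \<theta>)" by (simp add: qeval_def[symmetric])
  then have "poly (pderiv ?m) (to_ac \<theta>) \<noteq> 0" using minimal_rat_poly_simple_root[OF m] by (simp del: to_ac_qeval)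
  then obtain \<theta>' where t': "poly ?m \<theta>' = 0" "\<theta>' \<noteq> to_ac \<theta>"
    using degree_le_1_of_unique_simple_root[of ?m "to_ac \<theta>"] dm dM by auto
  then have m': "qeval m \<theta>' = 0" by (simp add: qeval_def)
  have well: "qeval P \<theta>' = qeval R \<theta>'" if "qeval P \<theta> = qeval R \<theta>" for P R
  proof -
    have "qeval (P - R) \<theta> = 0" using that by simp
    then obtain T where "P - R = m * T" using minimal_rat_poly_dvd[OF m] by (metis dvdE)
    then have "qeval (P - R) \<theta>' = 0" using m' by simp
    then show ?thesis by simp
  qed
  define \<sigma> where "\<sigma> y = qeval (SOME P. qeval P \<theta> = y) \<theta>'" for y
  have s: "\<sigma> (qeval P \<theta>) = qeval P \<theta>'" for P
    unfolding \<sigma>_def by (rule well, rule someI[of _ P]) simp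
  have emb: "rat_embedding K \<sigma>"
    unfolding rat_embedding_def
  proof (intro conjI allI ballI)
    fix q show "\<sigma> (of_rat q) = of_rat q" using s[of "[:q:]"] by simp
  next
    fix x y assume "x \<in> K" "y \<in> K"
    then obtain P R where "x = qeval P \<theta>" "y = qeval R \<theta>" by (auto simp: t(2) rat_adjoin_def)
    then show "\<sigma> (x + y) = \<sigma> x + \<sigma> y" "\<sigma> (x * y) = \<sigma> x * \<sigma> y"
      using s[of "P + R"] s[of "P * R"] s[of P] s[of R] by simp_all
  qed
  have sth: "\<sigma> \<theta> = \<theta>'" using s[of "[:0, 1:]"] by simp
  have alg': "algebraic_over_rat \<theta>'" using m' m by (auto simp: algebraic_over_rat_def minimal_rat_poly_def)
  obtain c where c: "to_ac \<theta> \<in> rat_adjoin (to_ac \<theta> + of_rat c * \<theta>')" "\<theta>' \<in> rat_adjoin (to_ac \<theta> + of_rat c * \<theta>')"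
    using primitive_element_alg_closed[of "to_ac \<theta>" \<theta>'] alg alg' by auto
  show thesis
  proof (rule that[OF emb t(1)])
    show "\<sigma> \<theta> \<noteq> to_ac \<theta>" using sth t'(2) by simp
    show "algebraic_over_rat (to_ac \<theta> + of_rat c * \<theta>')"
      using alg alg' by (intro algebraic_over_rat_combination) auto
    fix y assume "y \<in> K"
    then obtain P where P: "y = qeval P \<theta>" by (auto simp: t(2) rat_adjoin_def)
    show "\<sigma> y \<in> rat_adjoin (to_ac \<theta> + of_rat c * \<theta>') \<and> to_ac y \<in> rat_adjoin (to_ac \<theta> + of_rat c * \<theta>')"
      unfolding P s to_ac_qeval using c rat_adjoin_trans rat_adjoinI by blast
  qed
qed

section \<open>Reduction modulo primes\<close>

abbreviation rat_of_int_poly :: "int poly \<Rightarrow> rat poly" where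
  "rat_of_int_poly \<equiv> map_poly of_int"

lemma rat_of_int_poly_hom:
  shows "rat_of_int_poly (P + R) = rat_of_int_poly P + rat_of_int_poly R"
    and "rat_of_int_poly (P - R) = rat_of_int_poly P - rat_of_int_poly R"
    and "rat_of_int_poly (P * R) = rat_of_int_poly P * rat_of_int_poly R"
    and "rat_of_int_poly (smult c P) = smult (of_int c) (rat_of_int_poly P)"
    and "rat_of_int_poly [:c:] = [:of_int c:]"
    and "rat_of_int_poly (pderiv P) = pderiv (rat_of_int_poly P)"
  by (auto simp: poly_eq_iff coeff_map_poly coeff_mult coeff_pderiv coeff_pCons split: nat.split)

lemma rat_of_int_poly_eq_iff: "rat_of_int_poly P = rat_of_int_poly R \<longleftrightarrow> P = R"
  by (auto simp: poly_eq_iff coeff_map_poly)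

definition ieval :: "int poly \<Rightarrow> 'a::field_char_0 \<Rightarrow> 'a" where
  "ieval P x = qeval (rat_of_int_poly P) x"

lemma ieval_simps [simp]:
  "ieval (P + R) x = ieval P x + ieval R x" "ieval (P - R) x = ieval P x - ieval R x"
  "ieval (P * R) x = ieval P x * ieval R x" "ieval (smult c P) x = of_int c * ieval P x"
  "ieval [:c:] x = of_int c" "ieval 0 x = 0"
  by (simp_all add: ieval_def rat_of_int_poly_hom)

lemma ieval_sum: "ieval (\<Sum>i\<in>I. P i) x = (\<Sum>i\<in>I. ieval (P i) x)"
  by (induction I rule: infinite_finite_induct) simp_all

lemma clear_denominators:
  fixes P :: "rat poly"
  obtains e :: int and P' where "e > 0" "rat_of_int_poly P' = smult (of_int e) P"
proof -
  have "\<exists>(e::int) P'. e > 0 \<and> rat_of_int_poly P' = smult (of_int e) P"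
  proof (induction P)
    case 0
    show ?case by (intro exI[of _ 1] exI[of _ 0]) simp
  next
    case (pCons a P)
    then obtain e P' where e: "(e::int) > 0" "rat_of_int_poly P' = smult (of_int e) P" by blast
    obtain u v where uv: "a = of_int u / of_int v" "v > 0" by (metis quotient_of_denom_pos quotient_of_div surj_pair)
    have c: "of_int (coeff P' n) = of_int e * coeff P n" for n
      using arg_cong[OF e(2), of "\<lambda>q. coeff q n"] by (simp add: coeff_map_poly)
    have "rat_of_int_poly (pCons (e * u) (smult v P')) = smult (of_int (e * v)) (pCons a P)"
      using uv by (intro poly_eqI) (simp add: coeff_map_poly coeff_pCons c split: nat.split)
    moreover have "e * v > 0" using e uv by simp
    ultimately show ?case by blast
  qed
  then show thesis using that by blast
qed

lemma common_denominator:
  fixes q :: "'i \<Rightarrow> rat"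
  assumes "finite I"
  obtains e :: int where "e > 0" "\<And>i. i \<in> I \<Longrightarrow> \<exists>z. of_int z = of_int e * q i"
proof -
  have "\<exists>e::int. e > 0 \<and> (\<forall>i\<in>I. \<exists>z. of_int z = of_int e * q i)" using assms
  proof (induction I rule: finite_induct)
    case empty show ?case by (intro exI[of _ 1]) simp
  next
    case (insert j I)
    then obtain e where e: "(e::int) > 0" "\<forall>i\<in>I. \<exists>z. of_int z = of_int e * q i" by blast
    obtain u v where uv: "q j = of_int u / of_int v" "v > 0" by (metis quotient_of_denom_pos quotient_of_div surj_pair)
    have "\<exists>z. of_int z = of_int (e * v) * q i" if i: "i \<in> insert j I" for i
    proof (cases "i = j")
      case True
      then have "of_int (e * u) = of_int (e * v) * q i" using uv by simp
      then show ?thesis by blast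
    next
      case False
      then obtain z where "of_int z = of_int e * q i" using e i by blast
      then have "of_int (v * z) = of_int (e * v) * q i" by simp
      then show ?thesis by blast
    qed
    then show ?case using e uv by (intro exI[of _ "e * v"]) simp
  qed
  then show thesis using that by blast
qed

lemma common_denominator_rat_adjoin:
  fixes y :: "'i \<Rightarrow> 'a::field_char_0"
  assumes "finite I" "\<And>i. i \<in> I \<Longrightarrow> y i \<in> rat_adjoin \<eta>"
  obtains e :: int and P where "e > 0" "\<And>i. i \<in> I \<Longrightarrow> ieval (P i) \<eta> = of_int e * y i"
proof -
  have "\<exists>e::int. e > 0 \<and> (\<forall>i\<in>I. \<exists>P. ieval P \<eta> = of_int e * y i)" using assms
  proof (induction I rule: finite_induct)
    case empty show ?case by (intro exI[of _ 1]) simp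
  next
    case (insert j I)
    then obtain e where e: "(e::int) > 0" "\<forall>i\<in>I. \<exists>P. ieval P \<eta> = of_int e * y i" by auto
    obtain R where R: "y j = qeval R \<eta>" using insert.prems by (auto simp: rat_adjoin_def)
    obtain d R' where d: "d > 0" "rat_of_int_poly R' = smult (of_int d) R" by (rule clear_denominators)
    have "\<exists>P. ieval P \<eta> = of_int (e * d) * y i" if i: "i \<in> insert j I" for i
    proof (cases "i = j")
      case True
      have "ieval R' \<eta> = of_int d * y j" by (simp add: ieval_def d(2) R)
      then have "ieval (smult e R') \<eta> = of_int (e * d) * y i" using True by simp
      then show ?thesis by blast
    next
      case False
      then obtain P where "ieval P \<eta> = of_int e * y i" using e i by blast
      then have "ieval (smult d P) \<eta> = of_int (e * d) * y i" by simp
      then show ?thesis by blast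
    qed
    then show ?case using e d by (intro exI[of _ "e * d"]) simp
  qed
  then obtain e where e: "(e::int) > 0" "\<forall>i\<in>I. \<exists>P. ieval P \<eta> = of_int e * y i" by blast
  then obtain P where "\<forall>i\<in>I. ieval (P i) \<eta> = of_int e * y i" by metis
  then show thesis using that e(1) by blast
qed

text \<open>A root \<open>n\<close> of \<open>h\<close> modulo \<open>p\<close> serves as a reduction of \<open>\<eta>\<close> modulo \<open>p\<close>.  The bad primes for \<open>P\<close> are those
for which vanishing of \<open>P\<close> at some such \<open>n\<close> modulo \<open>p\<close> differs from vanishing of \<open>P\<close> at \<open>\<eta>\<close>.\<close>

definition bad_primes :: "int poly \<Rightarrow> 'a::field_char_0 \<Rightarrow> int poly \<Rightarrow> int set" where
  "bad_primes h \<eta> P = {p. prime p \<and> (\<exists>n. p dvd poly h n \<and> (p dvd poly P n \<longleftrightarrow> ieval P \<eta> \<noteq> 0))}"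

lemma finite_prime_divisors_int: "(e::int) \<noteq> 0 \<Longrightarrow> finite {p. prime p \<and> p dvd e}"
  by (rule finite_subset[OF _ finite_divisors_int[of e]]) auto

text \<open>Take for \<open>h\<close> an integer multiple of the minimal polynomial.  If \<open>P\<close> vanishes at \<open>\<eta>\<close>, then \<open>h\<close> divides an
integer multiple of \<open>P\<close>; otherwise a Bezout relation expresses a nonzero integer as a combination of \<open>P\<close>
and \<open>h\<close>.  In both cases a bad prime divides a fixed nonzero integer.\<close>

lemma ex_reduction_poly:
  fixes \<eta> :: "'a::field_char_0"
  assumes alg: "algebraic_over_rat \<eta>"
  obtains h where "degree h \<ge> 1" "ieval (pderiv h) \<eta> \<noteq> 0" "\<And>P. finite (bad_primes h \<eta> P)"
proof -
  obtain m where m: "minimal_rat_poly \<eta> m" using ex_minimal_rat_poly[OF alg] .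
  obtain a h where h: "(a::int) > 0" "rat_of_int_poly h = smult (of_int a) m" by (rule clear_denominators)
  have "degree h = degree (rat_of_int_poly h)" by (rule degree_map_poly[symmetric]) simp
  then have d: "degree h \<ge> 1" using h degree_minimal_rat_poly[OF m] by simp
  have s: "ieval (pderiv h) \<eta> \<noteq> 0"
    using h minimal_rat_poly_simple_root[OF m] by (simp add: ieval_def rat_of_int_poly_hom pderiv_smult)
  have "finite (bad_primes h \<eta> P)" for P
  proof (cases "ieval P \<eta> = 0")
    case True
    obtain T where T: "rat_of_int_poly P = m * T"
      using minimal_rat_poly_dvd[OF m] True unfolding ieval_def by (metis dvdE)
    obtain e T' where e: "(e::int) > 0" "rat_of_int_poly T' = smult (of_int e) T" by (rule clear_denominators)
    have "rat_of_int_poly (smult (a * e) P) = rat_of_int_poly (h * T')"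
      by (simp add: rat_of_int_poly_hom T h e mult.commute)
    then have eq: "smult (a * e) P = h * T'" by (simp only: rat_of_int_poly_eq_iff)
    have "bad_primes h \<eta> P \<subseteq> {p. prime p \<and> p dvd a * e}"
    proof
      fix p assume "p \<in> bad_primes h \<eta> P"
      then obtain n where p: "prime p" "p dvd poly h n" "\<not> p dvd poly P n" using True by (auto simp: bad_primes_def)
      have "a * e * poly P n = poly h n * poly T' n" using arg_cong[OF eq, of "\<lambda>q. poly q n"] by simp
      then have "p dvd a * e * poly P n" using p(2) by simp
      then show "p \<in> {p. prime p \<and> p dvd a * e}" using p by (simp add: prime_dvd_mult_iff)
    qed
    then show ?thesis by (rule finite_subset) (rule finite_prime_divisors_int, use h e in simp)
  next
    case False
    obtain A B where AB: "A * rat_of_int_poly P + B * m = 1"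
      using minimal_rat_poly_bezout[OF m] False unfolding ieval_def by blast
    obtain u A' where u: "(u::int) > 0" "rat_of_int_poly A' = smult (of_int u) A" by (rule clear_denominators)
    obtain v B' where v: "(v::int) > 0" "rat_of_int_poly B' = smult (of_int v) B" by (rule clear_denominators)
    have "rat_of_int_poly (smult (a * v) A' * P + smult u B' * h) = smult (of_int (a * u * v)) (A * rat_of_int_poly P + B * m)"
      by (simp only: rat_of_int_poly_hom u v h smult_smult mult_smult_left mult_smult_right smult_add_right of_int_mult mult_ac)
    also have "\<dots> = rat_of_int_poly [:a * u * v:]" by (simp add: AB rat_of_int_poly_hom)
    finally have eq: "smult (a * v) A' * P + smult u B' * h = [:a * u * v:]" by (simp only: rat_of_int_poly_eq_iff)
    have "bad_primes h \<eta> P \<subseteq> {p. prime p \<and> p dvd a * u * v}"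
    proof
      fix p assume "p \<in> bad_primes h \<eta> P"
      then obtain n where p: "prime p" "p dvd poly h n" "p dvd poly P n" using False by (auto simp: bad_primes_def)
      have "a * u * v = a * v * poly A' n * poly P n + u * poly B' n * poly h n"
        using arg_cong[OF eq, of "\<lambda>q. poly q n"] by simp
      moreover have "p dvd a * v * poly A' n * poly P n + u * poly B' n * poly h n" using p by simp
      ultimately show "p \<in> {p. prime p \<and> p dvd a * u * v}" using p by simp
    qed
    then show ?thesis by (rule finite_subset) (rule finite_prime_divisors_int, use h u v in simp)
  qed
  then show thesis using that d s by blast
qed

text \<open>Multiplying the row vector \<open>v\<close> by the matrix and then by its adjugate gives the determinant times \<open>v\<close>.\<close>

lemma left_kernel_dvd_det:
  fixes A :: "int mat" and p :: int
  assumes A: "A \<in> carrier_mat n n" and p: "prime p" and l: "l < n" "\<not> p dvd v l"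
    and ker: "\<And>j. j < n \<Longrightarrow> p dvd (\<Sum>i<n. v i * A $$ (i, j))"
  shows "p dvd det A"
proof -
  define B where "B = adj_mat A"
  have B: "B \<in> carrier_mat n n" "A * B = det A \<cdot>\<^sub>m 1\<^sub>m n" using adj_mat[OF A] by (auto simp: B_def)
  have AB: "(\<Sum>j<n. A $$ (i, j) * B $$ (j, l)) = (if i = l then det A else 0)" if i: "i < n" for i
  proof -
    have "(A * B) $$ (i, l) = (\<Sum>j<n. A $$ (i, j) * B $$ (j, l))"
      using A B(1) i l by (simp add: scalar_prod_def lessThan_atLeast0)
    then show ?thesis using i l unfolding B(2) by (cases "i = l") auto
  qed
  have "(\<Sum>j<n. (\<Sum>i<n. v i * A $$ (i, j)) * B $$ (j, l)) = (\<Sum>i<n. \<Sum>j<n. v i * (A $$ (i, j) * B $$ (j, l)))"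
    by (subst sum.swap) (simp add: sum_distrib_right mult.assoc)
  also have "\<dots> = (\<Sum>i<n. v i * (if i = l then det A else 0))"
    by (intro sum.cong refl) (simp add: sum_distrib_left[symmetric] AB)
  also have "\<dots> = v l * det A" using l by (simp add: if_distrib cong: if_cong)
  finally have "v l * det A = (\<Sum>j<n. (\<Sum>i<n. v i * A $$ (i, j)) * B $$ (j, l))" by simp
  moreover have "p dvd (\<Sum>j<n. (\<Sum>i<n. v i * A $$ (i, j)) * B $$ (j, l))"
    by (rule dvd_sum, rule dvd_mult2, rule ker) simp
  ultimately have "p dvd v l * det A" by simp
  then show ?thesis using p l by (simp add: prime_dvd_mult_iff)
qed

lemma abs_det_le:
  fixes A :: "int mat"
  assumes A: "A \<in> carrier_mat n n" and c: "\<And>i j. i < n \<Longrightarrow> j < n \<Longrightarrow> \<bar>real_of_int (A $$ (i, j))\<bar> \<le> c"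
  shows "\<bar>real_of_int (det A)\<bar> \<le> fact n * c ^ n"
proof -
  let ?P = "{\<pi>. \<pi> permutes {0..<n}}"
  have fin: "finite ?P" by (rule finite_permutations) simp
  have "\<bar>real_of_int (det A)\<bar> = \<bar>\<Sum>\<pi>\<in>?P. real_of_int (signof \<pi> * (\<Prod>i = 0..<n. A $$ (i, \<pi> i)))\<bar>"
    by (simp add: det_def'[OF A])
  also have "\<dots> \<le> (\<Sum>\<pi>\<in>?P. \<bar>real_of_int (signof \<pi> * (\<Prod>i = 0..<n. A $$ (i, \<pi> i)))\<bar>)" by (rule sum_abs)
  also have "\<dots> \<le> (\<Sum>\<pi>\<in>?P. c ^ n)"
  proof (rule sum_mono)
    fix \<pi> assume "\<pi> \<in> ?P"
    then have pi: "\<pi> i < n" if "i < n" for i using that permutes_in_image[of \<pi> "{0..<n}" i] by auto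
    have "\<bar>real_of_int (signof \<pi> * (\<Prod>i = 0..<n. A $$ (i, \<pi> i)))\<bar> = (\<Prod>i = 0..<n. \<bar>real_of_int (A $$ (i, \<pi> i))\<bar>)"
      by (simp add: abs_mult abs_prod sign_def)
    also have "\<dots> \<le> (\<Prod>i = 0..<n. c)" by (intro prod_mono) (use c pi in auto)
    finally show "\<bar>real_of_int (signof \<pi> * (\<Prod>i = 0..<n. A $$ (i, \<pi> i)))\<bar> \<le> c ^ n" by simp
  qed
  also have "\<dots> = fact n * c ^ n" by (simp add: card_permutations[of _ n])
  finally show ?thesis .
qed

lemma sum_set_nth:
  assumes "distinct b"
  shows "(\<Sum>x\<in>set b. g x) = (\<Sum>i<length b. g (b ! i))"
  by (rule sum.reindex_bij_betw[symmetric, OF bij_betw_nth]) (use assms in auto)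

section \<open>Norm forms\<close>

lemma ex_ordered_basis:
  assumes "number_field K"
  shows "ordered_basis K (SOME b. ordered_basis K b)"
proof (rule someI_ex)
  obtain B where B: "finite B" "rat_vs.span B = K" using assms by (auto simp: number_field_def)
  obtain S where S: "S \<subseteq> B" "rat_vs.independent S" "B \<subseteq> rat_vs.span S"
    by (rule rat_vs.maximal_independent_subset)
  have "rat_vs.span S = K"
    using S B(2) by (metis rat_vs.span_mono rat_vs.span_span subset_antisym)
  moreover obtain b where "set b = S" "distinct b" using S(1) B(1) finite_subset finite_distinct_list by metis
  ultimately show "\<exists>b. ordered_basis K b" using S by (auto simp: ordered_basis_def)
qed

text \<open>Elements that are independent over the integers are independent over the rationals, after clearing
denominators.  Thus the rank condition provides \<open>r\<close> independent elements in a field of degree \<open>r\<close>.\<close>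

lemma norm_form_span:
  fixes K :: "'a::field_char_0 set" and \<omega> :: "nat \<Rightarrow> 'a"
  assumes K: "number_field K" and deg: "field_degree K = r" and \<omega>: "\<omega> ` {1..r} \<subseteq> K"
    and rank: "Z_rank (int_mod.span (\<omega> ` {1..r})) = enat r"
  shows "K \<subseteq> rat_vs.span (\<omega> ` {1..r})"
proof -
  let ?W = "\<omega> ` {1..r}"
  obtain b where b: "distinct b" "rat_vs.independent (set b)" "rat_vs.span (set b) = K"
    using ex_ordered_basis[OF K] by (auto simp: ordered_basis_def)
  have dim: "card (set b) = r"
    using deg rat_vs.dim_span_eq_card_independent[OF b(2)] b(3) by (simp add: field_degree_def)
  have sub: "int_mod.span ?W \<subseteq> rat_vs.span ?W"
  proof
    fix y assume "y \<in> int_mod.span ?W"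
    then show "y \<in> rat_vs.span ?W"
    proof (induction rule: int_mod.span_induct_alt)
      case base then show ?case by (simp add: rat_vs.span_zero)
    next
      case (step c s y)
      have "of_int c * s = of_rat (of_int c) * s" by simp
      then show ?case using step by (metis rat_vs.span_add rat_vs.span_base rat_vs.span_scale)
    qed
  qed
  obtain B where B: "B \<subseteq> int_mod.span ?W" "finite B" "int_mod.independent B" "card B \<ge> r"
  proof (cases "r = 0")
    case True
    then show ?thesis using that[of "{}"] int_mod.independent_empty by auto
  next
    case False
    show ?thesis
    proof (rule ccontr)
      assume no: "\<not> thesis"
      have "Z_rank (int_mod.span ?W) \<le> enat (r - 1)"
        unfolding Z_rank_def
      proof (rule SUP_least)
        fix B assume "B \<in> {B. B \<subseteq> int_mod.span ?W \<and> finite B \<and> int_mod.independent B}"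
        then have "\<not> card B \<ge> r" using no that by blast
        then show "enat (card B) \<le> enat (r - 1)" by simp
      qed
      then show False using rank False by simp
    qed
  qed
  have indep: "rat_vs.independent B"
  proof
    assume "rat_vs.dependent B"
    then obtain u where u: "\<exists>v\<in>B. u v \<noteq> 0" "(\<Sum>v\<in>B. of_rat (u v) * v) = 0"
      using rat_vs.dependent_finite[OF B(2)] by auto
    obtain e where e: "(e::int) > 0" "\<And>v. v \<in> B \<Longrightarrow> \<exists>z. of_int z = of_int e * u v"
      using common_denominator[OF B(2), of u] by blast
    obtain z where z: "\<And>v. v \<in> B \<Longrightarrow> of_int (z v) = of_int e * u v" using e(2) by metis
    have zz: "of_int (z v) = of_int e * (of_rat (u v) :: 'a)" if "v \<in> B" for v
    proof -
      have "(of_rat (of_int (z v)) :: 'a) = of_rat (of_int e * u v)" using z[OF that] by simp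
      then show ?thesis by (simp add: of_rat_mult)
    qed
    have "(\<Sum>v\<in>B. of_int (z v) * v) = of_int e * (\<Sum>v\<in>B. of_rat (u v) * v)"
      by (simp add: sum_distrib_left zz mult.assoc)
    then have "(\<Sum>v\<in>B. of_int (z v) * v) = 0" using u by simp
    moreover obtain v where v: "v \<in> B" "u v \<noteq> 0" using u by blast
    then have "z v \<noteq> 0" using z[OF v(1)] e(1) by auto
    ultimately have "int_mod.dependent B"
      using v(1) B(2) unfolding int_mod.dependent_explicit by blast
    then show False using B(3) by simp
  qed
  have K_span: "rat_vs.span ?W \<subseteq> K"
  proof (rule rat_vs.span_minimal[OF \<omega>])
    show "rat_vs.subspace K" unfolding b(3)[symmetric] by (rule rat_vs.subspace_span)
  qed
  have "K \<subseteq> rat_vs.span B"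
  proof
    fix y assume y: "y \<in> K"
    show "y \<in> rat_vs.span B"
    proof (rule ccontr)
      assume n: "y \<notin> rat_vs.span B"
      then have "rat_vs.independent (insert y B)" using indep by (simp add: rat_vs.independent_insertI)
      moreover have "insert y B \<subseteq> rat_vs.span (set b)" using y B(1) sub K_span b(3) by auto
      ultimately have "card (insert y B) \<le> card (set b)"
        using rat_vs.independent_span_bound[of "set b" "insert y B"] by simp
      moreover have "y \<notin> B" using n rat_vs.span_base by blast
      ultimately show False using B(2,4) dim by simp
    qed
  qed
  also have "rat_vs.span B \<subseteq> rat_vs.span ?W"
    by (rule rat_vs.span_minimal[OF order_trans[OF B(1) sub] rat_vs.subspace_span])
  finally show ?thesis .
qed

text \<open>The multiplication matrix of a combination of the generators is the same combination of the matrices of the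
generators.  The integer \<open>\<Delta>\<close> is a common denominator of the entries of the latter.\<close>

lemma norm_form_integral_matrix:
  fixes K :: "'a::field_char_0 set"
  assumes K: "number_field K" and deg: "field_degree K = r" and F: "is_norm_form K F"
  obtains \<omega> :: "nat \<Rightarrow> 'a" and b :: "nat \<Rightarrow> 'a" and \<Delta> :: int and M :: "nat \<Rightarrow> nat \<Rightarrow> nat \<Rightarrow> int"
  where "\<And>k. k \<in> {1..r} \<Longrightarrow> \<omega> k \<in> K" "K \<subseteq> rat_vs.span (\<omega> ` {1..r})"
    "\<And>i. i < r \<Longrightarrow> b i \<in> K \<and> b i \<noteq> 0" "\<Delta> > 0"
    "\<And>k j. k \<in> {1..r} \<Longrightarrow> j < r \<Longrightarrow> of_int \<Delta> * (\<omega> k * b j) = (\<Sum>i<r. of_int (M k i j) * b i)"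
    "\<And>x. det (mat r r (\<lambda>(i, j). \<Sum>k=1..r. x k * M k i j)) = \<Delta> ^ r * mpoly_eval F x"
proof -
  obtain \<omega> :: "nat \<Rightarrow> 'a" where om: "\<forall>i\<in>{1..r}. \<omega> i \<in> ring_of_integers K"
      "Z_rank (int_mod.span (\<omega> ` {1..r})) = enat r"
      "\<forall>x :: nat \<Rightarrow> int. of_int (mpoly_eval F x) = field_norm K (\<Sum>i=1..r. of_int (x i) * \<omega> i)"
    using F deg unfolding is_norm_form_def Let_def by auto
  have omK: "\<omega> k \<in> K" if "k \<in> {1..r}" for k using om(1) that by (simp add: ring_of_integers_def)
  have sf: "is_subfield K" using K by (simp add: number_field_def)
  define b where "b = (SOME b. ordered_basis K b)"
  have b: "distinct b" "rat_vs.independent (set b)" "rat_vs.span (set b) = K"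
    using ex_ordered_basis[OF K, folded b_def] unfolding ordered_basis_def by blast+
  have len: "length b = r"
    using deg rat_vs.dim_span_eq_card_independent[OF b(2)] b(3) distinct_card[OF b(1)] by (simp add: field_degree_def)
  have bK: "b ! i \<in> K" if "i < r" for i using that len b(3) rat_vs.span_base[of "b ! i" "set b"] by simp
  have b0: "b ! i \<noteq> 0" if "i < r" for i
    using that len b(2) rat_vs.dependent_zero[of "set b"] by (metis nth_mem)
  define R where "R k i j = rat_vs.representation (set b) (\<omega> k * b ! j) (b ! i)" for k i j
  have prodK: "\<omega> k * b ! j \<in> K" if "k \<in> {1..r}" "j < r" for k j
    using subfieldD(3)[OF sf] omK bK that by blast
  have expand: "\<omega> k * b ! j = (\<Sum>i<r. of_rat (R k i j) * b ! i)" if "k \<in> {1..r}" "j < r" for k j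
  proof -
    have "(\<Sum>x\<in>set b. of_rat (rat_vs.representation (set b) (\<omega> k * b ! j) x) * x) = \<omega> k * b ! j"
      using prodK[OF that] by (intro rat_vs.sum_representation_eq) (use b in auto)
    then show ?thesis unfolding sum_set_nth[OF b(1)] R_def len by simp
  qed
  obtain \<Delta> where D: "(\<Delta>::int) > 0"
      "\<And>t. t \<in> {1..r} \<times> {..<r} \<times> {..<r} \<Longrightarrow> \<exists>z. of_int z = of_int \<Delta> * (case t of (k, i, j) \<Rightarrow> R k i j)"
    by (rule common_denominator[of "{1..r} \<times> {..<r} \<times> {..<r}" "\<lambda>(k, i, j). R k i j"]) auto
  have "\<exists>z. of_int z = of_int \<Delta> * R k i j" if "k \<in> {1..r}" "i < r" "j < r" for k i j
    using D(2)[of "(k, i, j)"] that by simp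
  then obtain M where M: "\<And>k i j. k \<in> {1..r} \<Longrightarrow> i < r \<Longrightarrow> j < r \<Longrightarrow> of_int (M k i j) = of_int \<Delta> * R k i j"
    by metis
  have MR: "of_int (M k i j) = of_int \<Delta> * (of_rat (R k i j) :: 'a)" if "k \<in> {1..r}" "i < r" "j < r" for k i j
  proof -
    have "(of_rat (of_int (M k i j)) :: 'a) = of_rat (of_int \<Delta> * R k i j)" using M[OF that] by simp
    then show ?thesis by (simp add: of_rat_mult)
  qed
  show thesis
  proof (rule that[of \<omega> "\<lambda>i. b ! i" \<Delta> M])
    show "\<omega> k \<in> K" if "k \<in> {1..r}" for k by (rule omK[OF that])
    show "K \<subseteq> rat_vs.span (\<omega> ` {1..r})"
      by (rule norm_form_span[OF K deg _ om(2)]) (use omK in blast)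
    show "b ! i \<in> K \<and> b ! i \<noteq> 0" if "i < r" for i using bK b0 that by blast
    show "\<Delta> > 0" by (rule D(1))
    show "of_int \<Delta> * (\<omega> k * b ! j) = (\<Sum>i<r. of_int (M k i j) * b ! i)" if kj: "k \<in> {1..r}" "j < r" for k j
      unfolding expand[OF kj] using MR kj by (simp add: sum_distrib_left mult.assoc)
    fix x :: "nat \<Rightarrow> int"
    let ?A = "mat r r (\<lambda>(i, j). \<Sum>k=1..r. x k * M k i j)"
    let ?y = "\<Sum>k=1..r. of_int (x k) * \<omega> k"
    have entry: "of_int (\<Sum>k=1..r. x k * M k i j) = of_int \<Delta> * rat_vs.representation (set b) (?y * b ! j) (b ! i)"
      if ij: "i < r" "j < r" for i j
    proof -
      have sp: "\<omega> k * b ! j \<in> rat_vs.span (set b)" if "k \<in> {1..r}" for k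
        using prodK[OF that ij(2)] b(3) by simp
      have "?y * b ! j = (\<Sum>k=1..r. of_rat (of_int (x k)) * (\<omega> k * b ! j))"
        by (simp add: sum_distrib_right mult.assoc)
      then have "rat_vs.representation (set b) (?y * b ! j) = (\<lambda>v. \<Sum>k=1..r. rat_vs.representation (set b) (of_rat (of_int (x k)) * (\<omega> k * b ! j)) v)"
        by (simp only:) (rule rat_vs.representation_sum[OF b(2)], rule rat_vs.span_scale, rule sp)
      also have "\<dots> = (\<lambda>v. \<Sum>k=1..r. of_int (x k) * rat_vs.representation (set b) (\<omega> k * b ! j) v)"
        by (intro ext sum.cong refl) (simp only: rat_vs.representation_scale[OF b(2) sp])
      finally have "rat_vs.representation (set b) (?y * b ! j) (b ! i) = (\<Sum>k=1..r. of_int (x k) * R k i j)"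
        by (simp add: R_def)
      then show ?thesis using M ij by (simp add: sum_distrib_left mult.left_commute)
    qed
    have "map_mat rat_of_int ?A = of_int \<Delta> \<cdot>\<^sub>m mult_matrix b ?y"
      by (rule eq_matI) (simp_all add: mult_matrix_def len entry del: of_int_sum of_int_mult One_nat_def)
    then have "det (map_mat rat_of_int ?A) = of_int \<Delta> ^ r * det (mult_matrix b ?y)"
      by (simp add: det_smult mult_matrix_def len)
    also have "det (mult_matrix b ?y) = of_int (mpoly_eval F x)"
      using om(3) by (simp add: field_norm_def b_def)
    also have "det (map_mat rat_of_int ?A) = of_int (det ?A)" by (rule of_int_hom.hom_det)
    finally have "rat_of_int (det ?A) = rat_of_int (\<Delta> ^ r * mpoly_eval F x)" by simp
    then show "det ?A = \<Delta> ^ r * mpoly_eval F x" by (simp only: of_int_eq_iff)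
  qed
qed

lemma rat_embedding_of_int: "rat_embedding K \<tau> \<Longrightarrow> \<tau> (of_int n) = of_int n"
  unfolding rat_embedding_def by (metis of_rat_of_int_eq)

lemma rat_embedding_sum:
  assumes "rat_embedding K \<tau>" "is_subfield K" "\<And>i. i \<in> I \<Longrightarrow> f i \<in> K"
  shows "\<tau> (\<Sum>i\<in>I. f i) = (\<Sum>i\<in>I. \<tau> (f i)) \<and> (\<Sum>i\<in>I. f i) \<in> K"
  using assms(3)
proof (induction I rule: infinite_finite_induct)
  case (insert j I)
  then show ?case using assms(1) subfieldD(5)[OF assms(2)] by (auto simp: rat_embedding_def)
qed (use rat_embedding_of_int[OF assms(1), of 0] subfieldD(2)[OF assms(2)] in auto)

lemma rat_embedding_nonzero:
  assumes "rat_embedding K \<tau>" "is_subfield K" "x \<in> K" "x \<noteq> 0"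
  shows "\<tau> x \<noteq> 0"
proof
  assume "\<tau> x = 0"
  have "inverse x \<in> K" using assms(2,3) by (simp add: is_subfield_def)
  then have "\<tau> (x * inverse x) = \<tau> x * \<tau> (inverse x)" using assms(1,3) by (simp add: rat_embedding_def)
  then have "\<tau> (of_int 1) = 0" using assms(4) \<open>\<tau> x = 0\<close> by simp
  then show False using rat_embedding_of_int[OF assms(1), of 1] by simp
qed

text \<open>The images of the basis under \<open>\<tau>\<close> form a left eigenvector of the multiplication matrix of any \<open>y\<close> in the
field, with eigenvalue \<open>\<tau> y\<close>.  Up to denominators these are integer polynomials in \<open>\<eta>\<close>, so by substituting a
root \<open>n\<close> of \<open>h\<close> modulo \<open>p\<close> the relation persists modulo \<open>p\<close>.  On the hyperplane where the reduced
eigenvalue vanishes, the matrix has a nonzero left kernel vector modulo \<open>p\<close>, and its determinant, which is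
the norm up to a power of \<open>\<Delta>\<close>, is divisible by \<open>p\<close>.\<close>

lemma embedding_gives_hyperplane:
  fixes K :: "'a::field_char_0 set" and \<tau> :: "'a \<Rightarrow> 'b::field_char_0"
  assumes K: "number_field K" and r: "r \<ge> 1" and emb: "rat_embedding K \<tau>"
    and adj: "\<And>y. y \<in> K \<Longrightarrow> \<tau> y \<in> rat_adjoin \<eta>"
    and omK: "\<And>k. k \<in> {1..r} \<Longrightarrow> \<omega> k \<in> K"
    and bK: "\<And>i. i < r \<Longrightarrow> b i \<in> K \<and> b i \<noteq> 0" and D: "(\<Delta>::int) > 0"
    and struct: "\<And>k j. k \<in> {1..r} \<Longrightarrow> j < r \<Longrightarrow> of_int \<Delta> * (\<omega> k * b j) = (\<Sum>i<r. of_int (M k i j) * b i)"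
    and det: "\<And>x. det (mat r r (\<lambda>(i, j). \<Sum>k=1..r. x k * M k i j)) = \<Delta> ^ r * Fn x"
    and fin: "\<And>P. finite (bad_primes h \<eta> P)"
  obtains W e E where "(e::int) > 0" "\<And>k. k \<in> {1..r} \<Longrightarrow> ieval (W k) \<eta> = of_int e * \<tau> (\<omega> k)" "finite E"
    "\<And>p n x. prime p \<Longrightarrow> p \<notin> E \<Longrightarrow> p dvd poly h n \<Longrightarrow> on_hyperplane {1..r} (\<lambda>k. poly (W k) n) 0 p x \<Longrightarrow> p dvd Fn x"
proof -
  have sf: "is_subfield K" using K by (simp add: number_field_def)
  obtain e P where e: "(e::int) > 0" "\<And>t. t \<in> {1..r} <+> {..<r} \<Longrightarrow> ieval (P t) \<eta> = of_int e * (case t of Inl k \<Rightarrow> \<tau> (\<omega> k) | Inr i \<Rightarrow> \<tau> (b i))"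
    by (rule common_denominator_rat_adjoin[of "{1..r} <+> {..<r}" "\<lambda>t. case t of Inl k \<Rightarrow> \<tau> (\<omega> k) | Inr i \<Rightarrow> \<tau> (b i)" \<eta>])
       (use omK bK adj in auto)
  define W where "W k = P (Inl k)" for k
  define V where "V i = P (Inr i)" for i
  have W: "ieval (W k) \<eta> = of_int e * \<tau> (\<omega> k)" if "k \<in> {1..r}" for k
    using e(2)[OF InlI[OF that]] by (simp add: W_def)
  have V: "ieval (V i) \<eta> = of_int e * \<tau> (b i)" if "i < r" for i
    using e(2)[OF InrI, of i] that by (simp add: V_def)
  \<comment> \<open>The eigenvector relation: entry \<open>j\<close> of the vector times the matrix of \<open>\<omega> k\<close>, minus eigenvalue times entry \<open>j\<close>.\<close>
  define R where "R k j = smult e (\<Sum>i<r. smult (M k i j) (V i)) - smult \<Delta> (W k * V j)" for k j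
  have R: "ieval (R k j) \<eta> = 0" if kj: "k \<in> {1..r}" "j < r" for k j
  proof -
    have intK: "of_int z \<in> K" for z
      using of_rat_in_number_field[OF K, of "of_int z"] by simp
    have mK: "of_int (M k i j) * b i \<in> K" if "i \<in> {..<r}" for i
      using subfieldD(3)[OF sf intK] bK that by simp
    have "\<tau> (of_int \<Delta> * (\<omega> k * b j)) = of_int \<Delta> * (\<tau> (\<omega> k) * \<tau> (b j))"
      using emb intK omK[OF kj(1)] bK[OF kj(2)] subfieldD(3)[OF sf] rat_embedding_of_int[OF emb]
      by (simp add: rat_embedding_def)
    moreover have "\<tau> (\<Sum>i<r. of_int (M k i j) * b i) = (\<Sum>i<r. \<tau> (of_int (M k i j) * b i))"
      by (rule conjunct1[OF rat_embedding_sum[OF emb sf mK]])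
    moreover have "(\<Sum>i<r. \<tau> (of_int (M k i j) * b i)) = (\<Sum>i<r. of_int (M k i j) * \<tau> (b i))"
      using emb intK bK rat_embedding_of_int[OF emb] by (intro sum.cong refl) (simp add: rat_embedding_def)
    ultimately have s: "of_int \<Delta> * (\<tau> (\<omega> k) * \<tau> (b j)) = (\<Sum>i<r. of_int (M k i j) * \<tau> (b i))"
      using struct[OF kj] by simp
    have "ieval (R k j) \<eta> = of_int e * (\<Sum>i<r. of_int (M k i j) * (of_int e * \<tau> (b i))) - of_int \<Delta> * ((of_int e * \<tau> (\<omega> k)) * (of_int e * \<tau> (b j)))"
      using W[OF kj(1)] V kj(2) by (simp add: R_def ieval_sum)
    also have "(\<Sum>i<r. of_int (M k i j) * (of_int e * \<tau> (b i))) = of_int e * (\<Sum>i<r. of_int (M k i j) * \<tau> (b i))"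
      by (simp add: sum_distrib_left mult.left_commute)
    finally show ?thesis by (simp only: s[symmetric]) (simp only: mult_ac diff_self)
  qed
  define E where "E = (\<Union>(k, j)\<in>{1..r} \<times> {..<r}. bad_primes h \<eta> (R k j)) \<union> bad_primes h \<eta> (V 0)
     \<union> {p. prime p \<and> p dvd e} \<union> {p. prime p \<and> p dvd \<Delta>}"
  have finE: "finite E" unfolding E_def using fin D e(1) by (auto intro!: finite_prime_divisors_int)
  show thesis
  proof (rule that[OF e(1) W finE])
    fix p n x assume p: "prime p" and pE: "p \<notin> E" and pn: "p dvd poly h n"
      and hyp: "on_hyperplane {1..r} (\<lambda>k. poly (W k) n) 0 p x"
    have pR: "p dvd poly (R k j) n" if "k \<in> {1..r}" "j < r" for k j
    proof -
      have "p \<notin> bad_primes h \<eta> (R k j)" using pE that unfolding E_def by blast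
      then show ?thesis using p pn R[OF that] by (auto simp: bad_primes_def)
    qed
    have pV: "\<not> p dvd poly (V 0) n"
    proof -
      have "p \<notin> bad_primes h \<eta> (V 0)" using pE unfolding E_def by blast
      moreover have "ieval (V 0) \<eta> \<noteq> 0"
        using V[of 0] r e(1) rat_embedding_nonzero[OF emb sf] bK[of 0] by simp
      ultimately show ?thesis using p pn by (auto simp: bad_primes_def)
    qed
    have pe: "\<not> p dvd e" and pD: "\<not> p dvd \<Delta>" using pE p unfolding E_def by blast+
    let ?A = "mat r r (\<lambda>(i, j). \<Sum>k=1..r. x k * M k i j)"
    have wx: "p dvd (\<Sum>k\<in>{1..r}. poly (W k) n * x k)" using hyp by (simp add: on_hyperplane_def)
    have "p dvd det ?A"
    proof (rule left_kernel_dvd_det[where n = r and v = "\<lambda>i. poly (V i) n" and l = 0, OF _ p _ pV])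
      show "?A \<in> carrier_mat r r" by simp
      show "0 < r" using r by simp
      fix j assume j: "j < r"
      have "e * (\<Sum>i<r. poly (V i) n * ?A $$ (i, j)) = (\<Sum>k=1..r. x k * (e * (\<Sum>i<r. M k i j * poly (V i) n)))"
      proof -
        have "(\<Sum>i<r. poly (V i) n * ?A $$ (i, j)) = (\<Sum>i<r. \<Sum>k=1..r. x k * (M k i j * poly (V i) n))"
          using j by (intro sum.cong refl) (simp add: sum_distrib_left mult_ac)
        also have "\<dots> = (\<Sum>k=1..r. \<Sum>i<r. x k * (M k i j * poly (V i) n))" by (rule sum.swap)
        finally show ?thesis by (simp add: sum_distrib_left mult_ac)
      qed
      also have "\<dots> = (\<Sum>k=1..r. x k * (poly (R k j) n + \<Delta> * (poly (W k) n * poly (V j) n)))"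
        by (intro sum.cong refl) (simp add: R_def poly_sum)
      also have "\<dots> = (\<Sum>k=1..r. x k * poly (R k j) n) + \<Delta> * poly (V j) n * (\<Sum>k=1..r. poly (W k) n * x k)"
        by (simp add: distrib_left sum.distrib sum_distrib_left mult_ac)
      finally have eq: "e * (\<Sum>i<r. poly (V i) n * ?A $$ (i, j)) = (\<Sum>k=1..r. x k * poly (R k j) n) + \<Delta> * poly (V j) n * (\<Sum>k=1..r. poly (W k) n * x k)" .
      have "p dvd (\<Sum>k=1..r. x k * poly (R k j) n)"
        by (rule dvd_sum, rule dvd_mult, rule pR) (use j in auto)
      then have "p dvd e * (\<Sum>i<r. poly (V i) n * ?A $$ (i, j))"
        unfolding eq using wx by (intro dvd_add dvd_mult)
      then show "p dvd (\<Sum>i<r. poly (V i) n * ?A $$ (i, j))" using p pe by (simp add: prime_dvd_mult_iff)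
    qed
    then have "p dvd \<Delta> ^ r * Fn x" by (simp only: det)
    then show "p dvd Fn x" using p pD by (auto simp: prime_dvd_mult_iff dest: prime_dvd_power)
  qed
qed

text \<open>The inclusion and the embedding \<open>\<sigma>\<close> provide one hyperplane each.  Some pair of generators has a ratio on
which the two embeddings differ: otherwise the values of \<open>\<sigma>\<close> and of the inclusion would be proportional
on the whole field, hence equal, as both take the value 1 at 1.  For such a pair the conditions for
transversality hold at \<open>\<eta>\<close>, and they persist modulo all but finitely many primes.\<close>

lemma norm_form_hyperplanes:
  fixes K :: "'a::field_char_0 set"
  assumes K: "number_field K" and deg: "field_degree K = r" and r: "r \<ge> 2" and F: "is_norm_form K F"
  obtains h :: "int poly" and E :: "int set" and k l :: nat
  where "degree h \<ge> 1" "finite E" "k \<in> {1..r}" "l \<in> {1..r}" "k \<noteq> l"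
    "\<And>p n. prime p \<Longrightarrow> p \<notin> E \<Longrightarrow> p dvd poly h n \<Longrightarrow> \<not> p dvd poly (pderiv h) n"
    "\<And>p n. prime p \<Longrightarrow> p \<notin> E \<Longrightarrow> p dvd poly h n \<Longrightarrow> \<exists>w w'. transversal p k l w w' \<and>
        (\<forall>x. on_hyperplane {1..r} w 0 p x \<or> on_hyperplane {1..r} w' 0 p x \<longrightarrow> p dvd mpoly_eval F x)"
proof -
  obtain \<omega> b \<Delta> M where nf: "\<And>k. k \<in> {1..r} \<Longrightarrow> \<omega> k \<in> K" "K \<subseteq> rat_vs.span (\<omega> ` {1..r})"
    "\<And>i. i < r \<Longrightarrow> b i \<in> K \<and> b i \<noteq> 0" "(\<Delta>::int) > 0"
    "\<And>k j. k \<in> {1..r} \<Longrightarrow> j < r \<Longrightarrow> of_int \<Delta> * (\<omega> k * b j) = (\<Sum>i<r. of_int (M k i j) * b i)"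
    "\<And>x. det (mat r r (\<lambda>(i, j). \<Sum>k=1..r. x k * M k i j)) = \<Delta> ^ r * mpoly_eval F x"
    by (rule norm_form_integral_matrix[OF K deg F]) blast
  obtain \<sigma> :: "'a \<Rightarrow> 'a alg_closure" and \<theta> \<eta> where s: "rat_embedding K \<sigma>" "\<theta> \<in> K" "\<sigma> \<theta> \<noteq> to_ac \<theta>" "algebraic_over_rat \<eta>"
    "\<And>y. y \<in> K \<Longrightarrow> \<sigma> y \<in> rat_adjoin \<eta> \<and> to_ac y \<in> rat_adjoin \<eta>"
    using ex_two_embeddings[OF K] deg r by blast
  have sf: "is_subfield K" using K by (simp add: number_field_def)
  let ?\<tau> = "to_ac :: 'a \<Rightarrow> 'a alg_closure"
  have t: "rat_embedding K ?\<tau>" by (simp add: rat_embedding_def)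
  obtain h where h: "degree h \<ge> 1" "ieval (pderiv h) \<eta> \<noteq> 0" "\<And>P. finite (bad_primes h \<eta> P)"
    using ex_reduction_poly[OF s(4)] by blast
  have r1: "r \<ge> 1" using r by simp
  obtain W e E where W: "(e::int) > 0" "\<And>k. k \<in> {1..r} \<Longrightarrow> ieval (W k) \<eta> = of_int e * \<sigma> (\<omega> k)" "finite E"
    "\<And>p n x. prime p \<Longrightarrow> p \<notin> E \<Longrightarrow> p dvd poly h n \<Longrightarrow> on_hyperplane {1..r} (\<lambda>k. poly (W k) n) 0 p x \<Longrightarrow> p dvd mpoly_eval F x"
    by (rule embedding_gives_hyperplane[OF K r1 s(1) _ nf(1) nf(3) nf(4) nf(5) nf(6) h(3)]) (use s(5) in blast)+
  obtain W' e' E' where W': "(e'::int) > 0" "\<And>k. k \<in> {1..r} \<Longrightarrow> ieval (W' k) \<eta> = of_int e' * to_ac (\<omega> k)" "finite E'"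
    "\<And>p n x. prime p \<Longrightarrow> p \<notin> E' \<Longrightarrow> p dvd poly h n \<Longrightarrow> on_hyperplane {1..r} (\<lambda>k. poly (W' k) n) 0 p x \<Longrightarrow> p dvd mpoly_eval F x"
    by (rule embedding_gives_hyperplane[OF K r1 t _ nf(1) nf(3) nf(4) nf(5) nf(6) h(3)]) (use s(5) in blast)+
  \<comment> \<open>The two embeddings differ on the ratio of some pair of generators.\<close>
  have "\<exists>k\<in>{1..r}. \<exists>l\<in>{1..r}. \<sigma> (\<omega> k) * to_ac (\<omega> l) \<noteq> to_ac (\<omega> k) * \<sigma> (\<omega> l)"
  proof (rule ccontr)
    assume "\<not> ?thesis"
    then have eq: "\<sigma> x * to_ac y = to_ac x * \<sigma> y" if "x \<in> \<omega> ` {1..r}" "y \<in> \<omega> ` {1..r}" for x y using that by blast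
    have sub: "\<omega> ` {1..r} \<subseteq> K" using nf(1) by blast
    have sp: "rat_vs.span (\<omega> ` {1..r}) = K"
    proof
      show "rat_vs.span (\<omega> ` {1..r}) \<subseteq> K"
      proof (rule rat_vs.span_minimal[OF sub])
        show "rat_vs.subspace K"
          by (rule rat_vs.subspaceI)
             (auto intro: subfieldD(2,5)[OF sf] subfieldD(3)[OF sf of_rat_in_number_field[OF K]])
      qed
    qed (rule nf(2))
    have ext: "\<sigma> x * to_ac y = to_ac x * \<sigma> y" 
      if gen: "\<And>x. x \<in> \<omega> ` {1..r} \<Longrightarrow> \<sigma> x * to_ac y = to_ac x * \<sigma> y" and x: "x \<in> K" for x y
    proof -
      have "x \<in> rat_vs.span (\<omega> ` {1..r})" using x sp by simp
      then have "x \<in> K \<and> \<sigma> x * to_ac y = to_ac x * \<sigma> y"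
      proof (induction rule: rat_vs.span_induct_alt)
        case base
        then show ?case using subfieldD(2)[OF sf] rat_embedding_of_int[OF s(1), of 0] by simp
      next
        case (step c g z)
        have gK: "g \<in> K" using step(1) sub by blast
        have cK: "of_rat c \<in> K" by (rule of_rat_in_number_field[OF K])
        have cgK: "of_rat c * g \<in> K" by (rule subfieldD(3)[OF sf cK gK])
        have "\<sigma> (of_rat c * g + z) = of_rat c * \<sigma> g + \<sigma> z"
          using s(1) cK gK cgK step(2) by (simp add: rat_embedding_def)
        then have "\<sigma> (of_rat c * g + z) * to_ac y = of_rat c * (\<sigma> g * to_ac y) + \<sigma> z * to_ac y"
          by (simp add: algebra_simps)
        also have "\<dots> = to_ac (of_rat c * g + z) * \<sigma> y"
          using gen[OF step(1)] step(2) by (simp add: algebra_simps)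
        finally show ?case using subfieldD(5)[OF sf cgK] step(2) by blast
      qed
      then show ?thesis by blast
    qed
    have 1: "\<sigma> x * to_ac y = to_ac x * \<sigma> y" if "x \<in> K" "y \<in> \<omega> ` {1..r}" for x y
      by (rule ext[OF eq[OF _ that(2)] that(1)])
    have 2: "\<sigma> y * to_ac x = to_ac y * \<sigma> x" if "x \<in> K" "y \<in> \<omega> ` {1..r}" for x y
      using 1[OF that] by (simp add: mult.commute)
    have "\<sigma> \<theta> * to_ac 1 = to_ac \<theta> * \<sigma> 1"
      by (rule ext[OF 2[OF subfieldD(1)[OF sf]] s(2)])
    moreover have "\<sigma> 1 = 1" using rat_embedding_of_int[OF s(1), of 1] by simp
    ultimately show False using s(3) by simp
  qed
  then obtain k l where kl: "k \<in> {1..r}" "l \<in> {1..r}" "\<sigma> (\<omega> k) * to_ac (\<omega> l) \<noteq> to_ac (\<omega> k) * \<sigma> (\<omega> l)" by blast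
  have nz: "\<omega> k \<noteq> 0" "\<omega> l \<noteq> 0"
    using kl(3) rat_embedding_of_int[OF s(1), of 0] by auto
  have nzs: "\<sigma> (\<omega> k) \<noteq> 0" "\<sigma> (\<omega> l) \<noteq> 0"
    using rat_embedding_nonzero[OF s(1) sf] nf(1) kl nz by blast+
  define Ps where "Ps = {pderiv h, W k, W l, W' k, W' l, W k * W' l - W' k * W l}"
  have Ps: "ieval P \<eta> \<noteq> 0" if "P \<in> Ps" for P
  proof -
    have "ieval (W k * W' l - W' k * W l) \<eta> = of_int (e * e') * (\<sigma> (\<omega> k) * to_ac (\<omega> l) - to_ac (\<omega> k) * \<sigma> (\<omega> l))"
      by (simp only: ieval_simps W(2)[OF kl(1)] W(2)[OF kl(2)] W'(2)[OF kl(1)] W'(2)[OF kl(2)] of_int_mult right_diff_distrib mult_ac)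
    then have "ieval (W k * W' l - W' k * W l) \<eta> \<noteq> 0" using kl(3) W(1) W'(1) by simp
    moreover have "ieval (W k) \<eta> \<noteq> 0" "ieval (W l) \<eta> \<noteq> 0" "ieval (W' k) \<eta> \<noteq> 0" "ieval (W' l) \<eta> \<noteq> 0"
      using W(1) W'(1) nz nzs W(2)[OF kl(1)] W(2)[OF kl(2)] W'(2)[OF kl(1)] W'(2)[OF kl(2)] by simp_all
    ultimately show ?thesis using that h(2) unfolding Ps_def by (elim insertE emptyE) (simp_all only: simp_thms)
  qed
  define E0 where "E0 = E \<union> E' \<union> (\<Union>P\<in>Ps. bad_primes h \<eta> P)"
  have nd: "\<not> p dvd poly P n" if "prime p" "p \<notin> E0" "p dvd poly h n" "P \<in> Ps" for p n P
    using that Ps[OF that(4)] unfolding E0_def bad_primes_def by blast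
  show thesis
  proof (rule that[of h E0 k l])
    show "finite E0" unfolding E0_def Ps_def using W(3) W'(3) h(3) by simp
    show "k \<noteq> l" using kl(3) by (auto simp: mult.commute)
    fix p n assume p: "prime p" "p \<notin> E0" "p dvd poly h n"
    show "\<not> p dvd poly (pderiv h) n" using nd[OF p] by (simp add: Ps_def)
    have "transversal p k l (\<lambda>k. poly (W k) n) (\<lambda>k. poly (W' k) n)"
      unfolding transversal_def using nd[OF p, of "W k"] nd[OF p, of "W l"] nd[OF p, of "W' k"] nd[OF p, of "W' l"]
        nd[OF p, of "W k * W' l - W' k * W l"] by (simp add: Ps_def)
    moreover have "p \<notin> E" "p \<notin> E'" using p(2) by (auto simp: E0_def)
    ultimately show "\<exists>w w'. transversal p k l w w' \<and>
        (\<forall>x. on_hyperplane {1..r} w 0 p x \<or> on_hyperplane {1..r} w' 0 p x \<longrightarrow> p dvd mpoly_eval F x)"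
      using W(4)[OF p(1) _ p(3)] W'(4)[OF p(1) _ p(3)] by blast
  qed (use h(1) kl in auto)
qed

lemma norm_form_bound:
  fixes K :: "'a::field_char_0 set"
  assumes K: "number_field K" and deg: "field_degree K = r" and F: "is_norm_form K F"
  obtains B where "B \<ge> 0" "\<And>N a. (\<And>i. i \<in> {1..r} \<Longrightarrow> a i \<in> {1..int N}) \<Longrightarrow> \<bar>real_of_int (mpoly_eval F a)\<bar> \<le> B * real N ^ r"
proof -
  obtain \<omega> b \<Delta> M where nf: "\<And>k. k \<in> {1..r} \<Longrightarrow> \<omega> k \<in> K" "K \<subseteq> rat_vs.span (\<omega> ` {1..r})"
    "\<And>i. i < r \<Longrightarrow> b i \<in> K \<and> b i \<noteq> 0" "(\<Delta>::int) > 0"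
    "\<And>k j. k \<in> {1..r} \<Longrightarrow> j < r \<Longrightarrow> of_int \<Delta> * (\<omega> k * b j) = (\<Sum>i<r. of_int (M k i j) * b i)"
    "\<And>x. det (mat r r (\<lambda>(i, j). \<Sum>k=1..r. x k * M k i j)) = \<Delta> ^ r * mpoly_eval F x"
    by (rule norm_form_integral_matrix[OF K deg F]) blast
  define c where "c = (\<Sum>i<r. \<Sum>j<r. \<Sum>k=1..r. \<bar>real_of_int (M k i j)\<bar>)"
  have c0: "c \<ge> 0" by (simp add: c_def sum_nonneg)
  have "\<bar>real_of_int (mpoly_eval F a)\<bar> \<le> (fact r * c ^ r) * real N ^ r"
    if a: "\<And>i. i \<in> {1..r} \<Longrightarrow> a i \<in> {1..int N}" for a N
  proof -
    let ?A = "mat r r (\<lambda>(i, j). \<Sum>k=1..r. a k * M k i j)"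
    have entry: "\<bar>real_of_int (?A $$ (i, j))\<bar> \<le> c * real N" if ij: "i < r" "j < r" for i j
    proof -
      have "\<bar>real_of_int (?A $$ (i, j))\<bar> = \<bar>\<Sum>k=1..r. real_of_int (a k) * real_of_int (M k i j)\<bar>" using ij by simp
      also have "\<dots> \<le> (\<Sum>k=1..r. \<bar>real_of_int (a k) * real_of_int (M k i j)\<bar>)" by (rule sum_abs)
      also have "\<dots> \<le> (\<Sum>k=1..r. \<bar>real_of_int (M k i j)\<bar> * real N)"
      proof (rule sum_mono)
        fix k assume "k \<in> {1..r}"
        then have "\<bar>real_of_int (a k)\<bar> \<le> real N" using a[of k] by auto
        then show "\<bar>real_of_int (a k) * real_of_int (M k i j)\<bar> \<le> \<bar>real_of_int (M k i j)\<bar> * real N"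
          by (simp add: abs_mult mult.commute mult_right_mono)
      qed
      also have "\<dots> = (\<Sum>k=1..r. \<bar>real_of_int (M k i j)\<bar>) * real N" by (simp add: sum_distrib_right)
      also have "\<dots> \<le> (\<Sum>j<r. \<Sum>k=1..r. \<bar>real_of_int (M k i j)\<bar>) * real N"
        using ij by (intro mult_right_mono member_le_sum) (auto intro!: sum_nonneg)
      also have "\<dots> \<le> c * real N" unfolding c_def
        using ij by (intro mult_right_mono member_le_sum[of i "{..<r}" "\<lambda>i. \<Sum>j<r. \<Sum>k=1..r. \<bar>real_of_int (M k i j)\<bar>"]) (auto intro!: sum_nonneg)
      finally show ?thesis .
    qed
    have "\<bar>real_of_int (mpoly_eval F a)\<bar> = 1 * \<bar>real_of_int (mpoly_eval F a)\<bar>" by simp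
    also have "\<dots> \<le> real_of_int (\<Delta> ^ r) * \<bar>real_of_int (mpoly_eval F a)\<bar>"
      using nf(4) by (intro mult_right_mono) (simp_all add: one_le_power)
    also have "\<dots> = \<bar>real_of_int (det ?A)\<bar>" unfolding nf(6) using nf(4) by (simp add: abs_mult)
    also have "\<dots> \<le> fact r * (c * real N) ^ r" by (rule abs_det_le) (use entry in auto)
    finally show ?thesis by (simp add: power_mult_distrib mult.assoc)
  qed
  then show thesis using that[of "fact r * c ^ r"] c0 by simp
qed

text \<open>With \<open>L = ln N\<close> and \<open>n\<close> between \<open>L powr (1 / \<kappa>)\<close> and twice that there are at least \<open>L\<close> elements of \<open>G\<close> up to
\<open>n ^ D\<close>.  Since \<open>D * ln n\<close> is at most \<open>ln L / a\<close>, the product of any \<open>a * L / ln L\<close> of them is at most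
\<open>exp L = N\<close>.\<close>

lemma many_primes_with_small_product:
  fixes G :: "int set" and \<kappa> :: real and D :: nat
  assumes G: "\<And>p. p \<in> G \<Longrightarrow> prime p" and \<kappa>: "\<kappa> > 0" and D: "D \<ge> 1"
    and dense: "\<forall>\<^sub>F n in sequentially. real n powr \<kappa> \<le> real (card {p \<in> G. p \<le> int n ^ D})"
  shows "\<exists>a>0. \<forall>\<^sub>F N in sequentially. \<exists>P. P \<subseteq> G \<and> finite P \<and> \<Prod>P \<le> int N \<and>
           real (card P) \<ge> a * (ln (real N) / ln (ln (real N))) - 1"
proof -
  define s where "s = 1 / \<kappa>"
  have s0: "s > 0" using \<kappa> by (simp add: s_def)
  define a where "a = 1 / (real D * (s + 1))"
  have a0: "a > 0" using s0 D by (simp add: a_def)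
  obtain n0 where n0: "\<And>n. n \<ge> n0 \<Longrightarrow> real n powr \<kappa> \<le> real (card {p \<in> G. p \<le> int n ^ D})"
    using dense unfolding eventually_sequentially by blast
  have "filterlim (\<lambda>N. ln (real N)) at_top sequentially" by real_asymp
  then have ev1: "\<forall>\<^sub>F N in sequentially. exp 1 + real n0 powr \<kappa> \<le> ln (real N)" by (simp only: filterlim_at_top)
  have "\<forall>\<^sub>F N in sequentially. \<exists>P. P \<subseteq> G \<and> finite P \<and> \<Prod>P \<le> int N \<and>
           real (card P) \<ge> a * (ln (real N) / ln (ln (real N))) - 1"
    using ev1 eventually_gt_at_top[of 0]
  proof eventually_elim
    case (elim N)
    define L where "L = ln (real N)"
    have L: "L \<ge> exp 1" "L \<ge> real n0 powr \<kappa>" 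
      using elim(1) powr_ge_zero[of "real n0" \<kappa>] exp_gt_zero[of "1::real"] unfolding L_def by linarith+
    have L1: "L > 1" using L(1) exp_gt_one[of 1] by linarith
    have lnL: "ln L \<ge> 1" using L(1) L1 by (simp add: ln_ge_iff)
    define n where "n = nat \<lceil>L powr s\<rceil>"
    have Ls1: "L powr s \<ge> 1" using L1 s0 by (simp add: ge_one_powr_ge_zero)
    have nL: "L powr s \<le> real n" unfolding n_def by (simp add: of_nat_ceiling)
    have nU: "real n \<le> 2 * L powr s"
    proof -
      have "real n = real_of_int \<lceil>L powr s\<rceil>" unfolding n_def using Ls1 by simp
      also have "\<dots> \<le> L powr s + 1" by linarith
      finally show ?thesis using Ls1 by linarith
    qed
    have n1: "real n \<ge> 1" using nL Ls1 by linarith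
    have "real n0 \<le> real n"
    proof (cases "n0 = 0")
      case False
      have "real n0 = (real n0 powr \<kappa>) powr s" using \<kappa> False by (simp add: powr_powr s_def)
      also have "\<dots> \<le> L powr s" using L(2) s0 by (intro powr_mono2) auto
      finally show ?thesis using nL by linarith
    qed simp
    then have "real n powr \<kappa> \<le> real (card {p \<in> G. p \<le> int n ^ D})" using n0[of n] by simp
    moreover have "L \<le> real n powr \<kappa>"
    proof -
      have "L = (L powr s) powr \<kappa>" using \<kappa> L1 by (simp add: powr_powr s_def)
      also have "\<dots> \<le> real n powr \<kappa>" using nL \<kappa> by (intro powr_mono2) auto
      finally show ?thesis .
    qed
    ultimately have cnt: "L \<le> real (card {p \<in> G. p \<le> int n ^ D})" by linarith
    have ln_n: "1 \<le> ln (real n) + 1" "ln (real n) \<le> (s + 1) * ln L"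
    proof -
      show "1 \<le> ln (real n) + 1" using n1 by simp
      have "ln (real n) \<le> ln (2 * L powr s)" using nU n1 by (intro ln_mono) auto
      also have "\<dots> = ln 2 + s * ln L" using L1 by (simp add: ln_mult ln_powr)
      also have "ln 2 \<le> ln L" using lnL ln_2_less_1 by linarith
      finally show "ln (real n) \<le> (s + 1) * ln L" by (simp add: algebra_simps)
    qed
    define z where "z = a * (L / ln L)"
    have z0: "z \<ge> 0" using a0 L1 lnL by (simp add: z_def)
    define k where "k = nat \<lfloor>z\<rfloor>"
    have kz: "real k \<le> z" "z - 1 \<le> real k" unfolding k_def using z0 by linarith+
    have a1: "a \<le> 1"
    proof -
      have "1 * 1 \<le> real D * (s + 1)" using D s0 by (intro mult_mono) auto
      then show ?thesis unfolding a_def by simp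
    qed
    have "z \<le> 1 * (L / 1)" unfolding z_def using a1 a0 lnL L1 by (intro mult_mono divide_left_mono) auto
    then have "k \<le> card {p \<in> G. p \<le> int n ^ D}" using kz cnt by linarith
    then obtain P where P: "P \<subseteq> {p \<in> G. p \<le> int n ^ D}" "card P = k" "finite P"
      by (rule obtain_subset_with_card_n)
    have "real_of_int (\<Prod>P) = (\<Prod>p\<in>P. real_of_int p)" by simp
    also have "\<dots> \<le> (\<Prod>p\<in>P. real n ^ D)"
    proof (rule prod_mono, rule conjI)
      fix p assume p: "p \<in> P"
      then have "p \<ge> 0" using P(1) G by (force intro: prime_ge_0_int)
      then show "0 \<le> real_of_int p" by simp
      have "p \<le> int n ^ D" using p P(1) by blast
      then have "real_of_int p \<le> real_of_int (int n ^ D)" by (simp only: of_int_le_iff)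
      then show "real_of_int p \<le> real n ^ D" by simp
    qed
    also have "\<dots> = real n ^ (D * k)" using P(2) by (simp add: power_mult)
    also have "\<dots> = exp (real (D * k) * ln (real n))" using n1 by (simp only: exp_of_nat_mult) simp
    also have "\<dots> \<le> exp L"
    proof -
      have "real (D * k) * ln (real n) \<le> real D * real k * ((s + 1) * ln L)"
        using ln_n by (simp only: of_nat_mult) (intro mult_left_mono, auto)
      also have "\<dots> \<le> real D * z * ((s + 1) * ln L)"
        using kz s0 lnL by (intro mult_right_mono mult_left_mono) auto
      also have "\<dots> = L" unfolding z_def a_def using D s0 lnL by simp
      finally show ?thesis by simp
    qed
    also have "\<dots> = real N" unfolding L_def using elim(2) by simp
    finally have "real_of_int (\<Prod>P) \<le> real_of_int (int N)" by simp
    then have "\<Prod>P \<le> int N" by (simp only: of_int_le_iff)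
    then show ?case using P kz(2) unfolding z_def L_def by (intro exI[of _ P]) auto
  qed
  then show ?thesis using a0 by blast
qed

section \<open>The bound for product sets\<close>

theorem theorem1p11:
  fixes K :: "'a::field_char_0 set" and F :: int_mpoly and r :: nat
  assumes "number_field K" and "field_degree K = r" and "r \<ge> 2"
    and "is_norm_form K F"
  shows "\<exists>c C :: real. c > 0 \<and> C > 0 \<and>
    (\<forall>N :: nat. N \<ge> 3 \<longrightarrow>
      (\<forall>(A :: nat \<Rightarrow> int set) (g :: real).
        (\<forall>i\<in>{1..r}. A i \<subseteq> {1..int N}) \<longrightarrow> g \<ge> 1 \<longrightarrow>
        (\<forall>m :: int. real (rep_count r A F m) \<le> g) \<longrightarrow>
        (\<Prod>i=1..r. real (card (A i)))
          \<le> C * g powr (1 / real r) * real N ^ r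
              * exp (- c * (ln (real N) / ln (ln (real N))))))"
proof -
  have K: "number_field K" and deg: "field_degree K = r" and r: "r \<ge> 2" and F: "is_norm_form K F" by fact+
  obtain h E k l where h: "degree h \<ge> 1" "finite E" "k \<in> {1..r}" "l \<in> {1..r}" "k \<noteq> l"
    "\<And>p n. prime p \<Longrightarrow> p \<notin> E \<Longrightarrow> p dvd poly h n \<Longrightarrow> \<not> p dvd poly (pderiv h) n"
    "\<And>p n. prime p \<Longrightarrow> p \<notin> E \<Longrightarrow> p dvd poly h n \<Longrightarrow> \<exists>w w'. transversal p k l w w' \<and>
        (\<forall>x. on_hyperplane {1..r} w 0 p x \<or> on_hyperplane {1..r} w' 0 p x \<longrightarrow> p dvd mpoly_eval F x)"
    using norm_form_hyperplanes[OF K deg r F] by blast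
  obtain B where B: "B \<ge> 0" "\<And>N a. (\<And>i. i \<in> {1..r} \<Longrightarrow> a i \<in> {1..int N}) \<Longrightarrow> \<bar>real_of_int (mpoly_eval F a)\<bar> \<le> B * real N ^ r"
    using norm_form_bound[OF K deg F] by blast
  define E' where "E' = E \<union> {p. prime p \<and> p < 100}"
  have "finite {p :: int. prime p \<and> p < 100}"
    by (rule finite_subset[of _ "{0..100}"]) (auto simp: prime_ge_0_int)
  then have finE': "finite E'" using h(2) by (simp add: E'_def)
  define G where "G = {p. prime p \<and> p \<notin> E' \<and> (\<exists>j. p dvd poly h j)}"
  have "\<forall>\<^sub>F n in sequentially. real n powr (1 / (65 * real (degree h))) \<le> real (card {p \<in> G. p \<le> int n ^ (degree h + 1)})"
  proof -
    have "{p \<in> G. p \<le> int n ^ (degree h + 1)} = {p. prime p \<and> p \<le> int n ^ (degree h + 1) \<and> p \<notin> E' \<and> (\<exists>j. p dvd poly h j)}" for n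
      by (auto simp: G_def)
    then show ?thesis using many_primes_outside_finite_set[OF h(1) finE'] h(6) by (simp add: E'_def)
  qed
  then obtain a where a: "a > 0" "\<forall>\<^sub>F N in sequentially. \<exists>P. P \<subseteq> G \<and> finite P \<and> \<Prod>P \<le> int N \<and> real (card P) \<ge> a * (ln (real N) / ln (ln (real N))) - 1"
    using many_primes_with_small_product[of G "1 / (65 * real (degree h))" "degree h + 1"] h(1) by (auto simp: G_def)
  have "\<exists>w w'. transversal p k l w w' \<and>
        (\<forall>x. on_hyperplane {1..r} w 0 p x \<or> on_hyperplane {1..r} w' 0 p x \<longrightarrow> p dvd mpoly_eval F x)" if "p \<in> G" for p
    using that h(7) by (auto simp: G_def E'_def)
  then obtain w w' where ww: "\<And>p. p \<in> G \<Longrightarrow> transversal p k l (w p) (w' p)"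
     "\<And>p x. p \<in> G \<Longrightarrow> on_hyperplane {1..r} (w p) 0 p x \<or> on_hyperplane {1..r} (w' p) 0 p x \<Longrightarrow> p dvd mpoly_eval F x"
    by metis
  have G: "prime p \<and> p \<ge> 100 \<and> transversal p k l (w p) (w' p)" if "p \<in> G" for p
    using that ww(1)[OF that] by (auto simp: G_def E'_def)
  define Y where "Y N = ln (real N) / ln (ln (real N))" for N
  define q where "q = ln (203 / 202 :: real)"
  have q: "q > 0" by (simp add: q_def)
  define C1 where "C1 = 2 ^ r * (2 * B + 1) * exp q"
  have C1: "C1 > 0" using B(1) by (simp add: C1_def)
  define c where "c = q * a / real r"
  have c0: "c > 0" using q a(1) r by (simp add: c_def)
  obtain N0 where N0: "\<And>N. N \<ge> N0 \<Longrightarrow> \<exists>P. P \<subseteq> G \<and> finite P \<and> \<Prod>P \<le> int N \<and> real (card P) \<ge> a * Y N - 1"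
    using a(2) unfolding eventually_sequentially Y_def by blast
  define C where "C = C1 powr (1 / real r) + (\<Sum>N<N0. exp (c * Y N))"
  have C0: "C > 0" unfolding C_def using C1 by (intro add_pos_nonneg sum_nonneg) auto
  have main: "(\<Prod>i=1..r. real (card (A i))) \<le> C * g powr (1 / real r) * real N ^ r * exp (- c * Y N)"
    if N: "N \<ge> 3" and A: "\<forall>i\<in>{1..r}. A i \<subseteq> {1..int N}" and g: "g \<ge> 1" and reps: "\<forall>m. real (rep_count r A F m) \<le> g" for N A g
  proof -
    define S where "S = (\<Prod>i=1..r. real (card (A i)))"
    have S0: "S \<ge> 0" by (simp add: S_def prod_nonneg)
    have cA: "real (card (A i)) \<le> real N" if "i \<in> {1..r}" for i
      using card_mono[of "{1..int N}" "A i"] A that by auto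
    have "S \<le> (\<Prod>i=1..r. real N)" unfolding S_def by (intro prod_mono) (use cA in auto)
    then have S1: "S \<le> real N ^ r" by simp
    have Nr: "real N ^ r > 0" using N by simp
    have g1: "g powr (1 / real r) \<ge> 1" using g by (simp add: ge_one_powr_ge_zero)
    have "S \<le> C * g powr (1 / real r) * real N ^ r * exp (- c * Y N)"
    proof (cases "N < N0")
      case True
      \<comment> \<open>The finitely many small \<open>N\<close> are absorbed into the constant \<open>C\<close>, using only \<open>S \<le> N ^ r\<close>.\<close>
      have "exp (c * Y N) \<le> (\<Sum>N<N0. exp (c * Y N))" using True by (intro member_le_sum) auto
      then have "exp (c * Y N) \<le> C" using C1 by (simp add: C_def add_increasing)
      then have "exp (c * Y N) * 1 \<le> C * g powr (1 / real r)" using g1 C0 by (intro mult_mono) auto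
      then have "exp (c * Y N) * (real N ^ r * exp (- c * Y N)) \<le> C * g powr (1 / real r) * (real N ^ r * exp (- c * Y N))"
        by (intro mult_right_mono) auto
      then have "real N ^ r * (exp (c * Y N) * exp (- c * Y N)) \<le> C * g powr (1 / real r) * real N ^ r * exp (- c * Y N)"
        by (simp add: mult_ac)
      then show ?thesis using S1 by (simp add: exp_minus)
    next
      case False
      then obtain P where P: "P \<subseteq> G" "finite P" "\<Prod>P \<le> int N" "real (card P) \<ge> a * Y N - 1" using N0[of N] by auto
      have "S\<^sup>2 \<le> 2 ^ card {1..r} * (2 * B + 1) * g * (real N ^ card {1..r})\<^sup>2 * (202/203) ^ card P"
        unfolding S_def
      proof (rule product_set_bound[OF _ h(3,4,5) P(2) _ _ _ P(3) _ B(1)])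
        show "prime p \<and> 100 \<le> p \<and> transversal p k l (w p) (w' p)" if "p \<in> P" for p using G P(1) that by blast
        show "p dvd mpoly_eval F x" if "p \<in> P" "on_hyperplane {1..r} (w p) 0 p x \<or> on_hyperplane {1..r} (w' p) 0 p x" for p x
          using ww(2) P(1) that by blast
        show "A i \<subseteq> {1..int N}" if "i \<in> {1..r}" for i using A that by blast
        show "\<bar>real_of_int (mpoly_eval F x)\<bar> \<le> B * real N ^ card {1..r}" if "x \<in> Pi\<^sub>E {1..r} A" for x
          using B(2)[of x N] that A by (simp add: PiE_iff subset_iff)
        show "real (card {x \<in> Pi\<^sub>E {1..r} A. mpoly_eval F x = m}) \<le> g" for m
          using reps by (simp add: rep_count_def)
      qed (use N in auto)
      then have S2: "S\<^sup>2 \<le> 2 ^ r * (2 * B + 1) * g * (real N ^ r)\<^sup>2 * (202/203) ^ card P" by simp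
      have "(202/203::real) ^ card P = exp (- q * real (card P))"
      proof -
        have "(202/203::real) = exp (- q)" by (simp add: q_def exp_minus)
        moreover have "exp (real (card P) * - q) = exp (- q) ^ card P" by (rule exp_of_nat_mult)
        ultimately show ?thesis by (simp only: mult.commute)
      qed
      also have "\<dots> \<le> exp (q - q * a * Y N)"
        using mult_left_mono[OF P(4), of q] q by (simp add: algebra_simps)
      also have "\<dots> = exp q * exp (- (q * a * Y N))" by (simp add: exp_diff exp_minus field_simps)
      finally have "2 ^ r * (2 * B + 1) * g * (real N ^ r)\<^sup>2 * (202/203) ^ card P
          \<le> 2 ^ r * (2 * B + 1) * g * (real N ^ r)\<^sup>2 * (exp q * exp (- (q * a * Y N)))"
        using B(1) g by (intro mult_left_mono) auto
      with S2 have S3: "S\<^sup>2 \<le> C1 * g * exp (- (q * a * Y N)) * (real N ^ r)\<^sup>2"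
        by (simp add: C1_def mult_ac)
      define \<delta> where "\<delta> = S / real N ^ r"
      have d: "\<delta> \<ge> 0" "\<delta> \<le> 1" using S0 S1 Nr by (auto simp: \<delta>_def)
      have d2: "\<delta>\<^sup>2 \<le> C1 * g * exp (- (q * a * Y N))"
        using S3 Nr by (simp add: \<delta>_def power_divide divide_le_eq)
      \<comment> \<open>Here \<open>2 / r \<le> 1\<close> and \<open>\<delta> \<le> 1\<close> are used.\<close>
      have "\<delta> \<le> (\<delta>\<^sup>2) powr (1 / real r)"
      proof (cases "\<delta> = 0")
        case False
        then have "\<delta> > 0" using d by simp
        have "(\<delta>\<^sup>2) powr (1 / real r) = \<delta> powr (2 / real r)"
          using \<open>\<delta> > 0\<close> by (simp add: powr_powr flip: powr_numeral)
        moreover have "\<delta> powr 1 \<le> \<delta> powr (2 / real r)"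
          using \<open>\<delta> > 0\<close> d(2) r by (intro powr_mono') auto
        ultimately show ?thesis using \<open>\<delta> > 0\<close> by simp
      qed simp
      also have "\<dots> \<le> (C1 * g * exp (- (q * a * Y N))) powr (1 / real r)"
        using d2 by (intro powr_mono2) auto
      also have "\<dots> = C1 powr (1 / real r) * g powr (1 / real r) * exp (- c * Y N)"
        using C1 g by (simp add: powr_mult exp_powr_real c_def)
      also have "\<dots> \<le> C * g powr (1 / real r) * exp (- c * Y N)"
        unfolding C_def by (intro mult_right_mono) (auto simp: sum_nonneg)
      finally have "\<delta> * real N ^ r \<le> C * g powr (1 / real r) * exp (- c * Y N) * real N ^ r"
        using Nr by (intro mult_right_mono) auto
      moreover have "\<delta> * real N ^ r = S" using N unfolding \<delta>_def by simp
      ultimately show ?thesis by (simp only: mult_ac)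
    qed
    then show ?thesis by (simp only: S_def)
  qed
  show ?thesis
    by (rule exI[of _ c], rule exI[of _ C], intro conjI c0 C0 allI impI, rule main[unfolded Y_def]) assumption+
qed

end
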